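(* Let $V$ be a valuation domain with quotient field $K$, and let $U$ be a fixed extension of $V$ to an algebraic closure $\overline{K}$ of $K$, with valuation $u$. Let $\mathcal{B}_u$ be the set of balls $B_u(\alpha,\delta)=\{x\in\overline{K}:u(x-\alpha)\ge\delta\}$ with $(\alpha,\delta)\in\overline{K}\times\Gamma_{\overline{v}}$, on which $\mathcal{D}(U)$ acts by $\sigma(B_u(\alpha,\delta))=B_u(\sigma(\alpha),\delta)$, and let $\mathcal{B}_u/\mathcal{D}(U)$ be the set of orbits. Let $\mathcal{W}_{\mathrm{rt}}$ be the set of residually transcendental extensions of $V$ to $K(X)$. Then the map $\Theta:\mathcal{B}_u/\mathcal{D}(U)\to\mathcal{W}_{\mathrm{rt}}$, $[B_u(\alpha,\delta)]\mapsto U_{\alpha,\delta}\cap K(X)$, is well defined and bijective.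
   Context: $v$ is the valuation of $V$, $\Gamma_v$ its value group and $\Gamma_{\overline{v}}=\Gamma_v\otimes_{\mathbb{Z}}\mathbb{Q}$. For $(\alpha,\delta)\in\overline{K}\times\Gamma_{\overline{v}}$, the monomial valuation $u_{\alpha,\delta}$ on $\overline{K}(X)$ is defined on polynomials by $u_{\alpha,\delta}\big(\sum_{i}a_i(X-\alpha)^i\big)=\min_i\{u(a_i)+i\delta\}$ and extended to $\overline{K}(X)$; $U_{\alpha,\delta}$ is its valuation domain. $\mathcal{D}(U)=\{\sigma\in\mathrm{Gal}(\overline{K}/K):\sigma(U)=U\}$. An extension of $V$ to $K(X)$ is a valuation domain $W$ of $K(X)$ with $W\cap K=V$; it is residually transcendental if its residue field is transcendental over the residue field of $V$. *)

theory Defs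
  imports "HOL-Computational_Algebra.Polynomial" "HOL-Computational_Algebra.Fraction_Field"
begin

definition gmul :: "nat \<Rightarrow> 'g::linordered_ab_group_add \<Rightarrow> 'g" where
  "gmul n g = (\<Sum>i<n. g)"

definition subfield_of :: "'a::field set \<Rightarrow> bool" where
  "subfield_of F \<longleftrightarrow> 0 \<in> F \<and> 1 \<in> F \<and>
     (\<forall>x\<in>F. \<forall>y\<in>F. x + y \<in> F \<and> x - y \<in> F \<and> x * y \<in> F) \<and>
     (\<forall>x\<in>F. x \<noteq> 0 \<longrightarrow> inverse x \<in> F)"

definition valuation_ring_of :: "'a::field set \<Rightarrow> 'a set \<Rightarrow> bool" where
  "valuation_ring_of F R \<longleftrightarrow> R \<subseteq> F \<and> 0 \<in> R \<and> 1 \<in> R \<and>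
     (\<forall>x\<in>R. \<forall>y\<in>R. x + y \<in> R \<and> x - y \<in> R \<and> x * y \<in> R) \<and>
     (\<forall>x\<in>F. x \<noteq> 0 \<longrightarrow> x \<in> R \<or> inverse x \<in> R)"

definition max_ideal :: "'a::field set \<Rightarrow> 'a set" where
  "max_ideal R = {x \<in> R. x = 0 \<or> inverse x \<notin> R}"

(* u is a (Krull) valuation on the field 'k with valuation ring U; u 0 is irrelevant (infinity) *)
definition is_valuation_of :: "('k::field \<Rightarrow> 'g::linordered_ab_group_add) \<Rightarrow> 'k set \<Rightarrow> bool" where
  "is_valuation_of u U \<longleftrightarrow>
     (\<forall>x y. x \<noteq> 0 \<longrightarrow> y \<noteq> 0 \<longrightarrow> u (x * y) = u x + u y) \<and>
     (\<forall>x y. x \<noteq> 0 \<longrightarrow> y \<noteq> 0 \<longrightarrow> x + y \<noteq> 0 \<longrightarrow> min (u x) (u y) \<le> u (x + y)) \<and>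
     U = {x. x = 0 \<or> 0 \<le> u x}"

definition alg_closed :: "'k::field itself \<Rightarrow> bool" where
  "alg_closed _ \<longleftrightarrow> (\<forall>p::'k poly. degree p > 0 \<longrightarrow> (\<exists>x. poly p x = 0))"

definition algebraic_over :: "'k::field set \<Rightarrow> bool" where
  "algebraic_over K \<longleftrightarrow> (\<forall>x::'k. \<exists>p. p \<noteq> 0 \<and> (\<forall>i. coeff p i \<in> K) \<and> poly p x = 0)"

(* Gamma_vbar = Gamma_v \<otimes> Q, realised as the divisible hull of u of K-nonzero inside the group of u *)
definition Gamma_bar :: "('k::field \<Rightarrow> 'g::linordered_ab_group_add) \<Rightarrow> 'k set \<Rightarrow> 'g set" where
  "Gamma_bar u K = {d. \<exists>n>0. gmul n d \<in> u ` (K - {0})}"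

definition Gal :: "'k::field set \<Rightarrow> ('k \<Rightarrow> 'k) set" where
  "Gal K = {\<sigma>. bij \<sigma> \<and> (\<forall>x y. \<sigma> (x + y) = \<sigma> x + \<sigma> y \<and> \<sigma> (x * y) = \<sigma> x * \<sigma> y)
              \<and> \<sigma> 1 = 1 \<and> (\<forall>c\<in>K. \<sigma> c = c)}"

definition decomp_group :: "'k::field set \<Rightarrow> 'k set \<Rightarrow> ('k \<Rightarrow> 'k) set" where
  "decomp_group K U = {\<sigma> \<in> Gal K. \<sigma> ` U = U}"

definition ball_u :: "('k::field \<Rightarrow> 'g::linordered_ab_group_add) \<Rightarrow> 'k \<Rightarrow> 'g \<Rightarrow> 'k set" where
  "ball_u u \<alpha> \<delta> = {x. x = \<alpha> \<or> \<delta> \<le> u (x - \<alpha>)}"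

definition balls_u :: "('k::field \<Rightarrow> 'g::linordered_ab_group_add) \<Rightarrow> 'k set \<Rightarrow> 'k set set" where
  "balls_u u K = {ball_u u \<alpha> \<delta> | \<alpha> \<delta>. \<delta> \<in> Gamma_bar u K}"

definition ball_orbits :: "('k::field \<Rightarrow> 'g::linordered_ab_group_add) \<Rightarrow> 'k set \<Rightarrow> 'k set \<Rightarrow> 'k set set set" where
  "ball_orbits u K U = {{\<sigma> ` B | \<sigma>. \<sigma> \<in> decomp_group K U} | B. B \<in> balls_u u K}"

(* monomial valuation u_{alpha,delta} on a nonzero polynomial: p = sum a_i (X - alpha)^i *)
definition mon_val :: "('k::field \<Rightarrow> 'g::linordered_ab_group_add) \<Rightarrow> 'k \<Rightarrow> 'g \<Rightarrow> 'k poly \<Rightarrow> 'g" where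
  "mon_val u \<alpha> \<delta> p = Min {u (coeff (pcompose p [:\<alpha>, 1:]) i) + gmul i \<delta> | i.
                              coeff (pcompose p [:\<alpha>, 1:]) i \<noteq> 0}"

definition U_ad :: "('k::field \<Rightarrow> 'g::linordered_ab_group_add) \<Rightarrow> 'k \<Rightarrow> 'g \<Rightarrow> 'k poly fract set" where
  "U_ad u \<alpha> \<delta> = {f. \<exists>p q. q \<noteq> 0 \<and> f = Fract p q \<and> (p = 0 \<or> mon_val u \<alpha> \<delta> q \<le> mon_val u \<alpha> \<delta> p)}"

definition KX :: "'k::field set \<Rightarrow> 'k poly fract set" where
  "KX K = {Fract p q | p q. q \<noteq> 0 \<and> (\<forall>i. coeff p i \<in> K) \<and> (\<forall>i. coeff q i \<in> K)}"

definition const_fr :: "'k::field \<Rightarrow> 'k poly fract" where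
  "const_fr c = Fract [:c:] 1"

definition extensions :: "'k::field set \<Rightarrow> 'k set \<Rightarrow> 'k poly fract set set" where
  "extensions K V = {W. valuation_ring_of (KX K) W \<and> (\<forall>c\<in>K. const_fr c \<in> W \<longleftrightarrow> c \<in> V)}"

(* residually transcendental: some t in W whose residue is transcendental over the residue field of V *)
definition res_transc :: "'k::field set \<Rightarrow> 'k set \<Rightarrow> 'k poly fract set \<Rightarrow> bool" where
  "res_transc K V W \<longleftrightarrow> (\<exists>t\<in>W. \<forall>p::'k poly. (\<forall>i. coeff p i \<in> V) \<longrightarrow>
       (\<exists>i. coeff p i \<notin> max_ideal V) \<longrightarrow>
       (\<Sum>i\<le>degree p. const_fr (coeff p i) * t ^ i) \<notin> max_ideal W)"

definition W_rt :: "'k::field set \<Rightarrow> 'k set \<Rightarrow> 'k poly fract set set" where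
  "W_rt K V = {W \<in> extensions K V. res_transc K V W}"

definition Theta :: "('k::field \<Rightarrow> 'g::linordered_ab_group_add) \<Rightarrow> 'k set \<Rightarrow> 'k set set \<Rightarrow> 'k poly fract set" where
  "Theta u K Ob = the_elem {U_ad u \<alpha> \<delta> \<inter> KX K | \<alpha> \<delta>. \<delta> \<in> Gamma_bar u K \<and> ball_u u \<alpha> \<delta> \<in> Ob}"

end

(*  Both directions rest on conjugacy: two valuation rings of an algebraic normal extension L that agree
    on the base field are conjugate.  Let A be the ring of all x whose conjugates lie in W1; it is the
    integral closure of the base valuation ring, so W2 gives the same A, and both Wi are localisations
    of A at primes Pi.  For finitely many elements of P1, the norm of the polynomial having them as
    coefficients has all its coefficients in P2, so by Gauss' lemma some conjugate of the polynomial
    does; a compactness argument produces one automorphism mapping P1 into P2.  Conjugacy is needed both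
    for the algebraic closure over K and for its rational function field over K(X).

    Injectivity: if two monomial valuation rings agree on K(X), the conjugating automorphism restricts
    to an element of the decomposition group and carries one ball to the other.
    Surjectivity: by Chevalley's theorem and conjugacy, a residually transcendental extension of V
    extends to a valuation ring of the large function field lying over U; if the residues of all
    units (X - alpha) / c were constants, then so would be the residues of all units, and a pair
    (alpha, c) with nonconstant residue exhibits the ring as monomial. *)

theory Submission
  imports Defs
begin

subsection \<open>Polynomials over a subring\<close>

text \<open>Every radius \<delta> in \<open>Gamma_bar\<close> is \<open>u c\<close> for some nonzero
  \<open>c\<close>, because roots can be extracted in the algebraic closure. So
  \<open>U_ad u \<alpha> (u c)\<close> is the Gauss valuation ring in the variable Y = (X -
  \<alpha>) / c, and among the valuation rings that lie over \<open>U\<close> and contain Y it is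
  the only one in which Y has transcendental residue. The residue field of \<open>U\<close> is
  algebraically closed, so an algebraic residue is a constant one, and transcendence can be tested
  by subtracting constants. No residue field is ever formed: statements about residues become
  statements about primitive polynomials and the maximal ideal.

  The extensions are not assumed separable, so an element fixed by the Galois group need not lie in
  the base field; only a power of it does. This suffices, since a valuation ring of a field contains
  x as soon as it contains a positive power of x. The Galois group may be infinite, hence norms run
  over the finite set of conjugates of one polynomial.\<close>

definition subring :: "'a::comm_ring_1 set \<Rightarrow> bool" where
  "subring S \<longleftrightarrow> 0 \<in> S \<and> 1 \<in> S \<and> (\<forall>x\<in>S. \<forall>y\<in>S. x + y \<in> S \<and> x - y \<in> S \<and> x * y \<in> S)"

definition polys_in :: "'a::zero set \<Rightarrow> 'a poly set" where
  "polys_in S = {p. \<forall>i. coeff p i \<in> S}"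

definition prime_ideal_of :: "'a::comm_ring_1 set \<Rightarrow> 'a set \<Rightarrow> bool" where
  "prime_ideal_of S M \<longleftrightarrow> M \<subseteq> S \<and> 0 \<in> M \<and> 1 \<notin> M \<and> (\<forall>x\<in>M. \<forall>y\<in>M. x + y \<in> M) \<and>
     (\<forall>x\<in>S. \<forall>y\<in>M. x * y \<in> M) \<and> (\<forall>x\<in>S. \<forall>y\<in>S. x * y \<in> M \<longrightarrow> x \<in> M \<or> y \<in> M)"

lemma
  assumes "subring S"
  shows subring_0: "0 \<in> S" and subring_1: "1 \<in> S"
    and subring_add: "x \<in> S \<Longrightarrow> y \<in> S \<Longrightarrow> x + y \<in> S"
    and subring_diff: "x \<in> S \<Longrightarrow> y \<in> S \<Longrightarrow> x - y \<in> S"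
    and subring_mult: "x \<in> S \<Longrightarrow> y \<in> S \<Longrightarrow> x * y \<in> S"
  using assms by (auto simp: subring_def)

lemma subring_uminus:
  assumes "subring S" "x \<in> S" shows "- x \<in> S"
  using subring_diff[OF assms(1) subring_0[OF assms(1)] assms(2)] by simp

lemma subring_sum:
  assumes "subring S" "\<And>i. i \<in> A \<Longrightarrow> f i \<in> S" shows "sum f A \<in> S"
  using assms(2) by (induction A rule: infinite_finite_induct)
    (auto intro: subring_0[OF assms(1)] subring_add[OF assms(1)])

lemma subring_prod:
  assumes "subring S" "\<And>i. i \<in> A \<Longrightarrow> f i \<in> S" shows "prod f A \<in> S"
  using assms(2) by (induction A rule: infinite_finite_induct)
    (auto intro: subring_1[OF assms(1)] subring_mult[OF assms(1)])

lemma subring_power: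
  assumes "subring S" "x \<in> S" shows "x ^ n \<in> S"
  by (induction n) (auto intro: subring_1[OF assms(1)] subring_mult[OF assms(1)] assms(2))

lemma subring_of_nat:
  assumes "subring S" shows "of_nat n \<in> S"
  by (induction n) (auto intro: subring_0[OF assms] subring_1[OF assms] subring_add[OF assms])

lemma polys_inD: "p \<in> polys_in S \<Longrightarrow> coeff p i \<in> S"
  by (simp add: polys_in_def)

lemma polys_in_pCons [simp]: "pCons a p \<in> polys_in S \<longleftrightarrow> a \<in> S \<and> p \<in> polys_in S"
  unfolding polys_in_def by (auto simp: coeff_pCons split: nat.splits)

lemma polys_in_0: "0 \<in> S \<Longrightarrow> 0 \<in> polys_in S"
  by (simp add: polys_in_def)

lemma polys_in_monom: "0 \<in> S \<Longrightarrow> c \<in> S \<Longrightarrow> monom c n \<in> polys_in S"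
  by (simp add: polys_in_def)

lemma polys_in_mono: "S \<subseteq> T \<Longrightarrow> p \<in> polys_in S \<Longrightarrow> p \<in> polys_in T"
  by (auto simp: polys_in_def)

lemma subring_polys_in:
  assumes "subring S" shows "subring (polys_in S)"
  unfolding subring_def
proof (intro conjI ballI)
  show "0 \<in> polys_in S" by (simp add: polys_in_0 subring_0[OF assms])
  show "1 \<in> polys_in S"
    by (simp add: polys_in_0 subring_0[OF assms] subring_1[OF assms] one_pCons)
  fix p q assume pq: "p \<in> polys_in S" "q \<in> polys_in S"
  show "p + q \<in> polys_in S" "p - q \<in> polys_in S"
    using pq by (auto simp: polys_in_def intro: subring_add[OF assms] subring_diff[OF assms])
  show "p * q \<in> polys_in S"
    using pq by (auto simp: polys_in_def coeff_mult intro!: subring_sum[OF assms] subring_mult[OF assms])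
qed

lemma polys_in_smult: "subring S \<Longrightarrow> c \<in> S \<Longrightarrow> p \<in> polys_in S \<Longrightarrow> smult c p \<in> polys_in S"
  by (auto simp: polys_in_def intro: subring_mult)

lemma subring_poly:
  assumes "subring S" "p \<in> polys_in S" "x \<in> S" shows "poly p x \<in> S"
  using assms(2) by (induction p)
    (auto intro: subring_0[OF assms(1)] subring_add[OF assms(1)] subring_mult[OF assms(1)] assms(3))

lemma prime_ideal_ofD:
  assumes "prime_ideal_of S M"
  shows "M \<subseteq> S" "0 \<in> M" "1 \<notin> M" "x \<in> M \<Longrightarrow> y \<in> M \<Longrightarrow> x + y \<in> M"
    "x \<in> S \<Longrightarrow> y \<in> M \<Longrightarrow> x * y \<in> M" "y \<in> S \<Longrightarrow> x \<in> M \<Longrightarrow> x * y \<in> M"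
    "x \<in> S \<Longrightarrow> y \<in> S \<Longrightarrow> x * y \<in> M \<Longrightarrow> x \<in> M \<or> y \<in> M"
  using assms unfolding prime_ideal_of_def by (auto simp: mult.commute)

lemma prime_ideal_uminus:
  assumes "subring S" "prime_ideal_of S M" "x \<in> M" shows "- x \<in> M"
  using prime_ideal_ofD(5)[OF assms(2) subring_uminus[OF assms(1) subring_1[OF assms(1)]] assms(3)] by simp

lemma prime_ideal_diff:
  assumes "subring S" "prime_ideal_of S M" "x \<in> M" "y \<in> M" shows "x - y \<in> M"
  using prime_ideal_ofD(4)[OF assms(2,3) prime_ideal_uminus[OF assms(1,2,4)]] by simp

lemma prime_ideal_sum:
  assumes "prime_ideal_of S M" "\<And>i. i \<in> A \<Longrightarrow> f i \<in> M" shows "sum f A \<in> M"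
  using assms(2) by (induction A rule: infinite_finite_induct)
    (auto intro: prime_ideal_ofD[OF assms(1)])

text \<open>Take the first coefficients of \<open>p\<close> and \<open>q\<close> outside
  \<open>M\<close>, at indices \<open>i\<close> and \<open>j\<close>. In coefficient
  \<open>i + j\<close> of the product every other summand has a factor of smaller index and so lies
  in \<open>M\<close>.\<close>

lemma gauss_lemma:
  assumes S: "subring S" and M: "prime_ideal_of S M" and p: "p \<in> polys_in S" and q: "q \<in> polys_in S"
    and pq: "p * q \<in> polys_in M"
  shows "p \<in> polys_in M \<or> q \<in> polys_in M"
proof (rule ccontr)
  note Md = prime_ideal_ofD[OF M]
  assume "\<not> ?thesis"
  then have ex: "\<exists>i. coeff p i \<notin> M" "\<exists>i. coeff q i \<notin> M" by (auto simp: polys_in_def)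
  define i where "i = (LEAST i. coeff p i \<notin> M)"
  define j where "j = (LEAST i. coeff q i \<notin> M)"
  have i: "coeff p i \<notin> M" "\<And>k. k < i \<Longrightarrow> coeff p k \<in> M"
    unfolding i_def by (rule LeastI_ex[OF ex(1)]) (use not_less_Least in blast)
  have j: "coeff q j \<notin> M" "\<And>k. k < j \<Longrightarrow> coeff q k \<in> M"
    unfolding j_def by (rule LeastI_ex[OF ex(2)]) (use not_less_Least in blast)
  have "(\<Sum>k\<in>{..i+j}-{i}. coeff p k * coeff q (i + j - k)) \<in> M"
  proof (rule prime_ideal_sum[OF M])
    fix k assume "k \<in> {..i+j}-{i}"
    then consider "k < i" | "i + j - k < j" by force
    then show "coeff p k * coeff q (i + j - k) \<in> M"
      by cases (auto intro: Md i j polys_inD[OF p] polys_inD[OF q])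
  qed
  moreover have "coeff (p * q) (i + j)
      = coeff p i * coeff q j + (\<Sum>k\<in>{..i+j}-{i}. coeff p k * coeff q (i + j - k))"
    unfolding coeff_mult by (subst sum.remove[of _ i]) auto
  ultimately have "coeff p i * coeff q j \<in> M"
    using prime_ideal_diff[OF S M polys_inD[OF pq, of "i + j"]] by fastforce
  then show False using Md(7) i(1) j(1) polys_inD[OF p] polys_inD[OF q] by blast
qed

lemma gauss_lemma_prod:
  assumes S: "subring S" and M: "prime_ideal_of S M"
    and f: "\<And>i. i \<in> A \<Longrightarrow> f i \<in> polys_in S" "\<And>i. i \<in> A \<Longrightarrow> f i \<notin> polys_in M"
  shows "prod f A \<notin> polys_in M"
  using f
proof (induction A rule: infinite_finite_induct)
  case (insert a A)
  have "prod f A \<in> polys_in S" using insert by (auto intro: subring_prod[OF subring_polys_in[OF S]])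
  with insert gauss_lemma[OF S M, of "f a" "prod f A"] show ?case by auto
qed (use prime_ideal_ofD[OF M] in \<open>auto simp: one_pCons\<close>)

lemma polys_in_ideal_mult:
  assumes M: "prime_ideal_of S M" and p: "p \<in> polys_in M" and q: "q \<in> polys_in S"
  shows "p * q \<in> polys_in M"
  using p q unfolding polys_in_def
  by (auto simp: coeff_mult intro!: prime_ideal_sum[OF M] prime_ideal_ofD(6)[OF M])

subsection \<open>Valuation rings\<close>

lemma
  assumes "valuation_ring_of F R"
  shows valuation_ring_subring: "subring R"
    and valuation_ring_subset: "R \<subseteq> F"
    and valuation_ring_cases: "x \<in> F \<Longrightarrow> x \<in> R \<or> inverse x \<in> R"
  using assms by (auto simp: valuation_ring_of_def subring_def)

lemma subfield_subring: "subfield_of F \<Longrightarrow> subring F"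
  by (auto simp: subfield_of_def subring_def)

lemma subfield_UNIV: "subfield_of UNIV"
  by (simp add: subfield_of_def)

lemma subfield_inverse: "subfield_of F \<Longrightarrow> x \<in> F \<Longrightarrow> inverse x \<in> F"
  by (cases "x = 0") (auto simp: subfield_of_def)

lemma subfield_divide: "subfield_of F \<Longrightarrow> x \<in> F \<Longrightarrow> y \<in> F \<Longrightarrow> x / y \<in> F"
  unfolding divide_inverse by (blast intro: subring_mult subfield_subring subfield_inverse)

lemma max_ideal_iff: "x \<in> max_ideal R \<longleftrightarrow> x \<in> R \<and> (x = 0 \<or> inverse x \<notin> R)"
  by (simp add: max_ideal_def)

text \<open>Closure under addition is where the valuation property enters: for nonzero x and y one
  of x / y and y / x lies in \<open>R\<close>, so x + y is an \<open>R\<close>-multiple of y or of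
  x.\<close>

lemma prime_max_ideal:
  assumes F: "subfield_of F" and R: "valuation_ring_of F R"
  shows "prime_ideal_of R (max_ideal R)"
  unfolding prime_ideal_of_def
proof (intro conjI ballI impI)
  note S = valuation_ring_subring[OF R]
  note FS = subfield_subring[OF F]
  have RF: "x \<in> R \<Longrightarrow> x \<in> F" for x using valuation_ring_subset[OF R] by blast
  show "max_ideal R \<subseteq> R" "0 \<in> max_ideal R" "1 \<notin> max_ideal R"
    using subring_0[OF S] subring_1[OF S] by (auto simp: max_ideal_def)
  show mult: "x * y \<in> max_ideal R" if xy: "x \<in> R" "y \<in> max_ideal R" for x y
  proof (rule ccontr)
    assume "x * y \<notin> max_ideal R"
    then have *: "x * y \<noteq> 0" "inverse (x * y) \<in> R"
      using that subring_mult[OF S] by (auto simp: max_ideal_iff)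
    then have "x * inverse (x * y) \<in> R" using that subring_mult[OF S] by blast
    then have "inverse y \<in> R" using *(1) by (simp add: field_simps)
    then show False using that *(1) by (simp add: max_ideal_iff)
  qed
  have 1: "x + y \<in> max_ideal R" if xy: "x \<in> max_ideal R" "y \<in> max_ideal R" "y \<noteq> 0" "x / y \<in> R" for x y
  proof -
    have "x + y = (x / y + 1) * y" using xy(3) by (simp add: field_simps)
    then show ?thesis using mult[OF subring_add[OF S xy(4) subring_1[OF S]] xy(2)] by simp
  qed
  fix x y
  show "x + y \<in> max_ideal R" if xy: "x \<in> max_ideal R" "y \<in> max_ideal R"
  proof (cases "x = 0 \<or> y = 0")
    case True then show ?thesis using xy by auto
  next
    case False
    have "x \<in> F" "y \<in> F" using xy RF by (auto simp: max_ideal_iff)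
    then have "x / y \<in> R \<or> y / x \<in> R"
      using valuation_ring_cases[OF R subfield_divide[OF F, of x y]] by auto
    then show ?thesis using 1[of x y] 1[of y x] xy False by (auto simp: add.commute)
  qed
  assume xy: "x \<in> R" "y \<in> R" "x * y \<in> max_ideal R"
  show "x \<in> max_ideal R \<or> y \<in> max_ideal R"
  proof (rule ccontr)
    assume "\<not> ?thesis"
    then have "x \<noteq> 0" "y \<noteq> 0" "inverse x * inverse y \<in> R"
      using xy subring_mult[OF S] by (auto simp: max_ideal_iff)
    then show False using xy(3) by (auto simp: max_ideal_iff)
  qed
qed

abbreviation vring :: "'a::field set \<Rightarrow> bool" where
  "vring \<equiv> valuation_ring_of UNIV"

lemma vring_prime: "vring R \<Longrightarrow> prime_ideal_of R (max_ideal R)"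
  by (rule prime_max_ideal[OF subfield_UNIV])

lemma vring_not_in: "vring R \<Longrightarrow> x \<notin> R \<Longrightarrow> x \<noteq> 0 \<and> inverse x \<in> max_ideal R"
  using valuation_ring_cases[of UNIV R x] subring_0[OF valuation_ring_subring[of UNIV R]]
  by (auto simp: max_ideal_iff)

lemma vring_Int_subfield:
  assumes "vring R" "subfield_of F" shows "valuation_ring_of F (R \<inter> F)"
  using assms by (auto simp: valuation_ring_of_def subfield_of_def)

lemma max_ideal_Int_subfield:
  assumes "subfield_of F" shows "max_ideal (R \<inter> F) = max_ideal R \<inter> F"
  using subfield_inverse[OF assms] by (auto simp: max_ideal_iff)

text \<open>If x were outside \<open>R\<close>, its inverse would lie in \<open>R\<close>, and x is
  x^n times a power of that inverse. This absorbs inseparability: membership of a fixed element is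
  decided by a power of it in the base field.\<close>

lemma vring_power_iff:
  assumes R: "vring R" and n: "n > 0" shows "x ^ n \<in> R \<longleftrightarrow> x \<in> R"
proof
  note S = valuation_ring_subring[OF R]
  assume xn: "x ^ n \<in> R"
  show "x \<in> R"
  proof (rule ccontr)
    assume x: "x \<notin> R"
    then have y: "x \<noteq> 0" "inverse x \<in> R" using vring_not_in[OF R] by (auto simp: max_ideal_iff)
    have "x = x ^ n * inverse x ^ (n - 1)"
      using y(1) n by (cases n) (auto simp: power_inverse)
    then show False using x subring_mult[OF S xn subring_power[OF S y(2)], of "n - 1"] by simp
  qed
qed (rule subring_power[OF valuation_ring_subring[OF R]])

text \<open>For x outside \<open>R\<close>, dividing the relation by x^n writes 1 as a combination
  of positive powers of \<open>inverse x\<close>, an element of the maximal ideal.\<close>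

lemma vring_integrally_closed:
  assumes R: "vring R" and p: "p \<in> polys_in R" "lead_coeff p = 1" "poly p x = 0"
  shows "x \<in> R"
proof (rule ccontr)
  note S = valuation_ring_subring[OF R] note M = vring_prime[OF R]
  assume x: "x \<notin> R"
  then have x0: "x \<noteq> 0" and y: "inverse x \<in> max_ideal R" using vring_not_in[OF R] by auto
  define n where "n = degree p"
  have "0 = (inverse x) ^ n * poly p x" using p by simp
  also have "\<dots> = (\<Sum>i\<le>n. coeff p i * inverse x ^ (n - i))"
    unfolding poly_altdef n_def sum_distrib_left
    using x0 by (intro sum.cong refl) (simp add: power_diff field_simps)
  also have "\<dots> = 1 + (\<Sum>i<n. coeff p i * inverse x ^ (n - i))"
    using p(2) by (simp add: n_def lessThan_Suc_atMost[symmetric])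
  finally have "1 = - (\<Sum>i<n. coeff p i * inverse x ^ (n - i))" by (simp add: eq_neg_iff_add_eq_0)
  moreover have "(\<Sum>i<n. coeff p i * inverse x ^ (n - i)) \<in> max_ideal R"
  proof (rule prime_ideal_sum[OF M])
    fix i assume "i \<in> {..<n}"
    then obtain k where "n - i = Suc k" by (auto dest: less_imp_Suc_add)
    moreover have "inverse x * inverse x ^ k \<in> max_ideal R"
      using y prime_ideal_ofD(1)[OF M] by (auto intro!: prime_ideal_ofD(6)[OF M] subring_power[OF S])
    ultimately show "coeff p i * inverse x ^ (n - i) \<in> max_ideal R"
      using polys_inD[OF p(1)] prime_ideal_ofD(5)[OF M] by auto
  qed
  ultimately show False using prime_ideal_uminus[OF S M] prime_ideal_ofD(3)[OF M] by metis
qed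

text \<open>\<open>k\<close> is the last index at which the value of the coefficients is minimal;
  the strictness beyond \<open>k\<close> is needed in \<open>conj_core_fraction\<close>. In the
  induction the new constant term is either dominated by the old \<open>coeff p k\<close> or
  strictly dominates everything.\<close>

lemma dominant_coeff:
  assumes R: "vring R" and "p \<noteq> 0"
  obtains k where "coeff p k \<noteq> 0" "\<And>j. coeff p j / coeff p k \<in> R"
    "\<And>j. j > k \<Longrightarrow> coeff p j / coeff p k \<in> max_ideal R"
proof -
  note S = valuation_ring_subring[OF R] note M = vring_prime[OF R]
  have "\<exists>k. coeff p k \<noteq> 0 \<and> (\<forall>j. coeff p j / coeff p k \<in> R) \<and>
      (\<forall>j>k. coeff p j / coeff p k \<in> max_ideal R)"
    using assms(2)
  proof (induction p)
    case (pCons a p)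
    show ?case
    proof (cases "p = 0")
      case True
      then show ?thesis using pCons subring_0[OF S] subring_1[OF S] prime_ideal_ofD(2)[OF M]
        by (intro exI[of _ 0]) (auto simp: coeff_pCons split: nat.splits)
    next
      case False
      then obtain k where k: "coeff p k \<noteq> 0" "\<forall>j. coeff p j / coeff p k \<in> R"
        "\<forall>j>k. coeff p j / coeff p k \<in> max_ideal R" using pCons by blast
      show ?thesis
      proof (cases "a / coeff p k \<in> R")
        case True
        then show ?thesis using k
          by (intro exI[of _ "Suc k"]) (auto simp: coeff_pCons split: nat.splits)
      next
        case False
        then have a: "a \<noteq> 0" "coeff p k / a \<in> max_ideal R" using vring_not_in[OF R False] by auto
        have *: "coeff p j / a \<in> max_ideal R" for j
          using prime_ideal_ofD(5)[OF M k(2)[rule_format, of j] a(2)] k(1) by simp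
        show ?thesis using a(1) * prime_ideal_ofD(1)[OF M] subring_1[OF S]
          by (intro exI[of _ 0]) (auto simp: coeff_pCons split: nat.splits)
      qed
    qed
  qed simp
  then show ?thesis using that by blast
qed

text \<open>The scaling factor is recorded as a coefficient of \<open>p\<close>, so that it lies in
  the base field whenever the coefficients of \<open>p\<close> do.\<close>

lemma primitive_scaling:
  assumes R: "vring R" and "p \<noteq> 0"
  obtains c where "c \<noteq> 0" "smult (inverse c) p \<in> polys_in R"
    "smult (inverse c) p \<notin> polys_in (max_ideal R)" "\<exists>k. c = coeff p k"
proof -
  obtain k where k: "coeff p k \<noteq> 0" "\<And>j. coeff p j / coeff p k \<in> R"
    by (rule dominant_coeff[OF assms]) blast
  have "coeff (smult (inverse (coeff p k)) p) k = 1" using k(1) by simp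
  then have "smult (inverse (coeff p k)) p \<notin> polys_in (max_ideal R)"
    using polys_inD[of _ "max_ideal R" k] prime_ideal_ofD(3)[OF vring_prime[OF R]] by metis
  then show ?thesis using k that[of "coeff p k"] by (auto simp: polys_in_def field_simps)
qed

subsection \<open>Chevalley's extension theorem\<close>

text \<open>The ideal generated by \<open>P\<close> in \<open>R\<close>, as finite sums of products
  p * r. The inductive form gives the statements on unions of chains and on adjoining an element by
  rule induction.\<close>

inductive_set ideal_gen :: "'a::comm_ring_1 set \<Rightarrow> 'a set \<Rightarrow> 'a set" for P R where
  ideal_gen_0: "0 \<in> ideal_gen P R"
| ideal_gen_step: "p \<in> P \<Longrightarrow> r \<in> R \<Longrightarrow> x \<in> ideal_gen P R \<Longrightarrow> p * r + x \<in> ideal_gen P R"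

lemma ideal_gen_add: "x \<in> ideal_gen P R \<Longrightarrow> y \<in> ideal_gen P R \<Longrightarrow> x + y \<in> ideal_gen P R"
  by (induction rule: ideal_gen.induct) (auto simp: add.assoc intro: ideal_gen.intros)

lemma ideal_gen_mult:
  assumes "subring R" "x \<in> ideal_gen P R" "r \<in> R" shows "x * r \<in> ideal_gen P R"
  using assms(2)
proof (induction rule: ideal_gen.induct)
  case (ideal_gen_step p s x)
  have "p * (s * r) + x * r \<in> ideal_gen P R"
    using ideal_gen_step subring_mult[OF assms(1) _ assms(3)] by (intro ideal_gen.intros) auto
  then show ?case by (simp add: algebra_simps)
qed (simp add: ideal_gen_0)

lemma ideal_gen_mult': "subring R \<Longrightarrow> x \<in> ideal_gen P R \<Longrightarrow> r \<in> R \<Longrightarrow> r * x \<in> ideal_gen P R"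
  using ideal_gen_mult[of R x P r] by (simp add: mult.commute)

lemma ideal_gen_uminus: "subring R \<Longrightarrow> x \<in> ideal_gen P R \<Longrightarrow> - x \<in> ideal_gen P R"
  using ideal_gen_mult[of R x P "- 1"] by (simp add: subring_uminus subring_1)

lemma ideal_gen_diff: "subring R \<Longrightarrow> x \<in> ideal_gen P R \<Longrightarrow> y \<in> ideal_gen P R \<Longrightarrow> x - y \<in> ideal_gen P R"
  using ideal_gen_add[of x P R "- y"] ideal_gen_uminus by auto

lemma ideal_gen_sum: "(\<And>i. i \<in> A \<Longrightarrow> f i \<in> ideal_gen P R) \<Longrightarrow> sum f A \<in> ideal_gen P R"
  by (induction A rule: infinite_finite_induct) (auto intro: ideal_gen_0 ideal_gen_add)

lemma ideal_gen_gen: "p \<in> P \<Longrightarrow> r \<in> R \<Longrightarrow> p * r \<in> ideal_gen P R"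
  using ideal_gen_step[OF _ _ ideal_gen_0] by force

lemma ideal_gen_mono: "R \<subseteq> T \<Longrightarrow> x \<in> ideal_gen P R \<Longrightarrow> x \<in> ideal_gen P T"
  by (rotate_tac, induction rule: ideal_gen.induct) (auto intro: ideal_gen.intros)

lemma ideal_gen_subset: "subring R \<Longrightarrow> P \<subseteq> R \<Longrightarrow> x \<in> ideal_gen P R \<Longrightarrow> x \<in> R"
  by (rotate_tac 2, induction rule: ideal_gen.induct) (auto intro: subring_0 subring_add subring_mult)

lemma subring_adjoin:
  assumes R: "subring R"
  shows "subring {poly p x |p. p \<in> polys_in R}" "R \<subseteq> {poly p x |p. p \<in> polys_in R}"
    "x \<in> {poly p x |p. p \<in> polys_in R}"
proof -
  note S = subring_polys_in[OF R]
  show "subring {poly p x |p. p \<in> polys_in R}"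
    unfolding subring_def
  proof (safe, goal_cases)
    case 1 show ?case using subring_0[OF S] by (intro exI[of _ 0]) auto
  next
    case 2 show ?case using subring_1[OF S] by (intro exI[of _ 1]) auto
  next
    case (3 _ _ p q) then show ?case using subring_add[OF S] by (intro exI[of _ "p + q"]) auto
  next
    case (4 _ _ p q) then show ?case using subring_diff[OF S] by (intro exI[of _ "p - q"]) auto
  next
    case (5 _ _ p q) then show ?case using subring_mult[OF S] by (intro exI[of _ "p * q"]) auto
  qed
  show "R \<subseteq> {poly p x |p. p \<in> polys_in R}"
  proof
    fix r assume "r \<in> R"
    then show "r \<in> {poly p x |p. p \<in> polys_in R}"
      by (intro CollectI exI[of _ "[:r:]"]) (simp add: polys_in_0 subring_0[OF R])
  qed
  show "x \<in> {poly p x |p. p \<in> polys_in R}"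
    by (intro CollectI exI[of _ "[:0,1:]"]) (simp add: polys_in_0 subring_0[OF R] subring_1[OF R])
qed

text \<open>Collecting powers of \<open>x\<close> moves the ideal into the coefficients. Thus 1
  \<in> P R[x] becomes a polynomial relation in \<open>x\<close> with value 1.\<close>

lemma ideal_gen_adjoin:
  assumes R: "subring R" and y: "y \<in> ideal_gen P {poly p x |p. p \<in> polys_in R}"
  shows "\<exists>p\<in>polys_in (ideal_gen P R). y = poly p x"
  using y
proof (induction rule: ideal_gen.induct)
  case ideal_gen_0
  then show ?case by (intro bexI[of _ 0]) (auto simp: polys_in_0 ideal_gen.ideal_gen_0)
next
  case (ideal_gen_step p r y)
  then obtain f q where f: "f \<in> polys_in R" "r = poly f x"
    and q: "q \<in> polys_in (ideal_gen P R)" "y = poly q x" by auto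
  have "smult p f + q \<in> polys_in (ideal_gen P R)"
    using f q ideal_gen_step(1) by (auto simp: polys_in_def intro: ideal_gen.ideal_gen_step)
  then show ?case using f q by (intro bexI[of _ "smult p f + q"]) auto
qed

text \<open>The polynomial of larger degree is shortened by solving the other relation for its constant
  term, which is possible because \<open>1 - i\<close> is a unit for every \<open>i\<close> in the ideal.\<close>

lemma relation_descent:
  fixes x :: "'a::field"
  assumes R: "subring R" and P: "P \<subseteq> R" and unit: "\<And>i. i \<in> ideal_gen P R \<Longrightarrow> i \<noteq> 1 \<and> inverse (1 - i) \<in> R"
    and "x \<noteq> 0" "p \<in> polys_in (ideal_gen P R)" "q \<in> polys_in (ideal_gen P R)"
    and "poly p x = 1" "poly q (inverse x) = 1"
  shows False
  using assms(3-)
proof (induction "degree p + degree q" arbitrary: p q x rule: less_induct)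
  case less
  have False if "p \<in> polys_in (ideal_gen P R)" "q \<in> polys_in (ideal_gen P R)"
    "poly p x = 1" "poly q (inverse x) = 1" "x \<noteq> 0" "degree q \<le> degree p"
    and IH: "\<And>p'. degree p' < degree p \<Longrightarrow> p' \<in> polys_in (ideal_gen P R) \<Longrightarrow> poly p' x = 1 \<Longrightarrow> False"
    for p q :: "'a poly" and x
  proof -
    note A = that(1-5)
    define n m a e where "n = degree p" and "m = degree q" and "a = coeff p n"
      and "e = inverse (1 - coeff q 0)"
    have I: "coeff p i \<in> ideal_gen P R" "coeff q i \<in> ideal_gen P R" for i
      using A by (auto simp: polys_in_def)
    have e: "e \<in> R" "e * (1 - coeff q 0) = 1" using unit[OF I(2)[of 0]] by (auto simp: e_def)
    have nz: "n \<noteq> 0"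
    proof
      assume "n = 0"
      then have "coeff p 0 = 1" using A by (auto simp: n_def elim!: degree_eq_zeroE)
      then show False using unit[OF I(1)[of 0]] by simp
    qed
    have mz: "m \<noteq> 0"
    proof
      assume "m = 0"
      then have "coeff q 0 = 1" using A by (auto simp: m_def elim!: degree_eq_zeroE)
      then show False using unit[OF I(2)[of 0]] by simp
    qed
    have mn: "m \<le> n" using that(6) by (simp add: m_def n_def)
    \<comment> \<open>\<open>s\<close> has the value x^n (q(1/x) - q(0)) = x^n (1 - q(0)) at x, and
      its degree is below n. So \<open>smult (a * e) s\<close> has the value a x^n and can replace
      the leading term of \<open>p\<close>.\<close>
    define s where "s = (\<Sum>j\<in>{1..m}. monom (coeff q j) (n - j))"
    define p' where "p' = p - monom a n + smult (a * e) s"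
    have "poly s x = (\<Sum>j\<in>{1..m}. x ^ n * (coeff q j * inverse x ^ j))"
      unfolding s_def poly_sum poly_monom
      using mn A(5) by (intro sum.cong refl) (simp add: power_diff field_simps)
    also have "\<dots> = x ^ n * (poly q (inverse x) - coeff q 0)"
      unfolding poly_altdef m_def[symmetric] sum_distrib_left[symmetric] atMost_atLeast0
      by (subst (2) sum.atLeast_Suc_atMost) auto
    finally have "poly s x = x ^ n * (1 - coeff q 0)" using A by simp
    then have "poly p' x = 1 - a * x ^ n + a * x ^ n * (e * (1 - coeff q 0))"
      using A by (simp add: p'_def poly_monom)
    then have p'x: "poly p' x = 1" using e by simp
    have aR: "a * e * coeff q j \<in> ideal_gen P R" for j
      using ideal_gen_mult[OF R ideal_gen_mult[OF R I(1) e(1)] ideal_gen_subset[OF R P I(2)]]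
      by (simp add: a_def)
    have p'I: "p' \<in> polys_in (ideal_gen P R)"
      unfolding polys_in_def
    proof (intro CollectI allI)
      fix i
      have "coeff p i - coeff (monom a n) i \<in> ideal_gen P R"
        using I by (auto simp: a_def intro: ideal_gen_diff[OF R] ideal_gen_0)
      moreover have "a * e * coeff s i \<in> ideal_gen P R"
        unfolding s_def coeff_sum sum_distrib_left
        by (rule ideal_gen_sum) (auto simp: aR ideal_gen_0)
      ultimately show "coeff p' i \<in> ideal_gen P R"
        by (simp add: p'_def ideal_gen_add)
    qed
    have "degree p' < n"
    proof (rule degree_lessI)
      have "coeff s k = 0" if "k \<ge> n" for k
        unfolding s_def coeff_sum using that nz by (intro sum.neutral) auto
      then show "\<forall>k\<ge>n. coeff p' k = 0"
        using coeff_eq_0[of p] by (auto simp: p'_def a_def n_def)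
    qed (use nz in simp)
    then show False using IH p'I p'x by (simp add: n_def)
  qed
  note * = this
  show False
  proof (cases "degree q \<le> degree p")
    case True
    show False
    proof (rule *[of p q x])
      fix p' assume "degree p' < degree p" "p' \<in> polys_in (ideal_gen P R)" "poly p' x = 1"
      then show False using less(1)[of p' q x] less(2-) by auto
    qed (use less True in auto)
  next
    case False
    show False
    proof (rule *[of q p "inverse x"])
      fix p' assume "degree p' < degree q" "p' \<in> polys_in (ideal_gen P R)" "poly p' (inverse x) = 1"
      then show False using less(1)[of p p' x] less(2-) by auto
    qed (use less False in auto)
  qed
qed

text \<open>Take \<open>R\<close> maximal among the subrings above \<open>R0\<close> in which
  \<open>P\<close> generates a proper ideal. Adjoining any x outside \<open>R\<close> makes the
  ideal improper, which gives a relation in x; relations in both x and 1/x are excluded by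
  \<open>relation_descent\<close>.\<close>

theorem chevalley:
  fixes R0 :: "'a::field set"
  assumes R0: "subring R0" and P: "P \<subseteq> R0" and proper: "1 \<notin> ideal_gen P R0"
  obtains R where "vring R" "R0 \<subseteq> R" "P \<subseteq> max_ideal R"
proof -
  define \<A> where "\<A> = {R. subring R \<and> R0 \<subseteq> R \<and> 1 \<notin> ideal_gen P R}"
  have "\<exists>R\<in>\<A>. \<forall>X\<in>\<A>. R \<subseteq> X \<longrightarrow> X = R"
  proof (rule subset_Zorn_nonempty)
    show "\<A> \<noteq> {}" using assms by (auto simp: \<A>_def)
    fix C assume C: "C \<noteq> {}" "subset.chain \<A> C"
    have CA: "subring X" "R0 \<subseteq> X" "1 \<notin> ideal_gen P X" if "X \<in> C" for X
      using C(2) that by (auto simp: subset.chain_def \<A>_def)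
    have join: "\<exists>Z\<in>C. X \<subseteq> Z \<and> Y \<subseteq> Z" if "X \<in> C" "Y \<in> C" for X Y
    proof -
      have "X \<subseteq> Y \<or> Y \<subseteq> X" using C(2) that by (auto simp: subset.chain_def)
      then show ?thesis using that by blast
    qed
    have "subring (\<Union>C)"
      unfolding subring_def
    proof (intro conjI ballI)
      show "0 \<in> \<Union>C" "1 \<in> \<Union>C" using C(1) CA(1) subring_0 subring_1 by blast+
      fix x y assume "x \<in> \<Union>C" "y \<in> \<Union>C"
      then obtain Z where Z: "Z \<in> C" "x \<in> Z" "y \<in> Z" using join by blast
      then show "x + y \<in> \<Union>C" "x - y \<in> \<Union>C" "x * y \<in> \<Union>C"
        using CA(1)[OF Z(1)] subring_add subring_diff subring_mult by blast+
    qed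
    moreover have "\<exists>X\<in>C. y \<in> ideal_gen P X" if "y \<in> ideal_gen P (\<Union>C)" for y
      using that
    proof (induction rule: ideal_gen.induct)
      case ideal_gen_0
      then show ?case using C(1) by (auto intro: ideal_gen.ideal_gen_0)
    next
      case (ideal_gen_step p r y)
      then obtain X Y where "X \<in> C" "r \<in> X" "Y \<in> C" "y \<in> ideal_gen P Y" by blast
      then obtain Z where "Z \<in> C" "r \<in> Z" "y \<in> ideal_gen P Z"
        using join[of X Y] ideal_gen_mono[of Y _ y P] by (metis subsetD)
      then show ?case using ideal_gen_step(1) ideal_gen.ideal_gen_step by blast
    qed
    ultimately show "\<Union>C \<in> \<A>" using C(1) CA unfolding \<A>_def by blast
  qed
  then obtain R where R: "subring R" "R0 \<subseteq> R" "1 \<notin> ideal_gen P R"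
    and max: "\<And>X. subring X \<Longrightarrow> R \<subseteq> X \<Longrightarrow> 1 \<notin> ideal_gen P X \<Longrightarrow> X = R"
    unfolding \<A>_def by (smt (verit, ccfv_SIG) mem_Collect_eq order_trans)
  have PR: "P \<subseteq> R" using P R by blast
  have rel: "\<exists>p\<in>polys_in (ideal_gen P R). poly p x = 1" if "x \<notin> R" for x
  proof -
    have "1 \<in> ideal_gen P {poly p x |p. p \<in> polys_in R}"
      using max[OF subring_adjoin(1,2)[OF R(1)]] subring_adjoin(3)[OF R(1)] that by blast
    from ideal_gen_adjoin[OF R(1) this] show ?thesis by metis
  qed
  \<comment> \<open>An inverse of 1 - i outside \<open>R\<close> would satisfy such a relation too.
    Clearing denominators puts a power of 1 - i into the ideal, although that power is congruent to
    1.\<close>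
  have unit: "i \<noteq> 1 \<and> inverse (1 - i) \<in> R" if i: "i \<in> ideal_gen P R" for i
  proof (intro conjI)
    show i1: "i \<noteq> 1" using i R(3) by auto
    show "inverse (1 - i) \<in> R"
    proof (rule ccontr)
      assume "inverse (1 - i) \<notin> R"
      then obtain p where p: "p \<in> polys_in (ideal_gen P R)" "poly p (inverse (1 - i)) = 1"
        using rel by blast
      have iR: "1 - i \<in> R"
        using subring_diff[OF R(1) subring_1[OF R(1)] ideal_gen_subset[OF R(1) PR i]] .
      define n where "n = degree p"
      have "(1 - i) ^ n = (1 - i) ^ n * poly p (inverse (1 - i))" using p by simp
      also have "\<dots> = (\<Sum>k\<le>n. coeff p k * (1 - i) ^ (n - k))"
        unfolding poly_altdef n_def sum_distrib_left
        using i1 by (intro sum.cong refl) (simp add: power_diff field_simps)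
      also have "\<dots> \<in> ideal_gen P R"
        by (intro ideal_gen_sum ideal_gen_mult[OF R(1) polys_inD[OF p(1)]] subring_power[OF R(1) iR])
      finally have 1: "(1 - i) ^ n \<in> ideal_gen P R" .
      have 2: "1 - (1 - i) ^ m \<in> ideal_gen P R" for m
      proof (induction m)
        case (Suc m)
        have "1 - (1 - i) ^ Suc m = (1 - (1 - i) ^ m) + (1 - i) ^ m * i" by (simp add: algebra_simps)
        then show ?case
          using ideal_gen_add[OF Suc ideal_gen_mult'[OF R(1) i subring_power[OF R(1) iR]]] by metis
      qed (simp add: ideal_gen_0)
      from ideal_gen_add[OF 1 2[of n]] R(3) show False by simp
    qed
  qed
  have "vring R"
    unfolding valuation_ring_of_def
  proof (intro conjI ballI impI)
    fix x :: 'a assume "x \<noteq> 0"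
    show "x \<in> R \<or> inverse x \<in> R"
    proof (rule ccontr)
      assume "\<not> ?thesis"
      then obtain p q where "p \<in> polys_in (ideal_gen P R)" "poly p x = 1"
        "q \<in> polys_in (ideal_gen P R)" "poly q (inverse x) = 1" using rel[of x] rel[of "inverse x"] by blast
      then show False using relation_descent[OF R(1) PR unit \<open>x \<noteq> 0\<close>] by blast
    qed
  qed (use R(1) in \<open>auto simp: subring_def\<close>)
  moreover have "P \<subseteq> max_ideal R"
  proof
    fix p assume p: "p \<in> P"
    have "p = 0 \<or> inverse p \<notin> R" using ideal_gen_gen[OF p, of "inverse p" R] R(3) by auto
    then show "p \<in> max_ideal R" using p PR by (auto simp: max_ideal_iff)
  qed
  ultimately show thesis using that R(2) by blast
qed

text \<open>\<open>P\<close> is taken to be the maximal ideal of \<open>W\<close>. A nonzero element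
  of \<open>F\<close> outside \<open>W\<close> has its inverse in \<open>max_ideal W\<close>, hence
  in \<open>max_ideal R\<close>, and so cannot lie in \<open>R\<close>.\<close>

corollary valuation_ring_extends:
  assumes F: "subfield_of F" and W: "valuation_ring_of F W"
  obtains R where "vring R" "R \<inter> F = W"
proof -
  note S = valuation_ring_subring[OF W] note M = prime_max_ideal[OF F W]
  have "x \<in> max_ideal W" if "x \<in> ideal_gen (max_ideal W) W" for x
    using that by (induction rule: ideal_gen.induct) (auto intro: prime_ideal_ofD[OF M])
  then obtain R where R: "vring R" "W \<subseteq> R" "max_ideal W \<subseteq> max_ideal R"
    using chevalley[OF S prime_ideal_ofD(1)[OF M]] prime_ideal_ofD(3)[OF M] by blast
  have "x \<in> W" if "x \<in> R" "x \<in> F" for x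
  proof (rule ccontr)
    assume x: "x \<notin> W"
    then have "x \<noteq> 0" "inverse x \<in> max_ideal W"
      using valuation_ring_cases[OF W that(2)] subring_0[OF S] by (auto simp: max_ideal_iff)
    then have "inverse x \<in> max_ideal R" using R(3) by blast
    then show False using \<open>x \<noteq> 0\<close> that(1) by (simp add: max_ideal_iff)
  qed
  then have "R \<inter> F = W" using R(2) valuation_ring_subset[OF W] by blast
  then show thesis using that R(1) by blast
qed

subsection \<open>Extending partial automorphisms\<close>

text \<open>A partial \<open>K\<close>-homomorphism is represented by its graph, a relation closed under the ring
  operations.\<close>

definition partial_hom :: "'a::field set \<Rightarrow> ('a \<times> 'a) set \<Rightarrow> bool" where
  "partial_hom K r \<longleftrightarrow> (\<forall>c\<in>K. (c, c) \<in> r) \<and>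
     (\<forall>a b c d. (a, b) \<in> r \<longrightarrow> (c, d) \<in> r \<longrightarrow>
        (a + c, b + d) \<in> r \<and> (a - c, b - d) \<in> r \<and> (a * c, b * d) \<in> r) \<and>
     (\<forall>b. (0, b) \<in> r \<longrightarrow> b = 0)"

definition poly_rel :: "('a::zero \<times> 'a) set \<Rightarrow> 'a poly \<Rightarrow> 'a poly \<Rightarrow> bool" where
  "poly_rel r p q \<longleftrightarrow> (\<forall>i. (coeff p i, coeff q i) \<in> r)"

text \<open>The graph of the extension sending \<open>a\<close> to \<open>b\<close>. As a relation
  it always exists; whether it is single-valued is decided by the clause on 0 in
  \<open>partial_hom\<close>.\<close>

definition adjoin_rel :: "('a::field \<times> 'a) set \<Rightarrow> 'a \<Rightarrow> 'a \<Rightarrow> ('a \<times> 'a) set" where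
  "adjoin_rel r a b = {(poly p a, poly q b) | p q. poly_rel r p q}"

lemma
  assumes "partial_hom K r"
  shows partial_hom_const: "c \<in> K \<Longrightarrow> (c, c) \<in> r"
    and partial_hom_add: "(a, b) \<in> r \<Longrightarrow> (c, d) \<in> r \<Longrightarrow> (a + c, b + d) \<in> r"
    and partial_hom_diff: "(a, b) \<in> r \<Longrightarrow> (c, d) \<in> r \<Longrightarrow> (a - c, b - d) \<in> r"
    and partial_hom_mult: "(a, b) \<in> r \<Longrightarrow> (c, d) \<in> r \<Longrightarrow> (a * c, b * d) \<in> r"
    and partial_hom_zero: "(0, b) \<in> r \<Longrightarrow> b = 0"
  using assms by (auto simp: partial_hom_def)

context
  fixes K :: "'k::field set" and r
  assumes K: "subfield_of K" and r: "partial_hom K r"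
begin

lemma partial_hom_0: "(0, 0) \<in> r"
  using partial_hom_const[OF r, of 0] subring_0[OF subfield_subring[OF K]] by simp

lemma partial_hom_1: "(1, 1) \<in> r"
  using partial_hom_const[OF r, of 1] subring_1[OF subfield_subring[OF K]] by simp

lemma partial_hom_sum: "(\<And>i. i \<in> A \<Longrightarrow> (f i, g i) \<in> r) \<Longrightarrow> (sum f A, sum g A) \<in> r"
  by (induction A rule: infinite_finite_induct) (auto intro: partial_hom_0 partial_hom_add[OF r])

lemma poly_rel_add: "poly_rel r p q \<Longrightarrow> poly_rel r p' q' \<Longrightarrow> poly_rel r (p + p') (q + q')"
  by (auto simp: poly_rel_def intro: partial_hom_add[OF r])

lemma poly_rel_diff: "poly_rel r p q \<Longrightarrow> poly_rel r p' q' \<Longrightarrow> poly_rel r (p - p') (q - q')"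
  by (auto simp: poly_rel_def intro: partial_hom_diff[OF r])

lemma poly_rel_mult: "poly_rel r p q \<Longrightarrow> poly_rel r p' q' \<Longrightarrow> poly_rel r (p * p') (q * q')"
  by (auto simp: poly_rel_def coeff_mult intro!: partial_hom_sum partial_hom_mult[OF r])

lemma poly_rel_monom: "(a, b) \<in> r \<Longrightarrow> poly_rel r (monom a n) (monom b n)"
  by (auto simp: poly_rel_def partial_hom_0)

lemma poly_rel_pCons: "(a, b) \<in> r \<Longrightarrow> poly_rel r p q \<Longrightarrow> poly_rel r (pCons a p) (pCons b q)"
  by (auto simp: poly_rel_def coeff_pCons split: nat.splits)

lemma poly_rel_0: "poly_rel r 0 0"
  by (auto simp: poly_rel_def partial_hom_0)

lemma poly_rel_const: "p \<in> polys_in K \<Longrightarrow> poly_rel r p p"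
  by (auto simp: poly_rel_def polys_in_def intro: partial_hom_const[OF r])

lemma poly_rel_eval: "poly_rel r p q \<Longrightarrow> (x, y) \<in> r \<Longrightarrow> (poly p x, poly q y) \<in> r"
proof (induction p arbitrary: q)
  case 0
  then have "coeff q i = 0" for i using partial_hom_zero[OF r] by (auto simp: poly_rel_def)
  then have "q = 0" by (simp add: poly_eq_iff)
  then show ?case by (simp add: partial_hom_0)
next
  case (pCons a p)
  obtain b q' where q: "q = pCons b q'" by (cases q)
  have rel: "(coeff (pCons a p) i, coeff q i) \<in> r" for i using pCons(3) by (auto simp: poly_rel_def)
  have "(a, b) \<in> r" using rel[of 0] by (simp add: q)
  moreover have "poly_rel r p q'" using rel[of "Suc _"] by (simp add: q poly_rel_def)
  ultimately show ?case
    using pCons by (auto simp: q intro: partial_hom_add[OF r] partial_hom_mult[OF r])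
qed

text \<open>Related polynomials are divided simultaneously by related monic divisors, so that
  quotients and remainders stay related and no coefficient has to be inverted. Degrees are expressed
  by vanishing coefficients, which includes the zero polynomial; \<open>n\<close> bounds both
  dividends.\<close>

lemma poly_rel_division:
  assumes m: "poly_rel r m m'" "coeff m d = 1" "coeff m' d = 1" "\<And>i. i > d \<Longrightarrow> coeff m i = 0 \<and> coeff m' i = 0"
    and "poly_rel r p q" "\<And>i. i \<ge> n \<Longrightarrow> coeff p i = 0 \<and> coeff q i = 0"
  shows "\<exists>s s' t t'. poly_rel r s s' \<and> poly_rel r t t' \<and> p = s * m + t \<and> q = s' * m' + t' \<and>
    (\<forall>i\<ge>d. coeff t i = 0)"
  using assms(5,6)
proof (induction n arbitrary: p q)
  case 0
  then have "p = 0" "q = 0" by (auto simp: poly_eq_iff)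
  then show ?case by (intro exI[of _ 0]) (simp add: poly_rel_0)
next
  case (Suc n)
  show ?case
  proof (cases "n < d")
    case True
    then show ?thesis using Suc
      by (intro exI[of _ 0] exI[of _ p] exI[of _ q]) (auto simp: poly_rel_0)
  next
    case False
    define c c' where "c = monom (coeff p n) (n - d)" and "c' = monom (coeff q n) (n - d)"
    have cc: "poly_rel r c c'"
      using Suc(2) unfolding c_def c'_def by (intro poly_rel_monom) (auto simp: poly_rel_def)
    have low: "coeff (monom a (n - d) * f) i = (if i = n then a else 0)"
      if "coeff f d = 1" "\<And>i. i > d \<Longrightarrow> coeff f i = 0" "i \<ge> n" for a :: 'k and f i
      using that False by (auto simp: coeff_monom_mult)
    have "\<exists>s s' t t'. poly_rel r s s' \<and> poly_rel r t t' \<and> p - c * m = s * m + t \<and>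
        q - c' * m' = s' * m' + t' \<and> (\<forall>i\<ge>d. coeff t i = 0)"
    proof (rule Suc.IH)
      show "poly_rel r (p - c * m) (q - c' * m')"
        using Suc(2) cc m(1) by (intro poly_rel_diff poly_rel_mult)
      fix i assume "i \<ge> n"
      then show "coeff (p - c * m) i = 0 \<and> coeff (q - c' * m') i = 0"
        using low[of m] low[of m'] m(2-) Suc(3)[of i] unfolding c_def c'_def by auto
    qed
    then obtain s s' t t' where *: "poly_rel r s s'" "poly_rel r t t'" "p - c * m = s * m + t"
      "q - c' * m' = s' * m' + t'" "\<forall>i\<ge>d. coeff t i = 0" by blast
    have "p = (c + s) * m + t" "q = (c' + s') * m' + t'"
      using *(3,4) by (simp_all add: algebra_simps)
    then show ?thesis using poly_rel_add[OF cc *(1)] *(2,5) by blast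
  qed
qed

text \<open>Only single-valuedness is at stake. If p(a) = 0, the remainder of \<open>p\<close>
  modulo \<open>m\<close> vanishes by minimality, so the related remainder of \<open>q\<close>
  modulo \<open>m'\<close> vanishes too and q(b) = 0.\<close>

lemma adjoin_rel:
  assumes m: "poly_rel r m m'" "coeff m d = 1" "coeff m' d = 1" "\<And>i. i > d \<Longrightarrow> coeff m i = 0 \<and> coeff m' i = 0"
    and a: "poly m a = 0" and b: "poly m' b = 0"
    and minimal: "\<And>t. t \<in> polys_in (Domain r) \<Longrightarrow> (\<And>i. i \<ge> d \<Longrightarrow> coeff t i = 0) \<Longrightarrow> poly t a = 0 \<Longrightarrow> t = 0"
  shows "partial_hom K (adjoin_rel r a b)" "r \<subseteq> adjoin_rel r a b" "(a, b) \<in> adjoin_rel r a b"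
proof -
  show sub: "r \<subseteq> adjoin_rel r a b"
  proof safe
    fix x y assume "(x, y) \<in> r"
    then have "poly_rel r [:x:] [:y:]" by (intro poly_rel_pCons poly_rel_0)
    then show "(x, y) \<in> adjoin_rel r a b" unfolding adjoin_rel_def by force
  qed
  have "poly_rel r [:0, 1:] [:0, 1:]" by (intro poly_rel_pCons poly_rel_0 partial_hom_0 partial_hom_1)
  then show "(a, b) \<in> adjoin_rel r a b" unfolding adjoin_rel_def by force
  show "partial_hom K (adjoin_rel r a b)"
    unfolding partial_hom_def
  proof (intro conjI ballI allI impI)
    fix c assume "c \<in> K" then show "(c, c) \<in> adjoin_rel r a b" using sub partial_hom_const[OF r] by blast
  next
    fix x y x' y' assume "(x, y) \<in> adjoin_rel r a b" "(x', y') \<in> adjoin_rel r a b"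
    then obtain p q p' q' where *: "poly_rel r p q" "poly_rel r p' q'" "x = poly p a" "y = poly q b"
      "x' = poly p' a" "y' = poly q' b" unfolding adjoin_rel_def by auto
    show "(x + x', y + y') \<in> adjoin_rel r a b" "(x - x', y - y') \<in> adjoin_rel r a b"
      "(x * x', y * y') \<in> adjoin_rel r a b"
      using poly_rel_add[OF *(1,2)] poly_rel_diff[OF *(1,2)] poly_rel_mult[OF *(1,2)] *(3-)
      unfolding adjoin_rel_def by force+
  next
    fix y assume "(0, y) \<in> adjoin_rel r a b"
    then obtain p q where pq: "poly_rel r p q" "poly p a = 0" "y = poly q b" unfolding adjoin_rel_def by auto
    have "\<exists>s s' t t'. poly_rel r s s' \<and> poly_rel r t t' \<and> p = s * m + t \<and> q = s' * m' + t' \<and>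
        (\<forall>i\<ge>d. coeff t i = 0)"
      by (rule poly_rel_division[OF m pq(1), where n = "Suc (max (degree p) (degree q))"])
        (auto intro: coeff_eq_0)
    then obtain s s' t t' where *: "poly_rel r t t'" "p = s * m + t" "q = s' * m' + t'"
      "\<forall>i\<ge>d. coeff t i = 0" by blast
    have "t = 0" using * pq a by (intro minimal) (auto simp: poly_rel_def polys_in_def)
    then have "t' = 0" using *(1) partial_hom_zero[OF r] by (auto simp: poly_rel_def poly_eq_iff)
    then show "y = 0" using * pq b by simp
  qed
qed

end

text \<open>Divide by powers of z until the constant term \<open>c\<close> is nonzero; then z * (-
  p(z) / c) = 1, with \<open>p\<close> the rest of the polynomial. The inverse is thus a polynomial
  in z over \<open>K\<close>, so relations closed under ring operations are also closed under
  inverses.\<close>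

lemma algebraic_inverse:
  assumes K: "subfield_of K" and alg: "p \<noteq> 0" "p \<in> polys_in K" "poly p z = 0" and z: "z \<noteq> 0"
  shows "\<exists>g\<in>polys_in K. z * poly g z = 1"
  using alg
proof (induction p)
  case (pCons c p)
  show ?case
  proof (cases "c = 0")
    case True
    then show ?thesis using pCons z by auto
  next
    case False
    have "z * poly (smult (- inverse c) p) z = 1"
      using pCons(5) False by (simp add: field_simps add_eq_0_iff)
    moreover have "smult (- inverse c) p \<in> polys_in K"
      using pCons(4) K by (intro polys_in_smult) (auto intro: subfield_subring subring_uminus subfield_inverse)
    ultimately show ?thesis by blast
  qed
qed simp

lemma algebraic_overD: "algebraic_over K \<Longrightarrow> \<exists>p. p \<noteq> 0 \<and> p \<in> polys_in K \<and> poly p x = 0"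
  by (simp add: algebraic_over_def polys_in_def)

lemma partial_hom_inverse:
  assumes K: "subfield_of K" and alg: "algebraic_over K" and r: "partial_hom K r"
    and zw: "(z, w) \<in> r" "z \<noteq> 0"
  shows "(inverse z, inverse w) \<in> r" "w \<noteq> 0"
proof -
  obtain g where g: "g \<in> polys_in K" "z * poly g z = 1"
    using algebraic_inverse[OF K] algebraic_overD[OF alg, of z] zw(2) by metis
  have gr: "(poly g z, poly g w) \<in> r" using poly_rel_eval[OF K r poly_rel_const[OF K r g(1)] zw(1)] .
  have "(0, w * poly g w - 1) \<in> r"
    using partial_hom_diff[OF r partial_hom_mult[OF r zw(1) gr] partial_hom_1[OF K r]] g(2) by simp
  then have "w * poly g w = 1" using partial_hom_zero[OF r] by fastforce
  then have "poly g w = inverse w" "w \<noteq> 0" by (auto simp: inverse_unique)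
  moreover have "poly g z = inverse z" using g(2) by (simp add: inverse_unique)
  ultimately show "(inverse z, inverse w) \<in> r" "w \<noteq> 0" using gr by auto
qed

text \<open>Minimality speaks of vanishing coefficients instead of degrees, so that it applies
  directly to remainders, the zero polynomial included. \<open>D\<close> will be \<open>K\<close> or
  the domain of a partial homomorphism.\<close>

definition minimal_poly :: "'a::field set \<Rightarrow> 'a \<Rightarrow> 'a poly \<Rightarrow> bool" where
  "minimal_poly D a m \<longleftrightarrow> m \<in> polys_in D \<and> lead_coeff m = 1 \<and> poly m a = 0 \<and> degree m > 0 \<and>
     (\<forall>t\<in>polys_in D. (\<forall>i\<ge>degree m. coeff t i = 0) \<longrightarrow> poly t a = 0 \<longrightarrow> t = 0)"

lemma minimal_polynomial:
  assumes D: "subfield_of D" and alg: "p \<in> polys_in D" "p \<noteq> 0" "poly p a = 0"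
  shows "\<exists>m. minimal_poly D a m"
proof -
  define Q where "Q = (\<lambda>p. p \<in> polys_in D \<and> p \<noteq> 0 \<and> poly p a = 0)"
  obtain f where f: "Q f" "\<And>g. Q g \<Longrightarrow> degree f \<le> degree g"
    using ex_has_least_nat[of Q p degree] alg by (auto simp: Q_def)
  define m where "m = smult (inverse (lead_coeff f)) f"
  have lf: "lead_coeff f \<noteq> 0" using f(1) by (simp add: Q_def)
  have m: "m \<in> polys_in D" "coeff m (degree m) = 1" "poly m a = 0" "degree m = degree f"
    using f(1) lf polys_inD[of f D] unfolding m_def Q_def
    by (auto intro!: polys_in_smult subfield_subring[OF D] subfield_inverse[OF D])
  have "degree m > 0"
  proof (rule ccontr)
    assume "\<not> degree m > 0"
    then obtain c where c: "m = [:c:]" by (metis degree_eq_zeroE gr0I)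
    then have "m = 0" using m(3) by simp
    then show False using m(2) by simp
  qed
  moreover have "t = 0" if "t \<in> polys_in D" "\<forall>i\<ge>degree m. coeff t i = 0" "poly t a = 0" for t
  proof (rule ccontr)
    assume "t \<noteq> 0"
    then have "degree f \<le> degree t" using that by (intro f) (auto simp: Q_def)
    then have "lead_coeff t = 0" using that(2) by (simp add: m)
    then show False using \<open>t \<noteq> 0\<close> by simp
  qed
  ultimately show ?thesis using m unfolding minimal_poly_def by blast
qed

text \<open>A maximal partial homomorphism is total: any element can be adjoined, its image being a
  root of the polynomial that corresponds to its minimal polynomial over the domain. It is onto
  because an injective map permutes the finite set of roots of a nonzero polynomial over
  \<open>K\<close>.\<close>

theorem partial_hom_extends:
  fixes K :: "'k::field set"
  assumes ac: "alg_closed TYPE('k)" and K: "subfield_of K" and alg: "algebraic_over K"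
    and r0: "partial_hom K r0"
  obtains \<sigma> where "\<sigma> \<in> Gal K" "\<And>a b. (a, b) \<in> r0 \<Longrightarrow> \<sigma> a = b"
proof -
  define \<A> where "\<A> = {r. partial_hom K r \<and> r0 \<subseteq> r}"
  have "\<exists>r\<in>\<A>. \<forall>X\<in>\<A>. r \<subseteq> X \<longrightarrow> X = r"
  proof (rule subset_Zorn_nonempty)
    show "\<A> \<noteq> {}" using r0 by (auto simp: \<A>_def)
    fix C assume C: "C \<noteq> {}" "subset.chain \<A> C"
    have CA: "partial_hom K X" "r0 \<subseteq> X" if "X \<in> C" for X
      using C(2) that by (auto simp: subset.chain_def \<A>_def)
    have join: "\<exists>Z\<in>C. X \<subseteq> Z \<and> Y \<subseteq> Z" if "X \<in> C" "Y \<in> C" for X Y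
    proof -
      have "X \<subseteq> Y \<or> Y \<subseteq> X" using C(2) that by (auto simp: subset.chain_def)
      then show ?thesis using that by blast
    qed
    have "partial_hom K (\<Union>C)"
      unfolding partial_hom_def
    proof (intro conjI ballI allI impI)
      fix c assume "c \<in> K" then show "(c, c) \<in> \<Union>C" using C(1) CA(1) partial_hom_const by blast
    next
      fix a b c d assume "(a, b) \<in> \<Union>C" "(c, d) \<in> \<Union>C"
      then obtain Z where Z: "Z \<in> C" "(a, b) \<in> Z" "(c, d) \<in> Z" using join by blast
      then show "(a + c, b + d) \<in> \<Union>C" "(a - c, b - d) \<in> \<Union>C" "(a * c, b * d) \<in> \<Union>C"
        using partial_hom_add[OF CA(1)[OF Z(1)] Z(2,3)] partial_hom_diff[OF CA(1)[OF Z(1)] Z(2,3)]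
          partial_hom_mult[OF CA(1)[OF Z(1)] Z(2,3)] by auto
    next
      fix b assume "(0, b) \<in> \<Union>C" then show "b = 0" using CA(1) partial_hom_zero by blast
    qed
    then show "\<Union>C \<in> \<A>" using C(1) CA(2) unfolding \<A>_def by blast
  qed
  then obtain r where r: "partial_hom K r" "r0 \<subseteq> r"
    and max: "\<And>X. partial_hom K X \<Longrightarrow> r \<subseteq> X \<Longrightarrow> X = r"
    unfolding \<A>_def by (metis (no_types, lifting) mem_Collect_eq order_trans)
  have dom: "subfield_of (Domain r)"
    unfolding subfield_of_def
    using partial_hom_0[OF K r(1)] partial_hom_1[OF K r(1)] partial_hom_add[OF r(1)]
      partial_hom_diff[OF r(1)] partial_hom_mult[OF r(1)] partial_hom_inverse[OF K alg r(1)]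
    by (auto simp: Domain_iff) metis+
  have total: "\<exists>b. (a, b) \<in> r" for a
  proof -
    obtain p where "p \<noteq> 0" "p \<in> polys_in K" "poly p a = 0" using algebraic_overD[OF alg] by blast
    moreover have "K \<subseteq> Domain r" using partial_hom_const[OF r(1)] by blast
    ultimately have p: "p \<in> polys_in (Domain r)" "p \<noteq> 0" "poly p a = 0" using polys_in_mono by auto
    obtain m where mp: "minimal_poly (Domain r) a m" using minimal_polynomial[OF dom p] by blast
    define d where "d = degree m"
    have m: "m \<in> polys_in (Domain r)" "degree m = d" "coeff m d = 1" "poly m a = 0" "d > 0"
      "\<And>t. t \<in> polys_in (Domain r) \<Longrightarrow> (\<And>i. i \<ge> d \<Longrightarrow> coeff t i = 0) \<Longrightarrow> poly t a = 0 \<Longrightarrow> t = 0"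
      using mp by (auto simp: minimal_poly_def d_def)
    have "\<forall>i. \<exists>b. (coeff m i, b) \<in> r" using polys_inD[OF m(1)] by blast
    then obtain f where f: "\<And>i. (coeff m i, f i) \<in> r" by metis
    \<comment> \<open>The leading 1 and the zeros above it are put in by hand, so that
      \<open>m'\<close> is visibly monic of degree \<open>d\<close>.\<close>
    define m' where "m' = (\<Sum>i<d. monom (f i) i) + monom 1 d"
    have cm': "coeff m' i = (if i < d then f i else if i = d then 1 else 0)" for i
      by (simp add: m'_def coeff_sum)
    have "degree m' > 0" using le_degree[of m' d] cm'[of d] m(5) by simp
    then obtain b where b: "poly m' b = 0" using ac by (auto simp: alg_closed_def)
    have high: "i > d \<Longrightarrow> coeff m i = 0" for i using m(2) coeff_eq_0 by blast
    have "poly_rel r m m'"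
      unfolding poly_rel_def cm' using f m(3) high partial_hom_0[OF K r(1)] partial_hom_1[OF K r(1)]
      by (auto simp: not_less_iff_gr_or_eq)
    moreover have "coeff m' d = 1" "\<And>i. i > d \<Longrightarrow> coeff m i = 0 \<and> coeff m' i = 0"
      using high by (auto simp: cm')
    ultimately have "partial_hom K (adjoin_rel r a b)" "r \<subseteq> adjoin_rel r a b" "(a, b) \<in> adjoin_rel r a b"
      using adjoin_rel[OF K r(1), of m m' d a b] m(3,4,6) b by blast+
    then show ?thesis using max by blast
  qed
  have single: "b = b'" if "(a, b) \<in> r" "(a, b') \<in> r" for a b b'
    using partial_hom_diff[OF r(1) that] partial_hom_zero[OF r(1)] by fastforce
  define \<sigma> where "\<sigma> a = (THE b. (a, b) \<in> r)" for a
  have \<sigma>: "\<sigma> a = b \<longleftrightarrow> (a, b) \<in> r" for a b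
    unfolding \<sigma>_def by (metis single the_equality total)
  have hom: "\<sigma> (x + y) = \<sigma> x + \<sigma> y" "\<sigma> (x - y) = \<sigma> x - \<sigma> y" "\<sigma> (x * y) = \<sigma> x * \<sigma> y" for x y
    using partial_hom_add[OF r(1)] partial_hom_diff[OF r(1)] partial_hom_mult[OF r(1)] \<sigma> by metis+
  have fixK: "\<sigma> c = c" if "c \<in> K" for c using that partial_hom_const[OF r(1)] \<sigma> by metis
  have inj: "inj \<sigma>"
  proof (rule injI, rule ccontr)
    fix x y assume "\<sigma> x = \<sigma> y" "x \<noteq> y"
    then show False using partial_hom_inverse(2)[OF K alg r(1), of "x - y" "\<sigma> (x - y)"] \<sigma> hom(2) by auto
  qed
  have "y \<in> range \<sigma>" for y
  proof -
    obtain p where p: "p \<noteq> 0" "p \<in> polys_in K" "poly p y = 0" using algebraic_overD[OF alg] by blast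
    have "\<sigma> ` {x. poly p x = 0} \<subseteq> {x. poly p x = 0}"
    proof safe
      fix x assume "poly p x = 0"
      then have "(0, poly p (\<sigma> x)) \<in> r"
        using poly_rel_eval[OF K r(1) poly_rel_const[OF K r(1) p(2)], of x "\<sigma> x"] \<sigma> by auto
      then show "poly p (\<sigma> x) = 0" using partial_hom_zero[OF r(1)] by blast
    qed
    then have "\<sigma> ` {x. poly p x = 0} = {x. poly p x = 0}"
      using endo_inj_surj[OF poly_roots_finite[OF p(1)]] inj inj_on_subset by blast
    then show ?thesis using p(3) by blast
  qed
  then have "bij \<sigma>" using inj by (auto simp: bij_def)
  moreover have "\<sigma> 1 = 1" using fixK subring_1[OF subfield_subring[OF K]] by blast
  ultimately have "\<sigma> \<in> Gal K" using hom fixK by (auto simp: Gal_def)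
  then show thesis using that r(2) \<sigma> by blast
qed

text \<open>The identity of \<open>K\<close>, extended by sending \<open>a\<close> to
  \<open>b\<close>, is a partial homomorphism because both are roots of the minimal polynomial
  \<open>m\<close>.\<close>

corollary Gal_transitive:
  fixes K :: "'k::field set"
  assumes ac: "alg_closed TYPE('k)" and K: "subfield_of K" and alg: "algebraic_over K"
    and mp: "minimal_poly K a m" and b: "poly m b = 0"
  obtains \<sigma> where "\<sigma> \<in> Gal K" "\<sigma> a = b"
proof -
  have r: "partial_hom K (Id_on K)"
    using subfield_subring[OF K] subring_0 by (auto simp: partial_hom_def subring_def)
  have "partial_hom K (adjoin_rel (Id_on K) a b)" "(a, b) \<in> adjoin_rel (Id_on K) a b"
    using adjoin_rel[OF K r, of m m "degree m" a b] poly_rel_const[OF K r, of m] mp b coeff_eq_0[of m]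
    by (auto simp: minimal_poly_def)
  then show thesis using partial_hom_extends[OF ac K alg] that by metis
qed

subsection \<open>Elements fixed by the Galois group\<close>

lemma alg_closed_factor:
  fixes p :: "'k::field poly"
  assumes ac: "alg_closed TYPE('k)" and p: "p \<noteq> 0"
  shows "\<exists>as. p = smult (lead_coeff p) (\<Prod>a\<leftarrow>as. [:- a, 1:])"
  using p
proof (induction "degree p" arbitrary: p)
  case 0
  then obtain c where "p = [:c:]" by (metis degree_eq_zeroE)
  then show ?case by (intro exI[of _ "[]"]) (auto simp: one_pCons)
next
  case (Suc n)
  then have "degree p > 0" by simp
  then obtain a where "poly p a = 0" using ac unfolding alg_closed_def by blast
  then obtain q where q: "p = [:- a, 1:] * q" by (auto simp: poly_eq_0_iff_dvd elim: dvdE)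
  then have q0: "q \<noteq> 0" using Suc by auto
  then have "degree p = Suc (degree q)" unfolding q by (subst degree_mult_eq) auto
  then obtain as where as: "q = smult (lead_coeff q) (\<Prod>a\<leftarrow>as. [:- a, 1:])" using Suc q0 by auto
  have "lead_coeff p = lead_coeff q" unfolding q lead_coeff_mult by simp
  have "p = smult (lead_coeff q) ([:- a, 1:] * (\<Prod>a\<leftarrow>as. [:- a, 1:]))"
    by (subst q, subst as) (rule mult_smult_right)
  then have "p = smult (lead_coeff p) (\<Prod>a\<leftarrow>a # as. [:- a, 1:])"
    unfolding \<open>lead_coeff p = lead_coeff q\<close> list.map prod_list.Cons .
  then show ?case by (rule exI)
qed

text \<open>Such an \<open>n\<close> is 1 in characteristic 0 and a power of p in characteristic p.
  Additivity is required for polynomials, so that a power can be taken coefficient by coefficient;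
  the characteristic need not be mentioned.\<close>

definition additive_power :: "'a::field itself \<Rightarrow> nat \<Rightarrow> bool" where
  "additive_power _ n \<longleftrightarrow> n > 0 \<and> (\<forall>a b :: 'a poly. (a + b) ^ n = a ^ n + b ^ n)"

lemma additive_power_mult:
  "additive_power TYPE('a::field) m \<Longrightarrow> additive_power TYPE('a) n \<Longrightarrow> additive_power TYPE('a) (m * n)"
  by (auto simp: additive_power_def power_mult)

text \<open>The minimal polynomial of a fixed element has a single root \<open>x\<close>.  If the \<open>k\<close>-th binomial
  coefficient were nonzero for some \<open>0 < k < n\<close>, the least such \<open>k\<close> would give \<open>x ^ k \<in> K\<close>,
  contradicting minimality.\<close>

lemma fixed_imp_power_mem:
  fixes K :: "'k::field set"
  assumes ac: "alg_closed TYPE('k)" and K: "subfield_of K" and alg: "algebraic_over K"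
    and fixed: "\<And>\<sigma>. \<sigma> \<in> Gal K \<Longrightarrow> \<sigma> x = x"
  obtains n where "additive_power TYPE('k) n" "x ^ n \<in> K"
proof -
  note S = subfield_subring[OF K]
  obtain p where p: "p \<in> polys_in K" "p \<noteq> 0" "poly p x = 0" using algebraic_overD[OF alg] by blast
  obtain m where mp: "minimal_poly K x m" using minimal_polynomial[OF K p] by blast
  define n where "n = degree m"
  have m: "m \<in> polys_in K" "degree m = n" "coeff m n = 1" "poly m x = 0" "n > 0"
    "\<And>t. t \<in> polys_in K \<Longrightarrow> (\<And>i. i \<ge> n \<Longrightarrow> coeff t i = 0) \<Longrightarrow> poly t x = 0 \<Longrightarrow> t = 0"
    using mp by (auto simp: minimal_poly_def n_def)
  have root: "y = x" if "poly m y = 0" for y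
    using Gal_transitive[OF ac K alg mp that] fixed by metis
  have "m \<noteq> 0" using m(2,5) by auto
  then obtain as where as: "m = (\<Prod>a\<leftarrow>as. [:- a, 1:])"
    using alg_closed_factor[OF ac, of m] m(2,3) by auto
  have "a = x" if "a \<in> set as" for a
    using root[of a] that unfolding as by (induction as) auto
  then have "m = [:- x, 1:] ^ length as"
    unfolding as by (induction as) auto
  moreover from this have "length as = n" using m(2) by (simp add: degree_linear_power)
  ultimately have mx: "m = [:- x, 1:] ^ n" by simp
  define Q where "Q k \<longleftrightarrow> k > 0 \<and> (of_nat (n choose k) :: 'k) \<noteq> 0" for k
  define k where "k = (LEAST k. Q k)"
  have Qn: "Q n" using m(5) by (simp add: Q_def)
  have k: "Q k" "k \<le> n" using LeastI[of Q, OF Qn] Least_le[of Q, OF Qn] by (auto simp: k_def)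
  have kl: "\<not> Q j" if "j < k" for j using that not_less_Least unfolding k_def by blast
  have "coeff m (n - k) = of_nat (n choose k) * (- x) ^ k"
    using k(2) unfolding mx by (simp add: coeff_linear_poly_power binomial_symmetric[symmetric])
  also have "\<dots> = of_nat (n choose k) * (- 1) ^ k * x ^ k" by (simp add: power_minus[of x])
  finally have c: "of_nat (n choose k) * (- 1) ^ k * x ^ k \<in> K" using polys_inD[OF m(1)] by metis
  have "of_nat (n choose k) * (- 1) ^ k \<in> K"
    by (intro subring_mult[OF S] subring_of_nat[OF S] subring_power[OF S] subring_uminus[OF S] subring_1[OF S])
  from subfield_divide[OF K c this] have xk: "x ^ k \<in> K" using k(1) by (simp add: Q_def)
  have "k = n"
  proof (rule ccontr)
    assume "k \<noteq> n"
    then have kn: "k < n" using k(2) by simp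
    have "monom 1 k - [:x ^ k:] = 0"
    proof (rule m(6))
      show "monom 1 k - [:x ^ k:] \<in> polys_in K"
        using xk S by (intro subring_diff[OF subring_polys_in[OF S]])
          (auto intro: polys_in_monom subring_0 subring_1 polys_in_0)
      fix i assume "i \<ge> n" then show "coeff (monom 1 k - [:x ^ k:]) i = 0"
        using kn by (auto simp: coeff_pCons split: nat.splits)
    qed (simp add: poly_monom)
    then have "coeff (monom 1 k - [:x ^ k:]) k = 0" by simp
    then show False using k(1) by (auto simp: Q_def coeff_pCons split: nat.splits)
  qed
  have "(a + b) ^ n = a ^ n + b ^ n" for a b :: "'k poly"
  proof -
    have z: "(of_nat (n choose i) :: 'k poly) = 0" if "0 < i" "i < n" for i
      using kl[of i] that \<open>k = n\<close> by (simp add: Q_def of_nat_poly)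
    have "(a + b) ^ n = (\<Sum>i\<le>n. of_nat (n choose i) * a ^ i * b ^ (n - i))" by (rule binomial_ring)
    also have "\<dots> = (\<Sum>i\<in>{0, n}. of_nat (n choose i) * a ^ i * b ^ (n - i))"
      by (rule sum.mono_neutral_right) (auto simp: z)
    also have "\<dots> = a ^ n + b ^ n" using m(5) by simp
    finally show ?thesis .
  qed
  then show thesis using that[of n] m(5) xk \<open>k = n\<close> by (auto simp: additive_power_def)
qed

text \<open>One exponent must serve all coefficients. If \<open>m\<close> serves the constant term
  and \<open>n\<close> the rest, then m * n serves both, because the power is additive.\<close>

lemma fixed_poly_imp_power_mem:
  fixes K :: "'k::field set"
  assumes ac: "alg_closed TYPE('k)" and K: "subfield_of K" and alg: "algebraic_over K"
    and fixed: "\<And>\<sigma> i. \<sigma> \<in> Gal K \<Longrightarrow> \<sigma> (coeff p i) = coeff p i"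
  shows "\<exists>n. additive_power TYPE('k) n \<and> p ^ n \<in> polys_in K"
  using fixed
proof (induction p)
  case 0
  then show ?case using subring_0[OF subfield_subring[OF K]]
    by (intro exI[of _ 1]) (auto simp: additive_power_def polys_in_0)
next
  case (pCons c p)
  note S = subfield_subring[OF K] note SP = subring_polys_in[OF S]
  have fx: "\<sigma> c = c" "\<sigma> (coeff p i) = coeff p i" if "\<sigma> \<in> Gal K" for \<sigma> i
    using pCons(3)[OF that, of 0] pCons(3)[OF that, of "Suc i"] by auto
  obtain m where m: "additive_power TYPE('k) m" "c ^ m \<in> K"
    using fixed_imp_power_mem[OF ac K alg, of c] fx(1) by blast
  obtain n where n: "additive_power TYPE('k) n" "p ^ n \<in> polys_in K" using pCons(2) fx(2) by blast
  have "pCons c p = [:c:] + [:0, 1:] * p" by simp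
  then have "pCons c p ^ (m * n) = [:c:] ^ (m * n) + ([:0, 1:] * p) ^ (m * n)"
    using additive_power_mult[OF m(1) n(1)] by (simp only: additive_power_def)
  also have "[:c:] ^ (m * n) = [:c ^ m:] ^ n" by (simp add: poly_const_pow power_mult)
  also have "([:0, 1:] * p) ^ (m * n) = [:0, 1:] ^ (m * n) * (p ^ n) ^ m"
    by (simp only: power_mult_distrib power_mult[symmetric] mult.commute[of m n])
  finally have "pCons c p ^ (m * n) = [:c ^ m:] ^ n + [:0, 1:] ^ (m * n) * (p ^ n) ^ m" .
  moreover have "[:c ^ m:] \<in> polys_in K" "[:0, 1:] \<in> polys_in K"
    using m(2) S by (auto intro: polys_in_0 subring_0 subring_1)
  ultimately have "pCons c p ^ (m * n) \<in> polys_in K"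
    using subring_add[OF SP subring_power[OF SP] subring_mult[OF SP subring_power[OF SP] subring_power[OF SP n(2)]]]
    by metis
  then show ?case using additive_power_mult[OF m(1) n(1)] by blast
qed

subsection \<open>Conjugacy of valuation rings\<close>

definition field_hom :: "('a::field \<Rightarrow> 'a) \<Rightarrow> bool" where
  "field_hom g \<longleftrightarrow> (\<forall>x y. g (x + y) = g x + g y \<and> g (x * y) = g x * g y) \<and> g 1 = 1"

lemma
  assumes "field_hom g"
  shows field_hom_add: "g (x + y) = g x + g y" and field_hom_mult: "g (x * y) = g x * g y"
    and field_hom_1: "g 1 = 1" and field_hom_0: "g 0 = 0"
    and field_hom_uminus: "g (- x) = - g x"
    and field_hom_diff: "g (x - y) = g x - g y"
proof -
  show *: "g (x + y) = g x + g y" "g (x * y) = g x * g y" "g 1 = 1" for x y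
    using assms by (auto simp: field_hom_def)
  show 0: "g 0 = 0" using *(1)[of 0 0] by (metis add_cancel_left_left add_0)
  show m: "g (- x) = - g x" for x using *(1)[of x "- x"] 0 by (simp add: eq_neg_iff_add_eq_0 add.commute)
  show "g (x - y) = g x - g y" using *(1)[of x "- y"] m by simp
qed

lemma field_hom_inverse: "field_hom g \<Longrightarrow> g (inverse x) = inverse (g x)"
  by (cases "x = 0") (auto simp: field_hom_0 field_hom_1 intro!: inverse_unique[symmetric]
    simp flip: field_hom_mult)

lemma field_hom_eq_0: "field_hom g \<Longrightarrow> g x = 0 \<longleftrightarrow> x = 0"
  by (metis field_hom_0 field_hom_1 field_hom_mult right_inverse mult_zero_left zero_neq_one)

lemma field_hom_inj: "field_hom g \<Longrightarrow> inj g"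
  by (metis eq_iff_diff_eq_0 field_hom_diff field_hom_eq_0 injI)

lemma field_hom_sum: "field_hom g \<Longrightarrow> g (sum f A) = (\<Sum>i\<in>A. g (f i))"
  by (induction A rule: infinite_finite_induct) (auto simp: field_hom_0 field_hom_add)

lemma field_hom_power: "field_hom g \<Longrightarrow> g (x ^ n) = g x ^ n"
  by (induction n) (auto simp: field_hom_1 field_hom_mult)

lemma coeff_map_hom: "field_hom g \<Longrightarrow> coeff (map_poly g p) i = g (coeff p i)"
  by (simp add: coeff_map_poly field_hom_0)

lemma map_poly_hom_pCons: "field_hom g \<Longrightarrow> map_poly g (pCons a p) = pCons (g a) (map_poly g p)"
  by (rule poly_eqI) (auto simp: coeff_map_hom coeff_pCons split: nat.splits)

lemma map_poly_hom_add: "field_hom g \<Longrightarrow> map_poly g (p + q) = map_poly g p + map_poly g q"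
  by (rule poly_eqI) (auto simp: coeff_map_hom field_hom_add)

lemma map_poly_hom_diff: "field_hom g \<Longrightarrow> map_poly g (p - q) = map_poly g p - map_poly g q"
  by (rule poly_eqI) (auto simp: coeff_map_hom field_hom_diff)

lemma map_poly_hom_mult: "field_hom g \<Longrightarrow> map_poly g (p * q) = map_poly g p * map_poly g q"
  by (rule poly_eqI) (auto simp: coeff_map_hom coeff_mult field_hom_sum field_hom_mult)

lemma map_poly_hom_prod: "field_hom g \<Longrightarrow> map_poly g (prod f A) = (\<Prod>i\<in>A. map_poly g (f i))"
  by (induction A rule: infinite_finite_induct) (auto simp: field_hom_1 map_poly_hom_mult)

lemma map_poly_hom_comp:
  "field_hom g \<Longrightarrow> field_hom h \<Longrightarrow> map_poly g (map_poly h p) = map_poly (g \<circ> h) p"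
  by (rule poly_eqI) (simp add: coeff_map_hom coeff_map_poly field_hom_0)

lemma map_poly_hom_eq_0: "field_hom g \<Longrightarrow> map_poly g p = 0 \<longleftrightarrow> p = 0"
  by (auto simp: poly_eq_iff coeff_map_hom field_hom_eq_0)

lemma map_poly_hom_inj: "field_hom g \<Longrightarrow> inj (map_poly g)"
  by (rule injI) (metis eq_iff_diff_eq_0 map_poly_hom_diff map_poly_hom_eq_0)

lemma poly_map_hom: "field_hom g \<Longrightarrow> poly (map_poly g p) (g x) = g (poly p x)"
  by (induction p) (auto simp: map_poly_hom_pCons field_hom_0 field_hom_add field_hom_mult)

text \<open>A Horner partial sum of an integral relation is a denominator that works for all of its roots,
  hence for all conjugates of an element, at once.\<close>

lemma horner_tail_mem:
  assumes R: "vring R" and p: "p \<in> polys_in R" and y: "poly p y = 0"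
  shows "poly (poly_shift k p) y \<in> R" "poly (poly_shift k p) y * y \<in> R"
proof -
  note S = valuation_ring_subring[OF R]
  define s where "s = poly (poly_shift k p) y"
  have ps: "poly_shift k p \<in> polys_in R" "poly_cutoff k p \<in> polys_in R"
    using p subring_0[OF S] by (auto simp: polys_in_def coeff_poly_shift coeff_poly_cutoff)
  have "s \<in> R \<and> s * y \<in> R"
  proof (cases "y \<in> R")
    case True
    then show ?thesis unfolding s_def using subring_poly[OF S ps(1)] subring_mult[OF S] by blast
  next
    case False
    then have y0: "y \<noteq> 0" and iy: "inverse y \<in> R" using vring_not_in[OF R] by (auto simp: max_ideal_iff)
    have "p = monom 1 k * poly_shift k p + poly_cutoff k p"
      by (rule poly_eqI) (auto simp: coeff_monom_mult coeff_poly_shift coeff_poly_cutoff)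
    then have "0 = y ^ k * s + poly (poly_cutoff k p) y"
      using y by (metis mult_1 poly_add poly_monom poly_mult s_def)
    also have "poly (poly_cutoff k p) y = (\<Sum>i<k. coeff p i * y ^ i)"
    proof -
      have "poly_cutoff k p = (\<Sum>i<k. monom (coeff p i) i)"
        by (rule poly_eqI) (auto simp: coeff_poly_cutoff coeff_sum)
      then show ?thesis by (simp add: poly_sum poly_monom)
    qed
    finally have "y ^ k * s = - (\<Sum>i<k. coeff p i * y ^ i)" by (simp add: eq_neg_iff_add_eq_0)
    \<comment> \<open>For y outside \<open>R\<close>, the relation p(y) = 0 trades the upper part of
      \<open>p\<close> for its lower part, which after division by y^k involves only powers of
      \<open>inverse y\<close>.\<close>
    then have "s = - (inverse y ^ k * (\<Sum>i<k. coeff p i * y ^ i))"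
      using y0 by (simp add: field_simps power_inverse)
    also have "inverse y ^ k * (\<Sum>i<k. coeff p i * y ^ i) = (\<Sum>i<k. coeff p i * inverse y ^ (k - i))"
      unfolding sum_distrib_left using y0 by (intro sum.cong refl) (simp add: power_diff field_simps)
    finally have s: "s = - (\<Sum>i<k. coeff p i * inverse y ^ (k - i))" .
    have "s \<in> R"
      unfolding s by (intro subring_uminus[OF S] subring_sum[OF S] subring_mult[OF S]
          polys_inD[OF p] subring_power[OF S iy])
    moreover have "s * y = - (\<Sum>i<k. coeff p i * inverse y ^ (k - i - 1))"
      unfolding s sum_distrib_right minus_mult_left[symmetric]
    proof (intro arg_cong[of _ _ uminus] sum.cong refl)
      fix i assume "i \<in> {..<k}"
      then obtain j where "k - i = Suc j" by (auto dest: less_imp_Suc_add)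
      then show "coeff p i * inverse y ^ (k - i) * y = coeff p i * inverse y ^ (k - i - 1)"
        using y0 by simp
    qed
    then have "s * y \<in> R"
      by (simp only:) (intro subring_uminus[OF S] subring_sum[OF S] subring_mult[OF S]
          polys_inD[OF p] subring_power[OF S iy])
    ultimately show ?thesis by blast
  qed
  then show "poly (poly_shift k p) y \<in> R" "poly (poly_shift k p) y * y \<in> R" by (simp_all add: s_def)
qed

text \<open>Instantiated by the Galois group acting on the algebraic closure and on its rational
  function field. The last two assumptions express compactness for pointwise convergence: orbits are
  finite, and a map that agrees with group elements on all finite sets belongs to the group.\<close>

locale profinite_action =
  fixes G :: "('a::field \<Rightarrow> 'a) set"
  assumes hom: "g \<in> G \<Longrightarrow> field_hom g"
    and id: "(\<lambda>x. x) \<in> G"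
    and comp: "g \<in> G \<Longrightarrow> h \<in> G \<Longrightarrow> g \<circ> h \<in> G"
    and inv: "g \<in> G \<Longrightarrow> \<exists>h\<in>G. \<forall>x. h (g x) = x \<and> g (h x) = x"
    and finite_orbit: "finite ((\<lambda>g. g x) ` G)"
    and closed: "(\<And>S. finite S \<Longrightarrow> \<exists>g\<in>G. \<forall>x\<in>S. f x = g x) \<Longrightarrow> f \<in> G"
begin

text \<open>Values g x = y are prescribed by a set \<open>r\<close> of pairs, as long as finitely
  many prescriptions and finitely many conditions can always be met together. A maximal
  \<open>r\<close> is total: if each value in the finite orbit of x were excluded by finite data,
  the union of these data would still be finite and could not be met.\<close>

lemma compactness:
  assumes fin: "\<And>S0. finite S0 \<Longrightarrow> S0 \<subseteq> S \<Longrightarrow> \<exists>g\<in>G. \<forall>x\<in>S0. P x (g x)"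
  shows "\<exists>g\<in>G. \<forall>x\<in>S. P x (g x)"
proof -
  define ok where "ok = (\<lambda>r. \<forall>T S0. finite T \<longrightarrow> T \<subseteq> r \<longrightarrow> finite S0 \<longrightarrow> S0 \<subseteq> S \<longrightarrow>
     (\<exists>g\<in>G. (\<forall>(x, y)\<in>T. g x = y) \<and> (\<forall>x\<in>S0. P x (g x))))"
  have okD: "\<exists>g\<in>G. (\<forall>(x, y)\<in>T. g x = y) \<and> (\<forall>x\<in>S0. P x (g x))"
    if "ok r" "finite T" "T \<subseteq> r" "finite S0" "S0 \<subseteq> S" for r T S0
    using that unfolding ok_def by blast
  have "\<exists>r\<in>Collect ok. \<forall>X\<in>Collect ok. r \<subseteq> X \<longrightarrow> X = r"
  proof (rule subset_Zorn_nonempty)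
    have "ok {}" using fin by (simp add: ok_def)
    then show "Collect ok \<noteq> {}" by blast
    fix C assume C: "C \<noteq> {}" "subset.chain (Collect ok) C"
    have "ok (\<Union>C)"
      unfolding ok_def
    proof (intro allI impI)
      fix T S0 assume *: "finite T" "T \<subseteq> \<Union>C" "finite S0" "S0 \<subseteq> S"
      obtain r where "r \<in> C" "T \<subseteq> r" by (rule finite_subset_Union_chain[OF *(1,2) C])
      moreover from this have "ok r" using C(2) by (auto simp: subset.chain_def)
      ultimately show "\<exists>g\<in>G. (\<forall>(x, y)\<in>T. g x = y) \<and> (\<forall>x\<in>S0. P x (g x))" using okD * by blast
    qed
    then show "\<Union>C \<in> Collect ok" by simp
  qed
  then obtain r where r: "ok r" "\<And>X. ok X \<Longrightarrow> r \<subseteq> X \<Longrightarrow> X = r" by blast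
  have total: "\<exists>y. (x, y) \<in> r" for x
  proof (rule ccontr)
    assume x: "\<not> ?thesis"
    have "\<exists>T S0. finite T \<and> T \<subseteq> r \<and> finite S0 \<and> S0 \<subseteq> S \<and>
        (\<forall>g\<in>G. g x = y \<longrightarrow> (\<forall>(x, y)\<in>T. g x = y) \<longrightarrow> \<not> (\<forall>x\<in>S0. P x (g x)))" for y
    proof -
      have "\<not> ok (insert (x, y) r)" using r(2)[of "insert (x, y) r"] x by blast
      then obtain T S0 where T: "finite T" "T \<subseteq> insert (x, y) r" "finite S0" "S0 \<subseteq> S"
        "\<not> (\<exists>g\<in>G. (\<forall>(x, y)\<in>T. g x = y) \<and> (\<forall>x\<in>S0. P x (g x)))"
        unfolding ok_def by blast
      have "\<not> (\<forall>x\<in>S0. P x (g x))" if "g \<in> G" "g x = y" "\<forall>(x, y)\<in>T - {(x, y)}. g x = y" for g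
      proof -
        have "g a = b" if ab: "(a, b) \<in> T" for a b
          using \<open>g x = y\<close> bspec[OF \<open>\<forall>(x, y)\<in>T - {(x, y)}. g x = y\<close>, of "(a, b)"] ab
          by (cases "(a, b) = (x, y)") auto
        then have "\<forall>(x, y)\<in>T. g x = y" by blast
        then show ?thesis using T(5) that(1) by blast
      qed
      moreover have "finite (T - {(x, y)})" "T - {(x, y)} \<subseteq> r" using T by auto
      ultimately show ?thesis using T(3,4) by blast
    qed
    then obtain T S0 where T: "\<And>y. finite (T y) \<and> T y \<subseteq> r \<and> finite (S0 y) \<and> S0 y \<subseteq> S \<and>
        (\<forall>g\<in>G. g x = y \<longrightarrow> (\<forall>(x, y)\<in>T y. g x = y) \<longrightarrow> \<not> (\<forall>x\<in>S0 y. P x (g x)))"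
      by metis
    define orb where "orb = (\<lambda>g. g x) ` G"
    have "finite orb" using finite_orbit by (simp add: orb_def)
    have "\<exists>g\<in>G. (\<forall>(x, y)\<in>(\<Union>y\<in>orb. T y). g x = y) \<and> (\<forall>x\<in>(\<Union>y\<in>orb. S0 y). P x (g x))"
    proof (rule okD[OF r(1)])
      show "finite (\<Union>y\<in>orb. T y)" "finite (\<Union>y\<in>orb. S0 y)" using \<open>finite orb\<close> T by blast+
      show "(\<Union>y\<in>orb. T y) \<subseteq> r" "(\<Union>y\<in>orb. S0 y) \<subseteq> S" using T by blast+
    qed
    then obtain g where g: "g \<in> G" "\<forall>(x, y)\<in>(\<Union>y\<in>orb. T y). g x = y"
      "\<forall>x\<in>(\<Union>y\<in>orb. S0 y). P x (g x)" by blast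
    have "g x \<in> orb" using g(1) by (simp add: orb_def)
    then have sub: "T (g x) \<subseteq> (\<Union>y\<in>orb. T y)" "S0 (g x) \<subseteq> (\<Union>y\<in>orb. S0 y)" by blast+
    have "\<forall>(x', y)\<in>T (g x). g x' = y" "\<forall>x'\<in>S0 (g x). P x' (g x')"
      using sub g(2,3) by (meson subsetD)+
    then show False using T[of "g x"] g(1) by blast
  qed
  then obtain f where f: "\<And>x. (x, f x) \<in> r" by metis
  have fg: "\<exists>g\<in>G. (\<forall>x\<in>T. f x = g x) \<and> (\<forall>x\<in>S0. P x (g x))" if "finite T" "finite S0" "S0 \<subseteq> S" for T S0
  proof -
    have "\<exists>g\<in>G. (\<forall>(x, y)\<in>(\<lambda>x. (x, f x)) ` T. g x = y) \<and> (\<forall>x\<in>S0. P x (g x))"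
      by (rule okD[OF r(1)]) (use f that in auto)
    then obtain g where "g \<in> G" "\<forall>(x, y)\<in>(\<lambda>x. (x, f x)) ` T. g x = y" "\<forall>x\<in>S0. P x (g x)" by blast
    then show ?thesis by (intro bexI[of _ g]) auto
  qed
  have "f \<in> G" using fg[of _ "{}"] by (intro closed) auto
  moreover have "P x (f x)" if "x \<in> S" for x using fg[of "{x}" "{x}"] that by auto
  ultimately show ?thesis by blast
qed

lemma orbit_image:
  assumes "g \<in> G" shows "map_poly g ` (\<lambda>h. map_poly h p) ` G = (\<lambda>h. map_poly h p) ` G"
proof
  show "map_poly g ` (\<lambda>h. map_poly h p) ` G \<subseteq> (\<lambda>h. map_poly h p) ` G"
    using comp[OF assms] hom assms by (auto simp: map_poly_hom_comp)
  show "(\<lambda>h. map_poly h p) ` G \<subseteq> map_poly g ` (\<lambda>h. map_poly h p) ` G"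
  proof safe
    fix h assume h: "h \<in> G"
    obtain g' where g': "g' \<in> G" "\<forall>x. g' (g x) = x \<and> g (g' x) = x" using inv[OF assms] by blast
    have "map_poly h p = map_poly g (map_poly (g' \<circ> h) p)"
      using g' h assms hom comp by (intro poly_eqI) (simp add: coeff_map_hom)
    then show "map_poly h p \<in> map_poly g ` (\<lambda>h. map_poly h p) ` G" using comp[OF g'(1) h] by blast
  qed
qed

lemma finite_poly_orbit: "finite ((\<lambda>h. map_poly h p) ` G)"
proof -
  define O' where "O' = (\<Union>i\<le>degree p. (\<lambda>g. g (coeff p i)) ` G)"
  have "(\<lambda>h. map_poly h p) ` G \<subseteq> {q. degree q \<le> degree p \<and> (\<forall>i\<le>degree p. coeff q i \<in> O')}"
    unfolding O'_def by (fastforce simp: coeff_map_hom hom intro: map_poly_degree_leq)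
  also have "\<dots> \<subseteq> Poly ` {xs. set xs \<subseteq> O' \<and> length xs = Suc (degree p)}"
  proof safe
    fix q :: "'a poly" assume q: "degree q \<le> degree p" "\<forall>i\<le>degree p. coeff q i \<in> O'"
    have "q = Poly (map (coeff q) [0..<Suc (degree p)])"
      using q(1) by (intro poly_eqI) (auto simp: nth_default_def coeff_eq_0 simp del: upt_Suc)
    moreover have "set (map (coeff q) [0..<Suc (degree p)]) \<subseteq> O'"
      using q(2) by (auto simp del: upt_Suc)
    ultimately show "q \<in> Poly ` {xs. set xs \<subseteq> O' \<and> length xs = Suc (degree p)}"
      by (intro image_eqI) (auto simp del: upt_Suc)
  qed
  finally show ?thesis
    by (rule finite_subset) (auto simp: O'_def finite_orbit intro!: finite_imageI finite_lists_length_eq)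
qed

text \<open>The product runs over the distinct conjugates of \<open>p\<close>, a finite set even
  when \<open>G\<close> is infinite. Multiplicities are lost, but invariance under \<open>G\<close>
  and divisibility by each conjugate are kept.\<close>

definition poly_norm :: "'a poly \<Rightarrow> 'a poly" where
  "poly_norm p = \<Prod>((\<lambda>h. map_poly h p) ` G)"

lemma poly_norm_fixed:
  assumes "g \<in> G" shows "g (coeff (poly_norm p) i) = coeff (poly_norm p) i"
proof -
  have "map_poly g (poly_norm p) = (\<Prod>q\<in>(\<lambda>h. map_poly h p) ` G. map_poly g q)"
    by (simp add: poly_norm_def map_poly_hom_prod hom[OF assms])
  also have "\<dots> = \<Prod>(map_poly g ` (\<lambda>h. map_poly h p) ` G)"
    using map_poly_hom_inj[OF hom[OF assms]] by (subst prod.reindex) (auto intro: inj_on_subset)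
  finally have "map_poly g (poly_norm p) = poly_norm p" by (simp add: orbit_image[OF assms] poly_norm_def)
  then show ?thesis by (metis coeff_map_hom hom assms)
qed

lemma poly_norm_factor:
  assumes "g \<in> G" shows "poly_norm p = map_poly g p * \<Prod>((\<lambda>h. map_poly h p) ` G - {map_poly g p})"
  unfolding poly_norm_def using assms by (intro prod.remove finite_poly_orbit) auto

definition conj_core :: "'a set \<Rightarrow> 'a set" where
  "conj_core W = {x. \<forall>g\<in>G. g x \<in> W}"

lemma subring_conj_core:
  assumes "subring W" shows "subring (conj_core W)"
  using assms unfolding subring_def conj_core_def
  by (auto simp: field_hom_0 field_hom_1 field_hom_add field_hom_diff field_hom_mult hom)

lemma conj_core_subset: "conj_core W \<subseteq> W"
  using id by (auto simp: conj_core_def)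

lemma conj_core_conj: "g \<in> G \<Longrightarrow> x \<in> conj_core W \<Longrightarrow> g x \<in> conj_core W"
  using comp by (fastforce simp: conj_core_def)

text \<open>The norm of X - x is the product of X - y over the orbit of x, so it serves as an
  integral equation with fixed coefficients for all conjugates of x at once.\<close>

lemma poly_norm_linear:
  shows "lead_coeff (poly_norm [:- x, 1:]) = 1" "g \<in> G \<Longrightarrow> poly (poly_norm [:- x, 1:]) (g x) = 0"
proof -
  have *: "map_poly h [:- x, 1:] = [:- h x, 1:]" if "h \<in> G" for h
    using hom[OF that] by (simp add: map_poly_hom_pCons field_hom_uminus field_hom_1)
  have "lead_coeff q = 1" if "q \<in> (\<lambda>h. map_poly h [:- x, 1:]) ` G" for q using that * by auto
  then show "lead_coeff (poly_norm [:- x, 1:]) = 1"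
    unfolding poly_norm_def by (simp add: lead_coeff_prod)
  show "poly (poly_norm [:- x, 1:]) (g x) = 0" if "g \<in> G"
    using poly_norm_factor[OF that, of "[:- x, 1:]"] *[OF that] by simp
qed

text \<open>This exhibits \<open>W\<close> as a localisation of \<open>conj_core W\<close>. The norm
  of X - x is scaled so that its last coefficient of minimal value, at \<open>k\<close>, becomes 1.
  The tail from \<open>k\<close> on, evaluated at x, is then 1 plus an element of the maximal ideal.
  Its coefficients are fixed, so the conjugates of \<open>s\<close> are the same tail at the
  conjugates of x, and \<open>horner_tail_mem\<close> applies to each of them.\<close>

lemma conj_core_fraction:
  assumes W: "vring W" and x: "x \<in> W"
  obtains s where "s \<in> conj_core W" "s \<notin> max_ideal W" "s * x \<in> conj_core W"
proof -
  note S = valuation_ring_subring[OF W] note M = vring_prime[OF W]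
  define Q where "Q = poly_norm [:- x, 1:]"
  have "Q \<noteq> 0" using poly_norm_linear(1)[of x] by (auto simp: Q_def)
  then obtain k where k: "coeff Q k \<noteq> 0" "\<And>j. coeff Q j / coeff Q k \<in> W"
    "\<And>j. j > k \<Longrightarrow> coeff Q j / coeff Q k \<in> max_ideal W" using dominant_coeff[OF W] by blast
  define p where "p = smult (inverse (coeff Q k)) Q"
  have cp: "coeff p j = coeff Q j / coeff Q k" for j by (simp add: p_def field_simps)
  have p: "p \<in> polys_in W" using k(2) by (simp add: polys_in_def cp)
  have fixed: "g (coeff p j) = coeff p j" if "g \<in> G" for g j
    using poly_norm_fixed[OF that] hom[OF that]
    by (simp add: cp Q_def divide_inverse field_hom_mult field_hom_inverse)
  have mp: "map_poly g (poly_shift k p) = poly_shift k p" if "g \<in> G" for g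
    using fixed[OF that] hom[OF that] by (intro poly_eqI) (simp add: coeff_map_hom coeff_poly_shift)
  define s where "s = poly (poly_shift k p) x"
  have gs: "g s = poly (poly_shift k p) (g x)" if "g \<in> G" for g
    using poly_map_hom[OF hom[OF that], of "poly_shift k p" x] mp[OF that] by (simp add: s_def)
  have root: "poly p (g x) = 0" if "g \<in> G" for g
    using poly_norm_linear(2)[OF that, of x] by (simp add: p_def Q_def)
  have "g s \<in> W" "g (s * x) \<in> W" if "g \<in> G" for g
    unfolding field_hom_mult[OF hom[OF that]] gs[OF that] using horner_tail_mem[OF W p root[OF that]] .
  then have "s \<in> conj_core W" "s * x \<in> conj_core W" by (auto simp: conj_core_def)
  moreover have "s \<notin> max_ideal W"
  proof
    assume s: "s \<in> max_ideal W"
    obtain a q where aq: "poly_shift k p = pCons a q" by (cases "poly_shift k p")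
    have "a = coeff p k" using arg_cong[OF aq, of "\<lambda>f. coeff f 0"] by (simp add: coeff_poly_shift)
    then have a: "a = 1" using k(1) by (simp add: cp)
    have "coeff q j = coeff p (k + Suc j)" for j
      using arg_cong[OF aq, of "\<lambda>f. coeff f (Suc j)"] by (simp add: coeff_poly_shift add.commute)
    then have "q \<in> polys_in (max_ideal W)" using k(3) by (simp add: polys_in_def cp)
    then have "poly q x \<in> max_ideal W"
      using x by (induction q) (auto intro: prime_ideal_ofD[OF M])
    then have "x * poly q x \<in> max_ideal W" using prime_ideal_ofD(5)[OF M x] by blast
    moreover have "s = 1 + x * poly q x" by (simp add: s_def aq a)
    ultimately show False using prime_ideal_diff[OF valuation_ring_subring[OF W] M s] prime_ideal_ofD(3)[OF M] by fastforce
  qed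
  ultimately show thesis using that by blast
qed

context
  fixes W1 W2 F
  assumes W1: "vring W1" and W2: "vring W2" and agree: "W1 \<inter> F = W2 \<inter> F"
    and fixed_power: "\<And>x. \<forall>g\<in>G. g x = x \<Longrightarrow> \<exists>n>0. x ^ n \<in> F"
begin

text \<open>A power of a fixed element lies in \<open>F\<close>, where the two rings agree, and each
  ring contains an element exactly when it contains that power.\<close>

lemma fixed_agree:
  assumes "\<forall>g\<in>G. g x = x" shows "x \<in> W1 \<longleftrightarrow> x \<in> W2"
proof -
  obtain n where "n > 0" "x ^ n \<in> F" using fixed_power[OF assms] by blast
  then show ?thesis using vring_power_iff[OF W1, of n x] vring_power_iff[OF W2, of n x] agree by blast
qed

lemma fixed_agree_max:
  assumes "\<forall>g\<in>G. g x = x" shows "x \<in> max_ideal W1 \<longleftrightarrow> x \<in> max_ideal W2"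
  using fixed_agree[OF assms] fixed_agree[of "inverse x"] assms hom
  by (auto simp: max_ideal_iff field_hom_inverse)

text \<open>The norm of X - x has coefficients in \<open>W1\<close>; they are fixed and so lie in
  \<open>W2\<close>. All conjugates of x are roots of this monic polynomial, hence integral over
  \<open>W2\<close>.\<close>

lemma conj_core_le: "conj_core W1 \<subseteq> conj_core W2"
proof
  fix x assume x: "x \<in> conj_core W1"
  define Q where "Q = poly_norm [:- x, 1:]"
  note S = valuation_ring_subring[OF W1]
  have "Q \<in> polys_in W1"
    unfolding Q_def poly_norm_def
  proof (rule subring_prod[OF subring_polys_in[OF S]])
    fix q assume "q \<in> (\<lambda>h. map_poly h [:- x, 1:]) ` G"
    then obtain h where "h \<in> G" "q = [:- h x, 1:]"
      using hom by (auto simp: map_poly_hom_pCons field_hom_uminus field_hom_1)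
    then show "q \<in> polys_in W1"
      using x subring_uminus[OF S, of "h x"] subring_1[OF S] subring_0[OF S]
      by (simp add: conj_core_def polys_in_0)
  qed
  then have "Q \<in> polys_in W2"
    using fixed_agree[of "coeff Q _"] poly_norm_fixed by (auto simp: polys_in_def Q_def)
  then show "x \<in> conj_core W2"
    using vring_integrally_closed[OF W2, of Q] poly_norm_linear(1)[of x] poly_norm_linear(2)[of _ x]
    by (simp add: conj_core_def Q_def)
qed

text \<open>The norm of a polynomial whose coefficients are the given elements has coefficients in the first
  maximal ideal, hence in the second, so by Gauss' lemma one of its factors does.\<close>

lemma conj_core_ideal_conj: "\<exists>g\<in>G. \<forall>x\<in>conj_core W1 \<inter> max_ideal W1. g x \<in> max_ideal W2"
proof (rule compactness)
  fix S0 assume S0: "finite S0" "S0 \<subseteq> conj_core W1 \<inter> max_ideal W1"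
  note S1 = valuation_ring_subring[OF W1] note S2 = valuation_ring_subring[OF W2]
  note M1 = vring_prime[OF W1] note M2 = vring_prime[OF W2]
  obtain xs where xs: "set xs = S0" using finite_list[OF S0(1)] by blast
  define p where "p = Poly xs"
  have cp: "coeff p i \<in> insert 0 S0" for i
    unfolding p_def coeff_Poly_eq xs[symmetric] by (auto simp: nth_default_def)
  have pM: "p \<in> polys_in (max_ideal W1)"
    unfolding polys_in_def
  proof (intro CollectI allI)
    fix i show "coeff p i \<in> max_ideal W1" using cp[of i] S0(2) prime_ideal_ofD(2)[OF M1] by auto
  qed
  have pc: "coeff p i \<in> conj_core W1" for i
    using cp[of i] S0(2) subring_0[OF subring_conj_core[OF S1]] by auto
  have hp: "map_poly h p \<in> polys_in (conj_core W1)" if "h \<in> G" for h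
    using pc conj_core_conj[OF that] hom[OF that] by (simp add: polys_in_def coeff_map_hom)
  have "poly_norm p \<in> polys_in (max_ideal W1)"
  proof -
    \<comment> \<open>The identity belongs to \<open>G\<close>, so \<open>p\<close> is itself a
      factor of its norm.\<close>
    have "map_poly (\<lambda>x. x) p = p" by simp
    then have "poly_norm p = p * \<Prod>((\<lambda>h. map_poly h p) ` G - {p})" using poly_norm_factor[OF id, of p] by simp
    moreover have "\<Prod>((\<lambda>h. map_poly h p) ` G - {p}) \<in> polys_in W1"
      using hp conj_core_subset[of W1] by (intro subring_prod[OF subring_polys_in[OF S1]])
        (auto intro: polys_in_mono)
    ultimately show ?thesis using polys_in_ideal_mult[OF M1 pM] by simp
  qed
  then have nM: "poly_norm p \<in> polys_in (max_ideal W2)"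
    using fixed_agree_max[of "coeff (poly_norm p) _"] poly_norm_fixed by (simp add: polys_in_def)
  have "\<exists>g\<in>G. map_poly g p \<in> polys_in (max_ideal W2)"
  proof (rule ccontr)
    assume neg: "\<not> ?thesis"
    have "poly_norm p \<notin> polys_in (max_ideal W2)"
      unfolding poly_norm_def
      using neg hp polys_in_mono[OF order_trans[OF conj_core_le conj_core_subset[of W2]]]
      by (intro gauss_lemma_prod[OF S2 M2]) auto
    then show False using nM by blast
  qed
  then obtain g where g: "g \<in> G" "map_poly g p \<in> polys_in (max_ideal W2)" by blast
  have "g x \<in> max_ideal W2" if x: "x \<in> S0" for x
  proof -
    obtain i where "i < length xs" "x = xs ! i" using x xs by (metis in_set_conv_nth)
    then have "x = coeff p i" by (simp add: p_def nth_default_def)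
    then show ?thesis using polys_inD[OF g(2), of i] hom[OF g(1)] by (simp add: coeff_map_hom)
  qed
  then show "\<exists>g\<in>G. \<forall>x\<in>S0. g x \<in> max_ideal W2" using g(1) by blast
qed

end

text \<open>The iterates of \<open>g\<close> take finitely many values at x, so two of them agree;
  by injectivity the coincidence can be pulled back to x itself.\<close>

lemma funpow_orbit:
  assumes "g \<in> G" obtains k where "k > 0" "(g ^^ k) x = x"
proof -
  have pw: "g ^^ n \<in> G" for n
  proof (induction n)
    case 0 then show ?case using id by (simp add: id_def)
  next
    case (Suc n) then show ?case using comp[OF assms] by (simp only: funpow.simps)
  qed
  then have "range (\<lambda>n. (g ^^ n) x) \<subseteq> (\<lambda>g. g x) ` G" by blast
  then have "finite (range (\<lambda>n. (g ^^ n) x))" using finite_orbit finite_subset by blast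
  then have "\<not> inj (\<lambda>n. (g ^^ n) x)" using finite_imageD by blast
  then obtain m n where "m < n" "(g ^^ m) x = (g ^^ n) x" unfolding inj_def by (metis linorder_neqE_nat)
  then have "(g ^^ m) ((g ^^ (n - m)) x) = (g ^^ m) x"
    by (metis comp_apply funpow_add le_add_diff_inverse less_imp_le_nat)
  then have "(g ^^ (n - m)) x = x" using field_hom_inj[OF hom[OF pw[of m]]] by (simp add: inj_eq)
  then show thesis using that[of "n - m"] \<open>m < n\<close> by simp
qed

text \<open>Compactness only gives inclusions between the primes, one in each direction. Once
  \<open>g\<close> is known to match the two primes of \<open>A\<close> exactly, it also matches the
  localisations of \<open>A\<close> at them, which are \<open>W1\<close> and
  \<open>W2\<close>.\<close>

theorem valuation_rings_conjugate:
  assumes W1: "vring W1" and W2: "vring W2" and agree: "W1 \<inter> F = W2 \<inter> F"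
    and fixed_power: "\<And>x. \<forall>g\<in>G. g x = x \<Longrightarrow> \<exists>n>0. x ^ n \<in> F"
  obtains g where "g \<in> G" "g ` W1 = W2"
proof -
  note S1 = valuation_ring_subring[OF W1] note S2 = valuation_ring_subring[OF W2]
  define A where "A = conj_core W1"
  have A2: "A = conj_core W2"
    using conj_core_le[OF W1 W2 agree fixed_power] conj_core_le[OF W2 W1 agree[symmetric] fixed_power]
    by (simp add: A_def subset_antisym)
  obtain g where g: "g \<in> G" "\<And>x. x \<in> A \<Longrightarrow> x \<in> max_ideal W1 \<Longrightarrow> g x \<in> max_ideal W2"
    using conj_core_ideal_conj[OF W1 W2 agree fixed_power] by (auto simp: A_def)
  obtain h where h: "h \<in> G" "\<And>x. x \<in> A \<Longrightarrow> x \<in> max_ideal W2 \<Longrightarrow> h x \<in> max_ideal W1"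
    using conj_core_ideal_conj[OF W2 W1 agree[symmetric] fixed_power] by (auto simp: A2)
  have gA: "\<And>f x. f \<in> G \<Longrightarrow> x \<in> A \<Longrightarrow> f x \<in> A" using conj_core_conj by (simp add: A_def)
  \<comment> \<open>\<open>h \<circ> g\<close> has finite orbits and maps the prime \<open>A \<inter> max_ideal W1\<close> into itself, hence onto itself.\<close>
  have reflect: "x \<in> max_ideal W1" if x: "x \<in> A" "g x \<in> max_ideal W2" for x
  proof -
    obtain k where k: "k > 0" "((h \<circ> g) ^^ k) x = x" using funpow_orbit[OF comp[OF h(1) g(1)]] by blast
    have "((h \<circ> g) ^^ Suc n) x \<in> A \<inter> max_ideal W1" for n
    proof (induction n)
      case 0 then show ?case using x g(1) h gA by simp
    next
      case (Suc n) then show ?case using g h gA by simp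
    qed
    then show ?thesis using k by (metis IntE Suc_pred)
  qed
  have "g x \<in> W2" if x: "x \<in> W1" for x
  proof -
    obtain s where s: "s \<in> A" "s \<notin> max_ideal W1" "s * x \<in> A"
      using conj_core_fraction[OF W1 x] unfolding A_def by blast
    have "g s \<in> A" "g s \<notin> max_ideal W2" using s reflect gA[OF g(1)] by blast+
    then have "g s \<noteq> 0" "inverse (g s) \<in> W2" using A2 conj_core_subset[of W2] by (auto simp: max_ideal_iff)
    moreover have "g (s * x) \<in> W2" using gA[OF g(1) s(3)] A2 conj_core_subset[of W2] by blast
    ultimately have "inverse (g s) * g (s * x) \<in> W2" using subring_mult[OF S2] by blast
    then show ?thesis using \<open>g s \<noteq> 0\<close> hom[OF g(1)] by (simp add: field_hom_mult mult.assoc[symmetric])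
  qed
  moreover have "\<exists>x\<in>W1. y = g x" if y: "y \<in> W2" for y
  proof -
    obtain f where f: "f \<in> G" "\<And>x. f (g x) = x" "\<And>x. g (f x) = x" using inv[OF g(1)] by blast
    obtain s where s: "s \<in> A" "s \<notin> max_ideal W2" "s * y \<in> A"
      using conj_core_fraction[OF W2 y] unfolding A2 by blast
    have "f s \<notin> max_ideal W1" using g(2)[OF gA[OF f(1) s(1)]] f(3) s(2) by metis
    moreover have "f s \<in> W1" "f (s * y) \<in> W1"
      using gA[OF f(1)] s conj_core_subset[of W1] unfolding A_def by blast+
    ultimately have "f s \<noteq> 0" "inverse (f s) * f (s * y) \<in> W1"
      using subring_mult[OF S1] by (auto simp: max_ideal_iff)
    then have "f y \<in> W1" using hom[OF f(1)] by (simp add: field_hom_mult mult.assoc[symmetric])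
    then show ?thesis using f(3) by metis
  qed
  ultimately have "g ` W1 = W2" by blast
  then show thesis using that g(1) by blast
qed

end

subsection \<open>The action of the Galois group on rational functions\<close>

lemma Gal_hom: "\<sigma> \<in> Gal K \<Longrightarrow> field_hom \<sigma>"
  by (auto simp: Gal_def field_hom_def)

lemma Gal_const: "\<sigma> \<in> Gal K \<Longrightarrow> c \<in> K \<Longrightarrow> \<sigma> c = c"
  by (auto simp: Gal_def)

lemma Gal_id: "(\<lambda>x. x) \<in> Gal K"
  by (auto simp: Gal_def intro: bij_id[unfolded id_def])

lemma Gal_comp: "\<sigma> \<in> Gal K \<Longrightarrow> \<tau> \<in> Gal K \<Longrightarrow> \<sigma> \<circ> \<tau> \<in> Gal K"
  by (auto simp: Gal_def intro: bij_comp)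

lemma Gal_inverse:
  assumes "\<sigma> \<in> Gal K" obtains \<tau> where "\<tau> \<in> Gal K" "\<And>x. \<tau> (\<sigma> x) = x" "\<And>x. \<sigma> (\<tau> x) = x"
proof -
  have b: "bij \<sigma>" using assms by (auto simp: Gal_def)
  have 1: "Hilbert_Choice.inv \<sigma> (\<sigma> x) = x" "\<sigma> (Hilbert_Choice.inv \<sigma> x) = x" for x
    using b by (auto simp: bij_def surj_f_inv_f)
  note hom = Gal_hom[OF assms]
  have "Hilbert_Choice.inv \<sigma> \<in> Gal K"
    unfolding Gal_def
  proof (intro CollectI conjI allI ballI)
    show "bij (Hilbert_Choice.inv \<sigma>)" by (rule bij_imp_bij_inv[OF b])
    show "Hilbert_Choice.inv \<sigma> 1 = 1" using 1(1)[of 1] field_hom_1[OF hom] by simp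
    fix x y
    show "Hilbert_Choice.inv \<sigma> (x + y) = Hilbert_Choice.inv \<sigma> x + Hilbert_Choice.inv \<sigma> y"
      by (metis 1 field_hom_add[OF hom])
    show "Hilbert_Choice.inv \<sigma> (x * y) = Hilbert_Choice.inv \<sigma> x * Hilbert_Choice.inv \<sigma> y"
      by (metis 1 field_hom_mult[OF hom])
  next
    fix c assume "c \<in> K" then show "Hilbert_Choice.inv \<sigma> c = c" using 1(1)[of c] Gal_const[OF assms] by simp
  qed
  then show thesis using that 1 by blast
qed

lemma map_poly_Gal_const: "\<sigma> \<in> Gal K \<Longrightarrow> p \<in> polys_in K \<Longrightarrow> map_poly \<sigma> p = p"
  by (rule poly_eqI) (simp add: coeff_map_hom Gal_hom Gal_const polys_inD)

lemma Gal_root: "\<sigma> \<in> Gal K \<Longrightarrow> p \<in> polys_in K \<Longrightarrow> poly p x = 0 \<Longrightarrow> poly p (\<sigma> x) = 0"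
  using poly_map_hom[OF Gal_hom, of \<sigma> K p x] by (simp add: map_poly_Gal_const Gal_hom field_hom_0)

text \<open>A pointwise limit of automorphisms inherits all identities and injectivity from finite
  sets; it is onto because it permutes the finite set of roots of a nonzero polynomial over
  \<open>K\<close>.\<close>

lemma profinite_action_Gal:
  fixes K :: "'k::field set"
  assumes K: "subfield_of K" and alg: "algebraic_over K"
  shows "profinite_action (Gal K)"
proof
  show "\<exists>h\<in>Gal K. \<forall>x. h (g x) = x \<and> g (h x) = x" if "g \<in> Gal K" for g
    using Gal_inverse[OF that] by metis
  show "finite ((\<lambda>g. g x) ` Gal K)" for x
  proof -
    obtain p where p: "p \<noteq> 0" "p \<in> polys_in K" "poly p x = 0" using algebraic_overD[OF alg] by blast
    show ?thesis
      by (rule finite_subset[OF _ poly_roots_finite[OF p(1)]]) (use Gal_root p in blast)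
  qed
  fix f assume f: "\<And>S. finite S \<Longrightarrow> \<exists>g\<in>Gal K. \<forall>x\<in>S. f x = g x"
  have inj: "inj f"
  proof (rule injI)
    fix x y assume "f x = f y"
    moreover obtain g where "g \<in> Gal K" "f x = g x" "f y = g y" using f[of "{x, y}"] by auto
    ultimately show "x = y" using field_hom_inj[OF Gal_hom] by (metis injD)
  qed
  have "y \<in> range f" for y
  proof -
    obtain p where p: "p \<noteq> 0" "p \<in> polys_in K" "poly p y = 0" using algebraic_overD[OF alg] by blast
    have "f ` {x. poly p x = 0} \<subseteq> {x. poly p x = 0}"
    proof safe
      fix x assume "poly p x = 0"
      moreover obtain g where "g \<in> Gal K" "f x = g x" using f[of "{x}"] by auto
      ultimately show "poly p (f x) = 0" using Gal_root p(2) by metis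
    qed
    then have "f ` {x. poly p x = 0} = {x. poly p x = 0}"
      using endo_inj_surj[OF poly_roots_finite[OF p(1)]] inj inj_on_subset by blast
    then show ?thesis using p(3) by blast
  qed
  then have "bij f" using inj by (auto simp: bij_def)
  moreover have "f (x + y) = f x + f y \<and> f (x * y) = f x * f y" for x y
  proof -
    obtain g where g: "g \<in> Gal K" "\<forall>z\<in>{x, y, x + y, x * y}. f z = g z" using f[of "{x, y, x + y, x * y}"] by auto
    then show ?thesis using field_hom_add[OF Gal_hom[OF g(1)]] field_hom_mult[OF Gal_hom[OF g(1)]] by simp
  qed
  moreover have "f c = c" if "c \<in> K" for c using f[of "{c}"] that Gal_const by auto
  moreover have "f 1 = 1" using f[of "{1}"] field_hom_1[OF Gal_hom] by auto
  ultimately show "f \<in> Gal K" by (auto simp: Gal_def)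
qed (auto intro: Gal_hom Gal_id Gal_comp)

section \<open>The induced action on the rational function field\<close>

definition map_fract :: "('k::field \<Rightarrow> 'k) \<Rightarrow> 'k poly fract \<Rightarrow> 'k poly fract" where
  "map_fract g f = (THE h. \<exists>p q. q \<noteq> 0 \<and> f = Fract p q \<and> h = Fract (map_poly g p) (map_poly g q))"

lemma map_fract_Fract:
  assumes g: "field_hom g" and q: "q \<noteq> 0"
  shows "map_fract g (Fract p q) = Fract (map_poly g p) (map_poly g q)"
  unfolding map_fract_def
proof (rule the_equality)
  fix h assume "\<exists>p' q'. q' \<noteq> 0 \<and> Fract p q = Fract p' q' \<and> h = Fract (map_poly g p') (map_poly g q')"
  then obtain p' q' where *: "q' \<noteq> 0" "Fract p q = Fract p' q'" "h = Fract (map_poly g p') (map_poly g q')"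
    by blast
  then have "p * q' = p' * q" using q by (simp add: eq_fract)
  then have "map_poly g p * map_poly g q' = map_poly g p' * map_poly g q"
    by (simp flip: map_poly_hom_mult[OF g])
  then show "h = Fract (map_poly g p) (map_poly g q)"
    using * q by (simp add: eq_fract map_poly_hom_eq_0[OF g])
qed (use q in blast)

lemma field_hom_map_fract:
  assumes g: "field_hom g" shows "field_hom (map_fract g)"
  unfolding field_hom_def
proof (intro conjI allI)
  fix x y :: "'a poly fract"
  obtain p q where x: "x = Fract p q" "q \<noteq> 0" by (cases x)
  obtain p' q' where y: "y = Fract p' q'" "q' \<noteq> 0" by (cases y)
  show "map_fract g (x + y) = map_fract g x + map_fract g y" "map_fract g (x * y) = map_fract g x * map_fract g y"
    using x y by (simp_all add: map_fract_Fract[OF g] map_poly_hom_add[OF g] map_poly_hom_mult[OF g]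
        map_poly_hom_eq_0[OF g])
qed (simp add: One_fract_def map_fract_Fract[OF g] field_hom_1[OF g])

lemma map_fract_comp:
  assumes "field_hom g" "field_hom h" shows "map_fract g (map_fract h x) = map_fract (g \<circ> h) x"
proof -
  obtain p q where x: "x = Fract p q" "q \<noteq> 0" by (cases x)
  have "field_hom (g \<circ> h)" using assms by (auto simp: field_hom_def)
  with x assms show ?thesis
    by (simp add: map_fract_Fract map_poly_hom_eq_0 map_poly_hom_comp)
qed

lemma map_fract_id: "map_fract (\<lambda>x. x) x = (x :: 'a::field poly fract)"
proof -
  obtain p q where x: "x = Fract p q" "q \<noteq> 0" by (cases x)
  have "field_hom (\<lambda>x::'a. x)" by (simp add: field_hom_def)
  with x show ?thesis by (simp add: map_fract_Fract)
qed

lemma map_fract_inverse: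
  assumes "\<sigma> \<in> Gal K" obtains \<tau> where "\<tau> \<in> Gal K"
    "\<And>x. map_fract \<tau> (map_fract \<sigma> x) = x" "\<And>x. map_fract \<sigma> (map_fract \<tau> x) = x"
    "\<And>x. \<sigma> (\<tau> x) = x"
proof -
  obtain \<tau> where \<tau>: "\<tau> \<in> Gal K" "\<And>x. \<tau> (\<sigma> x) = x" "\<And>x. \<sigma> (\<tau> x) = x" using Gal_inverse[OF assms] by blast
  then have "\<tau> \<circ> \<sigma> = (\<lambda>x. x)" "\<sigma> \<circ> \<tau> = (\<lambda>x. x)" by auto
  then have "map_fract \<tau> (map_fract \<sigma> x) = x" "map_fract \<sigma> (map_fract \<tau> x) = x" for x
    by (simp_all add: map_fract_comp Gal_hom[OF assms] Gal_hom[OF \<tau>(1)] map_fract_id)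
  then show thesis using that \<tau> by blast
qed

lemma const_fr_hom:
  "const_fr (x + y) = const_fr x + const_fr y" "const_fr (x * y) = const_fr x * const_fr y"
  "const_fr (x - y) = const_fr x - const_fr y" "const_fr 0 = 0" "const_fr 1 = 1"
  "const_fr x = const_fr y \<longleftrightarrow> x = y"
  by (simp_all add: const_fr_def One_fract_def Zero_fract_def eq_fract one_pCons)

lemma const_fr_eq_0: "const_fr x = 0 \<longleftrightarrow> x = 0"
  using const_fr_hom(6)[of x 0] by (simp add: const_fr_hom(4))

lemma const_fr_inverse: "const_fr (inverse x) = inverse (const_fr x)"
proof (cases "x = 0")
  case False
  then have "const_fr x * const_fr (inverse x) = 1"
    unfolding const_fr_hom(2)[symmetric] const_fr_hom(5)[symmetric] by simp
  then show ?thesis by (simp add: inverse_unique)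
qed (simp add: const_fr_hom)

lemma const_fr_divide: "const_fr (x / y) = const_fr x / const_fr y"
  by (simp add: divide_inverse const_fr_hom const_fr_inverse)

lemma const_fr_power: "const_fr (x ^ n) = const_fr x ^ n"
  by (induction n) (simp_all add: const_fr_hom)

lemma map_fract_const: "field_hom g \<Longrightarrow> map_fract g (const_fr c) = const_fr (g c)"
  by (simp add: const_fr_def map_fract_Fract map_poly_hom_pCons field_hom_1)

lemma Fract_power: "Fract p q ^ n = Fract (p ^ n) (q ^ n)"
  by (induction n) (simp_all add: One_fract_def)

lemma KX_iff: "f \<in> KX K \<longleftrightarrow> (\<exists>p q. q \<noteq> 0 \<and> p \<in> polys_in K \<and> q \<in> polys_in K \<and> f = Fract p q)"
  by (auto simp: KX_def polys_in_def)

lemma subfield_KX: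
  assumes K: "subfield_of K" shows "subfield_of (KX K)"
proof -
  note S = subring_polys_in[OF subfield_subring[OF K]]
  note [simp] = subring_0[OF S] subring_1[OF S]
  have "x + y \<in> KX K \<and> x - y \<in> KX K \<and> x * y \<in> KX K" if xy: "x \<in> KX K" "y \<in> KX K" for x y
  proof -
    obtain p q p' q' where *: "x = Fract p q" "y = Fract p' q'" "q \<noteq> 0" "q' \<noteq> 0"
      "p \<in> polys_in K" "q \<in> polys_in K" "p' \<in> polys_in K" "q' \<in> polys_in K"
      using xy unfolding KX_iff by blast
    have "x + y = Fract (p * q' + p' * q) (q * q')" "x - y = Fract (p * q' - p' * q) (q * q')"
      "x * y = Fract (p * p') (q * q')" using * by simp_all
    moreover have "q * q' \<noteq> 0" "q * q' \<in> polys_in K" "p * q' + p' * q \<in> polys_in K"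
      "p * q' - p' * q \<in> polys_in K" "p * p' \<in> polys_in K"
      using * by (auto intro: subring_add[OF S] subring_diff[OF S] subring_mult[OF S])
    ultimately show ?thesis unfolding KX_iff by blast
  qed
  moreover have "inverse x \<in> KX K" if x: "x \<in> KX K" "x \<noteq> 0" for x
  proof -
    obtain p q where "x = Fract p q" "q \<noteq> 0" "p \<in> polys_in K" "q \<in> polys_in K"
      using x unfolding KX_iff by blast
    moreover from this have "p \<noteq> 0" using x(2) by (auto simp: fract_collapse)
    ultimately show ?thesis unfolding KX_iff by auto
  qed
  moreover have "0 \<in> KX K"
    unfolding KX_iff Zero_fract_def by (intro exI[of _ 0] exI[of _ 1]) simp
  moreover have "1 \<in> KX K"
    unfolding KX_iff One_fract_def by (intro exI[of _ 1]) simp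
  ultimately show ?thesis by (auto simp: subfield_of_def)
qed

lemma const_fr_KX: "subfield_of K \<Longrightarrow> const_fr c \<in> KX K \<longleftrightarrow> c \<in> K"
proof
  assume K: "subfield_of K"
  note S = subfield_subring[OF K]
  show "const_fr c \<in> KX K" if "c \<in> K"
    unfolding KX_iff const_fr_def using that S
    by (intro exI[of _ "[:c:]"] exI[of _ 1]) (auto simp: one_pCons polys_in_0 subring_0 subring_1)
  assume "const_fr c \<in> KX K"
  then obtain p q where pq: "q \<noteq> 0" "p \<in> polys_in K" "q \<in> polys_in K" "smult c q = p"
    by (auto simp: KX_iff const_fr_def eq_fract)
  then have "c * lead_coeff q \<in> K" "lead_coeff q \<in> K" by (auto simp: polys_in_def)
  from subfield_divide[OF K this] pq(1) show "c \<in> K" by simp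
qed

lemma map_fract_KX: "\<sigma> \<in> Gal K \<Longrightarrow> f \<in> KX K \<Longrightarrow> map_fract \<sigma> f = f"
  by (auto simp: KX_iff map_fract_Fract Gal_hom map_poly_Gal_const)

text \<open>Closedness is the assumption with content. On constants a limit \<open>f\<close> is
  given by some \<sigma>, itself a limit of Galois elements and so one of them. For a given
  fraction, \<open>f\<close> agrees with one \<open>map_fract \<tau>\<close> both there and on its
  coefficients, where \<tau> equals \<sigma>.\<close>

lemma profinite_action_map_fract:
  fixes K :: "'k::field set"
  assumes K: "subfield_of K" and alg: "algebraic_over K"
  shows "profinite_action (map_fract ` Gal K)"
proof
  interpret Gal: profinite_action "Gal K" by (rule profinite_action_Gal[OF K alg])
  show "field_hom g" if "g \<in> map_fract ` Gal K" for g using that Gal_hom field_hom_map_fract by blast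
  show "(\<lambda>x. x) \<in> map_fract ` Gal K"
  proof (rule image_eqI[OF _ Gal_id])
    show "(\<lambda>x. x) = map_fract (\<lambda>x::'k. x)" by (rule ext) (simp add: map_fract_id)
  qed
  show "g \<circ> h \<in> map_fract ` Gal K" if gh: "g \<in> map_fract ` Gal K" "h \<in> map_fract ` Gal K" for g h
  proof -
    obtain \<sigma> \<tau> where st: "\<sigma> \<in> Gal K" "\<tau> \<in> Gal K" "g = map_fract \<sigma>" "h = map_fract \<tau>" using gh by blast
    then have "g \<circ> h = map_fract (\<sigma> \<circ> \<tau>)" by (auto simp: map_fract_comp Gal_hom)
    then show ?thesis using Gal_comp st by blast
  qed
  show "\<exists>h\<in>map_fract ` Gal K. \<forall>x. h (g x) = x \<and> g (h x) = x" if g: "g \<in> map_fract ` Gal K" for g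
  proof -
    obtain \<sigma> where \<sigma>: "\<sigma> \<in> Gal K" "g = map_fract \<sigma>" using g by blast
    obtain \<tau> where "\<tau> \<in> Gal K" "\<And>x. map_fract \<tau> (map_fract \<sigma> x) = x" "\<And>x. map_fract \<sigma> (map_fract \<tau> x) = x"
      by (rule map_fract_inverse[OF \<sigma>(1)]) (rule that)
    then show ?thesis using \<sigma>(2) by blast
  qed
  show "finite ((\<lambda>g. g x) ` map_fract ` Gal K)" for x
  proof -
    obtain p q where x: "x = Fract p q" "q \<noteq> 0" by (cases x)
    have "(\<lambda>g. g x) ` map_fract ` Gal K \<subseteq>
        (\<lambda>(p, q). Fract p q) ` ((\<lambda>h. map_poly h p) ` Gal K \<times> (\<lambda>h. map_poly h q) ` Gal K)"
    proof clarify
      fix \<sigma> assume "\<sigma> \<in> Gal K"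
      then have "map_fract \<sigma> x = (\<lambda>(p, q). Fract p q) (map_poly \<sigma> p, map_poly \<sigma> q)"
        using x by (simp add: map_fract_Fract Gal_hom)
      then show "map_fract \<sigma> x \<in> (\<lambda>(p, q). Fract p q) `
          ((\<lambda>h. map_poly h p) ` Gal K \<times> (\<lambda>h. map_poly h q) ` Gal K)"
        using \<open>\<sigma> \<in> Gal K\<close> by (intro image_eqI) auto
    qed
    then show ?thesis
      by (rule finite_subset) (intro finite_imageI finite_cartesian_product Gal.finite_poly_orbit)
  qed
  fix f :: "'k poly fract \<Rightarrow> 'k poly fract"
  assume f: "\<And>S. finite S \<Longrightarrow> \<exists>g\<in>map_fract ` Gal K. \<forall>x\<in>S. f x = g x"
  define \<sigma> where "\<sigma> c = (THE d. f (const_fr c) = const_fr d)" for c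
  have \<sigma>: "\<sigma> c = \<tau> c" if "\<tau> \<in> Gal K" "f (const_fr c) = map_fract \<tau> (const_fr c)" for c \<tau>
    using that unfolding \<sigma>_def by (auto simp: map_fract_const Gal_hom const_fr_hom(6))
  have "\<sigma> \<in> Gal K"
  proof (rule Gal.closed)
    fix S :: "'k set" assume "finite S"
    then obtain \<tau> where "\<tau> \<in> Gal K" "\<forall>x\<in>const_fr ` S. f x = map_fract \<tau> x" using f[of "const_fr ` S"] by auto
    then show "\<exists>g\<in>Gal K. \<forall>x\<in>S. \<sigma> x = g x" using \<sigma> by blast
  qed
  moreover have "f x = map_fract \<sigma> x" for x
  proof -
    obtain p q where x: "x = Fract p q" "q \<noteq> 0" by (cases x)
    \<comment> \<open>0 is included for the coefficients beyond the degree.\<close>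
    define S where "S = insert 0 (set (coeffs p)) \<union> set (coeffs q)"
    have "finite (insert x (const_fr ` S))" by (simp add: S_def)
    then obtain \<tau> where \<tau>: "\<tau> \<in> Gal K" "\<forall>x\<in>insert x (const_fr ` S). f x = map_fract \<tau> x" using f by blast
    have eq: "\<sigma> c = \<tau> c" if "c \<in> S" for c using \<sigma>[OF \<tau>(1)] \<tau>(2) that by auto
    have "coeff p i \<in> S" "coeff q i \<in> S" for i
      using coeff_in_coeffs[of p i] coeff_in_coeffs[of q i] coeff_eq_0[of p i] coeff_eq_0[of q i]
      unfolding S_def by (metis UnI1 UnI2 coeff_0 insertCI not_le)+
    then have "map_poly \<sigma> p = map_poly \<tau> p" "map_poly \<sigma> q = map_poly \<tau> q"
      using eq Gal_hom[OF \<open>\<sigma> \<in> Gal K\<close>] Gal_hom[OF \<tau>(1)] by (auto intro!: poly_eqI simp: coeff_map_hom)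
    then show ?thesis using \<tau> x \<open>\<sigma> \<in> Gal K\<close> by (simp add: map_fract_Fract Gal_hom)
  qed
  ultimately show "f \<in> map_fract ` Gal K" by blast
qed

theorem Gal_conjugates_extensions:
  fixes K :: "'k::field set"
  assumes ac: "alg_closed TYPE('k)" and K: "subfield_of K" and alg: "algebraic_over K"
    and U: "vring U1" "vring U2" "U1 \<inter> K = U2 \<inter> K"
  obtains \<sigma> where "\<sigma> \<in> Gal K" "\<sigma> ` U1 = U2"
proof (rule profinite_action.valuation_rings_conjugate[OF profinite_action_Gal[OF K alg] U])
  fix x assume "\<forall>\<sigma>\<in>Gal K. \<sigma> x = x"
  then show "\<exists>n>0. x ^ n \<in> K"
    using fixed_imp_power_mem[OF ac K alg, of x] unfolding additive_power_def by metis
qed (rule that)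

text \<open>A fixed fraction need not be given by a fixed numerator and denominator. Expanding it by
  the other conjugates of the denominator makes the denominator a norm; then the numerator is fixed
  as well, and powers of both lie in K[X].\<close>

theorem Gal_conjugates_extensions_KX:
  fixes K :: "'k::field set"
  assumes ac: "alg_closed TYPE('k)" and K: "subfield_of K" and alg: "algebraic_over K"
    and W: "vring W1" "vring W2" "W1 \<inter> KX K = W2 \<inter> KX K"
  obtains \<sigma> where "\<sigma> \<in> Gal K" "map_fract \<sigma> ` W1 = W2"
proof (rule profinite_action.valuation_rings_conjugate[OF profinite_action_map_fract[OF K alg] W])
  interpret Gal: profinite_action "Gal K" by (rule profinite_action_Gal[OF K alg])
  fix f assume f: "\<forall>g\<in>map_fract ` Gal K. g f = f"
  obtain p q where pq: "f = Fract p q" "q \<noteq> 0" by (cases f)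
  define Q r where "Q = Gal.poly_norm q" and "r = \<Prod>((\<lambda>h. map_poly h q) ` Gal K - {q})"
  have Q: "Q = q * r" using Gal.poly_norm_factor[OF Gal_id, of q] by (simp add: Q_def r_def)
  have "\<forall>h\<in>Gal K. map_poly h q \<noteq> 0" using pq(2) by (simp add: map_poly_hom_eq_0 Gal_hom)
  then have Q0: "Q \<noteq> 0" unfolding Q_def Gal.poly_norm_def
    using Gal.finite_poly_orbit by (subst prod_zero_iff) auto
  have fQ: "f = Fract (p * r) Q" using pq Q Q0 by (simp add: eq_fract)
  have sQ: "map_poly \<sigma> Q = Q" if "\<sigma> \<in> Gal K" for \<sigma>
    using Gal.poly_norm_fixed[OF that, of q] Gal_hom[OF that] by (intro poly_eqI) (simp add: coeff_map_hom Q_def)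
  have sp: "map_poly \<sigma> (p * r) = p * r" if "\<sigma> \<in> Gal K" for \<sigma>
  proof -
    have "map_fract \<sigma> f = f" using f that by blast
    then have "Fract (map_poly \<sigma> (p * r)) Q = Fract (p * r) Q"
      using that Q0 unfolding fQ by (simp add: map_fract_Fract Gal_hom sQ)
    then show ?thesis using Q0 by (simp add: eq_fract)
  qed
  have fixed: "\<sigma> (coeff Q i) = coeff Q i" "\<sigma> (coeff (p * r) i) = coeff (p * r) i" if "\<sigma> \<in> Gal K" for \<sigma> i
    using sQ[OF that] sp[OF that] coeff_map_hom[OF Gal_hom[OF that]] by metis+
  obtain m where m: "additive_power TYPE('k) m" "Q ^ m \<in> polys_in K"
    using fixed_poly_imp_power_mem[OF ac K alg, of Q] fixed(1) by blast
  obtain n where n: "additive_power TYPE('k) n" "(p * r) ^ n \<in> polys_in K"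
    using fixed_poly_imp_power_mem[OF ac K alg, of "p * r"] fixed(2) by blast
  note S = subring_polys_in[OF subfield_subring[OF K]]
  have "f ^ (m * n) = Fract (((p * r) ^ n) ^ m) ((Q ^ m) ^ n)"
    by (simp only: fQ Fract_power power_mult[symmetric] mult.commute)
  moreover have "((p * r) ^ n) ^ m \<in> polys_in K" "(Q ^ m) ^ n \<in> polys_in K" "(Q ^ m) ^ n \<noteq> 0"
    using subring_power[OF S] m n Q0 by auto
  ultimately have "f ^ (m * n) \<in> KX K" unfolding KX_iff by blast
  then show "\<exists>n>0. f ^ n \<in> KX K" using m(1) n(1)
    by (intro exI[of _ "m * n"]) (auto simp: additive_power_def)
qed (use that in blast)

subsection \<open>Monomial valuations\<close>

lemma gmul_0 [simp]: "gmul 0 g = 0"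
  by (simp add: gmul_def)

lemma gmul_Suc: "gmul (Suc n) g = g + gmul n g"
  by (simp add: gmul_def add.commute)

lemma gmul_strict_mono: "n > 0 \<Longrightarrow> a < b \<Longrightarrow> gmul n a < gmul n b"
  by (induction n rule: nat_induct_non_zero) (auto simp: gmul_Suc intro: add_strict_mono)

lemma gmul_inject: "n > 0 \<Longrightarrow> gmul n a = gmul n b \<longleftrightarrow> a = b"
  using gmul_strict_mono[of n a b] gmul_strict_mono[of n b a] by (metis less_irrefl linorder_neqE)

text \<open>The polynomials of Gauss value 0: their reduction modulo the maximal ideal exists and is
  nonzero. A residue is transcendental over the residue field of \<open>R\<close> when no such
  polynomial takes a value in the maximal ideal.\<close>

definition primitive_over :: "'a::field set \<Rightarrow> 'a poly \<Rightarrow> bool" where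
  "primitive_over R p \<longleftrightarrow> p \<in> polys_in R \<and> p \<notin> polys_in (max_ideal R)"

lemma primitive_nonzero: "vring R \<Longrightarrow> primitive_over R p \<Longrightarrow> p \<noteq> 0"
  using polys_in_0[OF prime_ideal_ofD(2)[OF vring_prime]] by (auto simp: primitive_over_def)

lemma primitive_mult: "vring R \<Longrightarrow> primitive_over R p \<Longrightarrow> primitive_over R q \<Longrightarrow> primitive_over R (p * q)"
  using gauss_lemma[OF valuation_ring_subring vring_prime] subring_mult[OF subring_polys_in[OF valuation_ring_subring]]
  unfolding primitive_over_def by blast

lemma primitive_factorization:
  assumes "vring R" "p \<noteq> 0"
  obtains e q where "e \<noteq> 0" "primitive_over R q" "p = smult e q" "\<exists>k. e = coeff p k"
proof -
  obtain c where c: "c \<noteq> 0" "smult (inverse c) p \<in> polys_in R"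
    "smult (inverse c) p \<notin> polys_in (max_ideal R)" "\<exists>k. c = coeff p k" by (rule primitive_scaling[OF assms])
  show thesis by (rule that[of c "smult (inverse c) p"]) (use c in \<open>auto simp: primitive_over_def\<close>)
qed

lemma primitive_smult_mem:
  assumes R: "vring R" and q: "primitive_over R q" and "smult e q \<in> polys_in R"
  shows "e \<in> R"
proof -
  obtain k where k: "coeff q k \<in> R" "coeff q k \<notin> max_ideal R" using q by (auto simp: primitive_over_def polys_in_def)
  then have "coeff q k \<noteq> 0" "inverse (coeff q k) \<in> R" by (auto simp: max_ideal_iff)
  moreover have "e * coeff q k \<in> R" using polys_inD[OF assms(3), of k] by simp
  ultimately have "e * coeff q k * inverse (coeff q k) \<in> R"
    using subring_mult[OF valuation_ring_subring[OF R]] by blast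
  then show ?thesis using \<open>coeff q k \<noteq> 0\<close> by (simp add: mult.assoc)
qed

lemma primitive_linear_const:
  assumes R: "vring R" and x: "x \<in> R" shows "primitive_over R [:x, 1:]"
  using x subring_0[OF valuation_ring_subring[OF R]] subring_1[OF valuation_ring_subring[OF R]]
    prime_ideal_ofD(3)[OF vring_prime[OF R]]
  by (auto simp: primitive_over_def polys_in_0)

text \<open>In p(x) = 0 a single term of least value could not cancel, so two terms tie, at distinct
  exponents j and k. Hence a positive power of x has the value of a quotient of coefficients: modulo
  the value group of \<open>K\<close>, that of \<open>U\<close> is torsion.\<close>

lemma power_commensurable:
  assumes U: "vring U" and K: "subfield_of K" and p: "p \<noteq> 0" "p \<in> polys_in K" "poly p x = 0" and x: "x \<noteq> 0"
  obtains n b where "n > 0" "b \<in> K" "b \<noteq> 0" "x ^ n / b \<in> U" "b / x ^ n \<in> U"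
proof -
  note M = vring_prime[OF U] note S = valuation_ring_subring[OF U]
  \<comment> \<open>Substituting x X for X moves the root to 1: the coefficients of \<open>q\<close>
    are the terms of p(x) and sum to 0.\<close>
  define q where "q = pcompose p [:0, x:]"
  have cq: "coeff q i = x ^ i * coeff p i" for i unfolding q_def by (rule coeff_pcompose_linear)
  have "q \<noteq> 0" using p(1) x by (auto simp: poly_eq_iff cq)
  then obtain e f where e: "e \<noteq> 0" "primitive_over U f" "q = smult e f" "\<exists>k. e = coeff q k"
    using primitive_factorization[OF U] by blast
  then obtain k where k: "e = coeff q k" by blast
  have cf: "coeff f j = coeff q j / e" for j using e by simp
  have "poly q 1 = 0" using p(3) by (simp add: q_def poly_pcompose)
  then have "poly f 1 = 0" using e(1,3) by simp
  then have s0: "(\<Sum>i\<le>degree f. coeff f i) = 0" by (simp add: poly_altdef)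
  have fk: "coeff f k = 1" using k e(1) by (simp add: cf)
  then have kd: "k \<le> degree f" by (intro le_degree) simp
  have "\<exists>j. j \<noteq> k \<and> coeff f j \<notin> max_ideal U"
  proof (rule ccontr)
    assume "\<not> ?thesis"
    then have "(\<Sum>i\<in>{..degree f} - {k}. coeff f i) \<in> max_ideal U" by (intro prime_ideal_sum[OF M]) auto
    moreover have "0 = 1 + (\<Sum>i\<in>{..degree f} - {k}. coeff f i)"
      using s0 kd fk by (simp add: sum.remove[of _ k])
    then have "1 = - (\<Sum>i\<in>{..degree f} - {k}. coeff f i)" by (simp add: eq_neg_iff_add_eq_0)
    ultimately show False using prime_ideal_uminus[OF S M] prime_ideal_ofD(3)[OF M] by metis
  qed
  then obtain j where j: "j \<noteq> k" "coeff f j \<notin> max_ideal U" by blast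
  have fj: "coeff f j \<in> U" using e(2) by (auto simp: primitive_over_def polys_in_def)
  then have j': "coeff f j \<noteq> 0" "inverse (coeff f j) \<in> U" using j by (auto simp: max_ideal_iff)
  have *: "x ^ j * coeff p j / (x ^ k * coeff p k) \<in> U" "x ^ k * coeff p k / (x ^ j * coeff p j) \<in> U"
    using fj j'(2) by (simp_all add: cf k cq)
  have nz: "coeff p j \<noteq> 0" "coeff p k \<noteq> 0" using j'(1) e(1) k by (auto simp: cf cq)
  have pK: "coeff p i \<in> K" for i using p(2) by (simp add: polys_in_def)
  show thesis
  proof (cases "k < j")
    case True
    then have "x ^ j = x ^ (j - k) * x ^ k" by (simp flip: power_add)
    with * x nz have "x ^ (j - k) / (coeff p k / coeff p j) \<in> U" "(coeff p k / coeff p j) / x ^ (j - k) \<in> U"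
      by (simp_all add: field_simps)
    then show thesis using that[of "j - k" "coeff p k / coeff p j"] True nz subfield_divide[OF K pK pK] by simp
  next
    case False
    then have "x ^ k = x ^ (k - j) * x ^ j" by (simp flip: power_add)
    with * x nz have "x ^ (k - j) / (coeff p j / coeff p k) \<in> U" "(coeff p j / coeff p k) / x ^ (k - j) \<in> U"
      by (simp_all add: field_simps)
    then show thesis using that[of "k - j" "coeff p j / coeff p k"] False j(1) nz subfield_divide[OF K pK pK] by simp
  qed
qed

section \<open>Substitution of rational functions, and constant versus transcendental
  residues\<close>

definition eval_fr :: "'k::field poly \<Rightarrow> 'k poly fract \<Rightarrow> 'k poly fract" where
  "eval_fr p t = poly (map_poly const_fr p) t"

lemma eval_fr_pCons [simp]: "eval_fr (pCons a p) t = const_fr a + t * eval_fr p t"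
  by (simp add: eval_fr_def map_poly_pCons const_fr_hom)

lemma eval_fr_0 [simp]: "eval_fr 0 t = 0"
  by (simp add: eval_fr_def)

lemma eval_fr_add: "eval_fr (p + q) t = eval_fr p t + eval_fr q t"
  by (induction p q rule: poly_induct2) (simp_all add: const_fr_hom algebra_simps)

lemma eval_fr_smult: "eval_fr (smult c p) t = const_fr c * eval_fr p t"
  by (induction p) (simp_all add: const_fr_hom algebra_simps)

lemma eval_fr_mult: "eval_fr (p * q) t = eval_fr p t * eval_fr q t"
  by (induction p) (simp_all add: eval_fr_add eval_fr_smult algebra_simps const_fr_hom)

lemma eval_fr_altdef: "eval_fr p t = (\<Sum>i\<le>degree p. const_fr (coeff p i) * t ^ i)"
proof -
  have "degree (map_poly const_fr p) = degree p"
    by (rule degree_map_poly) (simp add: const_fr_eq_0)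
  then show ?thesis by (simp add: eval_fr_def poly_altdef coeff_map_poly const_fr_hom)
qed

lemma eval_fr_Fract: "eval_fr p (Fract q 1) = Fract (pcompose p q) 1"
  by (induction p) (simp_all add: pcompose_pCons const_fr_def Zero_fract_def)

text \<open>The coordinate Y = (X - \<alpha>) / c, written with denominator 1 so that substituting
  it into a polynomial is a composition of polynomials.\<close>

definition lin_fr :: "'k::field \<Rightarrow> 'k \<Rightarrow> 'k poly fract" where
  "lin_fr \<alpha> c = Fract [:- (\<alpha> / c), inverse c:] 1"

lemma pcompose_linear_inverse:
  assumes "c \<noteq> (0 :: 'k::field)"
  shows "pcompose (pcompose p [:\<alpha>, c:]) [:- (\<alpha> / c), inverse c:] = p"
    "pcompose (pcompose p [:- (\<alpha> / c), inverse c:]) [:\<alpha>, c:] = p"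
  using assms by (simp_all add: pcompose_assoc[symmetric] pcompose_pCons field_simps)

lemma Fract_eq_eval_lin: "c \<noteq> 0 \<Longrightarrow> Fract p 1 = eval_fr (pcompose p [:\<alpha>, c:]) (lin_fr \<alpha> c)"
  by (simp add: lin_fr_def eval_fr_Fract pcompose_linear_inverse)

lemma pcompose_linear_eq_0: "c \<noteq> (0 :: 'k::field) \<Longrightarrow> pcompose p [:\<alpha>, c:] = 0 \<longleftrightarrow> p = 0"
  using pcompose_linear_inverse(1)[of c p \<alpha>] by auto

definition over :: "'k::field set \<Rightarrow> 'k poly fract set \<Rightarrow> bool" where
  "over U W \<longleftrightarrow> vring W \<and> (\<forall>x. const_fr x \<in> W \<longleftrightarrow> x \<in> U)"

lemma over_max_ideal: "over U W \<Longrightarrow> const_fr x \<in> max_ideal W \<longleftrightarrow> x \<in> max_ideal U"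
  by (simp add: over_def max_ideal_iff const_fr_eq_0 flip: const_fr_inverse)

lemma over_eval:
  assumes W: "over U W" and t: "t \<in> W" and p: "p \<in> polys_in U" shows "eval_fr p t \<in> W"
proof -
  have S: "subring W" using W valuation_ring_subring by (auto simp: over_def)
  show ?thesis using p W by (induction p)
    (auto simp: over_def intro: subring_0[OF S] subring_add[OF S] subring_mult[OF S t])
qed

text \<open>A linear factor of a primitive polynomial either has its root in the valuation ring or is a unit
  at every integral element.\<close>

lemma residue_algebraic_imp_const:
  fixes U :: "'k::field set"
  assumes ac: "alg_closed TYPE('k)" and U: "vring U" and W: "over U W" and t: "t \<in> W"
    and "primitive_over U p" "eval_fr p t \<in> max_ideal W"
  shows "\<exists>d\<in>U. t - const_fr d \<in> max_ideal W"
  using assms(5,6)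
proof (induction "degree p" arbitrary: p rule: less_induct)
  case less
  have vW: "vring W" using W by (simp add: over_def)
  note SU = valuation_ring_subring[OF U] note MU = vring_prime[OF U]
  note SW = valuation_ring_subring[OF vW] note MW = vring_prime[OF vW]
  show ?case
  proof (cases "degree p = 0")
    case True
    then obtain a where "p = [:a:]" by (metis degree_eq_zeroE)
    then have "a \<notin> max_ideal U" "const_fr a \<in> max_ideal W"
      using less(2,3) prime_ideal_ofD(2)[OF MU] by (auto simp: primitive_over_def polys_in_0)
    then show ?thesis using over_max_ideal[OF W] by blast
  next
    case False
    then obtain a where "poly p a = 0" using ac by (auto simp: alg_closed_def)
    then obtain r where r: "p = [:- a, 1:] * r" by (auto simp: poly_eq_0_iff_dvd elim: dvdE)
    have p0: "p \<noteq> 0" using False by auto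
    \<comment> \<open>\<open>f\<close> is the linear factor made primitive: X - a itself for
      \<open>a\<close> in \<open>U\<close>, otherwise X / a - 1, which reduces to the constant
      -1.\<close>
    define s f where "s = (if a \<in> U then 1 else a)" and "f = smult (inverse s) [:- a, 1:]"
    have a0: "a \<notin> U \<Longrightarrow> a \<noteq> 0 \<and> inverse a \<in> max_ideal U" using vring_not_in[OF U] by blast
    have s0: "s \<noteq> 0" using a0 by (auto simp: s_def)
    have f: "primitive_over U f"
    proof (cases "a \<in> U")
      case True
      then show ?thesis using primitive_linear_const[OF U subring_uminus[OF SU]] by (simp add: f_def s_def)
    next
      case False
      have "- 1 \<in> U" using subring_uminus[OF SU subring_1[OF SU]] .
      moreover have "- 1 \<notin> max_ideal U"
        using prime_ideal_uminus[OF SU MU, of "- 1"] prime_ideal_ofD(3)[OF MU] by auto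
      ultimately show ?thesis
        using a0[OF False] False subring_0[OF SU] by (auto simp: f_def s_def primitive_over_def polys_in_0 max_ideal_iff)
    qed
    have "r \<noteq> 0" using p0 r by auto
    then obtain e q where q: "e \<noteq> 0" "primitive_over U q" "r = smult e q"
      using primitive_factorization[OF U] by blast
    have "s * e * inverse s = e" using s0 by simp
    then have pfq: "p = smult (s * e) (f * q)"
      unfolding r q(3) f_def mult_smult_left mult_smult_right smult_smult by (simp only:)
    have se: "s * e \<notin> max_ideal U"
    proof
      assume "s * e \<in> max_ideal U"
      moreover have "f * q \<in> polys_in U" using primitive_mult[OF U f q(2)] by (simp add: primitive_over_def)
      ultimately have "p \<in> polys_in (max_ideal U)"
        unfolding pfq polys_in_def by (auto intro: prime_ideal_ofD(6)[OF MU])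
      then show False using less(2) by (simp add: primitive_over_def)
    qed
    then have ise: "inverse (s * e) \<in> U"
      using vring_not_in[OF U, of "s * e"] by (auto simp: max_ideal_iff)
    have "eval_fr f t * eval_fr q t = const_fr (inverse (s * e)) * eval_fr p t"
    proof -
      have "const_fr (inverse (s * e)) * const_fr (s * e) = 1"
        unfolding const_fr_hom(2)[symmetric] using s0 q(1)
        by (subst left_inverse) (simp_all add: const_fr_hom(5))
      then show ?thesis by (simp add: pfq eval_fr_smult eval_fr_mult mult.assoc[symmetric])
    qed
    moreover have "\<dots> \<in> max_ideal W"
      using ise W less(3) by (intro prime_ideal_ofD(5)[OF MW]) (auto simp: over_def)
    moreover have "eval_fr f t \<in> W" "eval_fr q t \<in> W"
      using over_eval[OF W t] f q(2) by (auto simp: primitive_over_def)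
    ultimately consider "eval_fr f t \<in> max_ideal W" | "eval_fr q t \<in> max_ideal W"
      using prime_ideal_ofD(7)[OF MW] by metis
    then show ?thesis
    proof cases
      case 1
      show ?thesis
      proof (cases "a \<in> U")
        case True
        then show ?thesis using 1 const_fr_hom(3)[of 0 a]
          by (intro bexI[of _ a]) (auto simp: f_def s_def const_fr_hom)
      next
        case False
        have "const_fr (inverse a) \<in> max_ideal W" using a0[OF False] over_max_ideal[OF W] by blast
        then have "t * const_fr (inverse a) \<in> max_ideal W" using prime_ideal_ofD(5)[OF MW t] by blast
        moreover have "eval_fr f t = t * const_fr (inverse a) - 1"
          using False a0[OF False] const_fr_hom(3)[of 0 1] by (simp add: f_def s_def const_fr_hom)
        ultimately have "1 \<in> max_ideal W"
          using prime_ideal_diff[OF SW MW _ 1] by fastforce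
        then show ?thesis using prime_ideal_ofD(3)[OF MW] by blast
      qed
    next
      case 2
      have "degree p = Suc (degree r)" using \<open>r \<noteq> 0\<close> unfolding r by (subst degree_mult_eq) auto
      then have "degree q < degree p" using q by simp
      then show ?thesis using less(1) q(2) 2 by blast
    qed
  qed
qed

text \<open>The constant \<open>d\<close> is algebraic over \<open>K\<close>. Its equation, divided
  by one of its own coefficients, stays over \<open>K\<close> and becomes primitive; at
  \<open>t\<close> it takes a value congruent to its value 0 at \<open>d\<close>. In other words,
  the residue field of \<open>U\<close> is algebraic over that of U \<inter> K.\<close>

lemma residue_const_imp_algebraic:
  fixes U :: "'k::field set"
  assumes U: "vring U" and K: "subfield_of K" and alg: "algebraic_over K"
    and W: "over U W" and t: "t \<in> W" and d: "d \<in> U" "t - const_fr d \<in> max_ideal W"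
  obtains p where "p \<in> polys_in (U \<inter> K)" "p \<notin> polys_in (max_ideal (U \<inter> K))" "eval_fr p t \<in> max_ideal W"
proof -
  have vW: "vring W" using W by (simp add: over_def)
  note SU = valuation_ring_subring[OF U] note MW = vring_prime[OF vW]
  obtain g where g: "g \<noteq> 0" "g \<in> polys_in K" "poly g d = 0" using algebraic_overD[OF alg] by blast
  obtain e q where q: "e \<noteq> 0" "primitive_over U q" "g = smult e q" "\<exists>k. e = coeff g k"
    using primitive_factorization[OF U g(1)] by blast
  have "e \<in> K" using q(4) g(2) by (auto simp: polys_in_def)
  moreover have "q = smult (inverse e) g" using q(1,3) by simp
  ultimately have qK: "q \<in> polys_in K"
    using g(2) polys_in_smult[OF subfield_subring[OF K]] subfield_inverse[OF K] by metis
  have red: "eval_fr p t - const_fr (poly p d) \<in> max_ideal W" if "p \<in> polys_in U" for p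
    using that
  proof (induction p)
    case 0
    then show ?case using prime_ideal_ofD(2)[OF MW] by (simp add: const_fr_hom)
  next
    case (pCons a p)
    have "eval_fr (pCons a p) t - const_fr (poly (pCons a p) d) =
        t * (eval_fr p t - const_fr (poly p d)) + const_fr (poly p d) * (t - const_fr d)"
      by (simp add: const_fr_hom algebra_simps)
    moreover have "const_fr (poly p d) \<in> W"
      using pCons(3) subring_poly[OF SU _ d(1)] W by (auto simp: over_def)
    ultimately show ?case
      using pCons d(2) t prime_ideal_ofD(4,5)[OF MW] by auto
  qed
  have "poly q d = 0" using g(3) q(1,3) by simp
  then have "eval_fr q t \<in> max_ideal W" using red[of q] q(2) by (simp add: primitive_over_def const_fr_hom)
  moreover have "q \<in> polys_in (U \<inter> K)" "q \<notin> polys_in (max_ideal (U \<inter> K))"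
    using q(2) qK unfolding max_ideal_Int_subfield[OF K] by (auto simp: primitive_over_def polys_in_def)
  ultimately show thesis using that by blast
qed

section \<open>Monomial valuations as Gauss valuations\<close>

context
  fixes u :: "'k::field \<Rightarrow> 'g::linordered_ab_group_add" and U
  assumes val: "is_valuation_of u U"
begin

lemma val_mult: "x \<noteq> 0 \<Longrightarrow> y \<noteq> 0 \<Longrightarrow> u (x * y) = u x + u y"
  using val by (simp add: is_valuation_of_def)

lemma val_1: "u 1 = 0"
  using val_mult[of 1 1] by simp

lemma val_inverse: "x \<noteq> 0 \<Longrightarrow> u (inverse x) = - u x"
  using val_mult[of x "inverse x"] val_1 by (simp add: eq_neg_iff_add_eq_0 add.commute)

lemma val_power: "x \<noteq> 0 \<Longrightarrow> u (x ^ n) = gmul n (u x)"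
  by (induction n) (simp_all add: val_1 val_mult gmul_Suc)

lemma val_minus_1: "u (- 1) = 0"
proof -
  have "gmul 2 (u (- 1)) = gmul 2 0" using val_power[of "- 1" 2] val_1 by (simp add: gmul_def)
  then show ?thesis by (subst (asm) gmul_inject) auto
qed

lemma val_uminus: "x \<noteq> 0 \<Longrightarrow> u (- x) = u x"
  using val_mult[of "- 1" x] val_minus_1 by simp

lemma val_ring_iff: "x \<in> U \<longleftrightarrow> x = 0 \<or> 0 \<le> u x"
  using val by (auto simp: is_valuation_of_def)

lemma vring_U: "vring U"
proof -
  have add: "x + y \<in> U" if "x \<in> U" "y \<in> U" for x y
  proof (cases "x = 0 \<or> y = 0 \<or> x + y = 0")
    case False
    then have "min (u x) (u y) \<le> u (x + y)" using val by (simp add: is_valuation_of_def)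
    then show ?thesis using that False by (auto simp: val_ring_iff min_def split: if_splits)
  qed (use that in \<open>auto simp: val_ring_iff\<close>)
  moreover have "- x \<in> U" if "x \<in> U" for x using that val_uminus[of x] by (cases "x = 0") (auto simp: val_ring_iff)
  ultimately have diff: "x - y \<in> U" if "x \<in> U" "y \<in> U" for x y using that add[of x "- y"] by simp
  have mult: "x * y \<in> U" if "x \<in> U" "y \<in> U" for x y
    using that by (cases "x = 0 \<or> y = 0") (auto simp: val_ring_iff val_mult)
  have "x \<in> U \<or> inverse x \<in> U" if "x \<noteq> 0" for x using that by (auto simp: val_ring_iff val_inverse)
  moreover have "0 \<in> U" "1 \<in> U" by (simp_all add: val_ring_iff val_1)
  ultimately show ?thesis using add mult diff by (auto simp: valuation_ring_of_def)
qed

lemma val_le_iff: "x \<noteq> 0 \<Longrightarrow> y \<noteq> 0 \<Longrightarrow> u y \<le> u x \<longleftrightarrow> x / y \<in> U"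
  by (simp add: val_ring_iff divide_inverse val_mult val_inverse)

lemma val_max_ideal_iff: "x \<in> max_ideal U \<longleftrightarrow> x = 0 \<or> 0 < u x"
  by (auto simp: max_ideal_iff val_ring_iff val_inverse)

text \<open>Substituting \<alpha> + c X instead of \<alpha> + X absorbs the weights
  \<open>gmul i (u c)\<close> into the coefficients, so the monomial value becomes a Gauss value.
  Nonzero coefficients of e q have value at least \<open>u e\<close>, with equality at a unit
  coefficient of \<open>q\<close>.\<close>

lemma mon_val_eq:
  assumes c: "c \<noteq> 0" and e: "e \<noteq> 0" and q: "primitive_over U q" and p: "pcompose p [:\<alpha>, c:] = smult e q"
  shows "mon_val u \<alpha> (u c) p = u e"
proof -
  define f where "f = pcompose p [:\<alpha>, 1:]"
  have "pcompose p [:\<alpha>, c:] = pcompose f [:0, c:]"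
    by (simp add: f_def pcompose_assoc[symmetric] pcompose_pCons)
  then have "coeff (smult e q) i = coeff (pcompose f [:0, c:]) i" for i using p by simp
  then have cq: "e * coeff q i = c ^ i * coeff f i" for i
    by (simp add: coeff_pcompose_linear)
  then have nz: "coeff f i \<noteq> 0 \<longleftrightarrow> coeff q i \<noteq> 0" for i using c e by (metis mult_eq_0_iff power_not_zero)
  have v: "u (coeff f i) + gmul i (u c) = u e + u (coeff q i)" if "coeff f i \<noteq> 0" for i
    using val_mult[of e "coeff q i"] val_mult[of "c ^ i" "coeff f i"] that nz cq[of i] c e val_power
    by (simp add: add.commute)
  have qU: "coeff q i \<in> U" for i using q by (simp add: primitive_over_def polys_in_def)
  obtain k where "coeff q k \<notin> max_ideal U" using q by (auto simp: primitive_over_def polys_in_def)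
  then have k: "coeff q k \<noteq> 0" "u (coeff q k) = 0"
    using qU[of k] by (auto simp: val_max_ideal_iff val_ring_iff)
  have "Min {u (coeff f i) + gmul i (u c) | i. coeff f i \<noteq> 0} = u e"
  proof (rule Min_eqI)
    have "finite {i. coeff f i \<noteq> 0}"
      by (rule finite_subset[of _ "{..degree f}"]) (auto intro: le_degree)
    then show "finite {u (coeff f i) + gmul i (u c) | i. coeff f i \<noteq> 0}" by simp
    show "u e \<in> {u (coeff f i) + gmul i (u c) | i. coeff f i \<noteq> 0}"
      using k nz v[of k] by force
    fix y assume "y \<in> {u (coeff f i) + gmul i (u c) | i. coeff f i \<noteq> 0}"
    then obtain i where "y = u e + u (coeff q i)" "coeff q i \<noteq> 0" using v nz by force
    then show "u e \<le> y" using qU[of i] by (simp add: val_ring_iff)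
  qed
  then show ?thesis by (simp add: mon_val_def f_def)
qed

lemma mon_val_factorization:
  assumes "c \<noteq> 0" "p \<noteq> 0"
  obtains e q where "e \<noteq> 0" "primitive_over U q" "pcompose p [:\<alpha>, c:] = smult e q"
    "mon_val u \<alpha> (u c) p = u e"
proof -
  obtain e q where "e \<noteq> 0" "primitive_over U q" "pcompose p [:\<alpha>, c:] = smult e q"
    using primitive_factorization[OF vring_U, of "pcompose p [:\<alpha>, c:]"] pcompose_linear_eq_0[OF assms(1)] assms(2)
    by metis
  then show thesis using that mon_val_eq[OF assms(1)] by blast
qed

text \<open>Multiplicativity is Gauss' lemma: products of primitive polynomials are
  primitive.\<close>

lemma mon_val_mult:
  assumes c: "c \<noteq> 0" and p: "p \<noteq> 0" and q: "q \<noteq> 0"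
  shows "mon_val u \<alpha> (u c) (p * q) = mon_val u \<alpha> (u c) p + mon_val u \<alpha> (u c) q"
proof -
  obtain e f where e: "e \<noteq> 0" "primitive_over U f" "pcompose p [:\<alpha>, c:] = smult e f"
    "mon_val u \<alpha> (u c) p = u e" using mon_val_factorization[OF c p] by blast
  obtain e' f' where e': "e' \<noteq> 0" "primitive_over U f'" "pcompose q [:\<alpha>, c:] = smult e' f'"
    "mon_val u \<alpha> (u c) q = u e'" using mon_val_factorization[OF c q] by blast
  have "pcompose (p * q) [:\<alpha>, c:] = smult (e * e') (f * f')" using e e' by (simp add: pcompose_mult mult.commute)
  from mon_val_eq[OF c _ primitive_mult[OF vring_U e(2) e'(2)] this] show ?thesis
    using e e' by (simp add: val_mult)
qed

text \<open>After division by the content \<open>e'\<close> of the polynomial of smaller value, the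
  sum has coefficients in \<open>U\<close>; a multiple of a primitive polynomial can do so only if
  the scalar lies in \<open>U\<close>.\<close>

lemma mon_val_add_le:
  assumes c: "c \<noteq> 0" and p: "p \<noteq> 0" and q: "q \<noteq> 0" and pq: "p + q \<noteq> 0"
    and le: "mon_val u \<alpha> (u c) q \<le> mon_val u \<alpha> (u c) p"
  shows "mon_val u \<alpha> (u c) q \<le> mon_val u \<alpha> (u c) (p + q)"
proof -
  note S = valuation_ring_subring[OF vring_U]
  obtain e f where e: "e \<noteq> 0" "primitive_over U f" "pcompose p [:\<alpha>, c:] = smult e f"
    "mon_val u \<alpha> (u c) p = u e" using mon_val_factorization[OF c p] by blast
  obtain e' f' where e': "e' \<noteq> 0" "primitive_over U f'" "pcompose q [:\<alpha>, c:] = smult e' f'"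
    "mon_val u \<alpha> (u c) q = u e'" using mon_val_factorization[OF c q] by blast
  obtain d g where d: "d \<noteq> 0" "primitive_over U g" "pcompose (p + q) [:\<alpha>, c:] = smult d g"
    "mon_val u \<alpha> (u c) (p + q) = u d" using mon_val_factorization[OF c pq] by blast
  have "e / e' \<in> U" using le e e' val_le_iff by simp
  then have "smult (e / e') f + f' \<in> polys_in U"
    using e(2) e'(2) by (intro subring_add[OF subring_polys_in[OF S]] polys_in_smult[OF S])
      (auto simp: primitive_over_def)
  moreover have "smult (d / e') g = smult (inverse e') (smult d g)" by (simp add: field_simps)
  then have "smult (d / e') g = smult (e / e') f + f'"
    using e e' d(3)[symmetric] by (simp add: pcompose_add smult_add_right field_simps)
  ultimately have "d / e' \<in> U" using primitive_smult_mem[OF vring_U d(2)] by simp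
  then show ?thesis using d e' val_le_iff by simp
qed

lemma U_ad_iff:
  assumes c: "c \<noteq> 0" and q: "q \<noteq> 0"
  shows "Fract p q \<in> U_ad u \<alpha> (u c) \<longleftrightarrow> p = 0 \<or> mon_val u \<alpha> (u c) q \<le> mon_val u \<alpha> (u c) p"
proof
  let ?v = "mon_val u \<alpha> (u c)"
  assume "Fract p q \<in> U_ad u \<alpha> (u c)"
  then obtain p' q' where *: "q' \<noteq> 0" "Fract p q = Fract p' q'" "p' = 0 \<or> ?v q' \<le> ?v p'"
    by (auto simp: U_ad_def)
  then have eq: "p * q' = p' * q" using q by (simp add: eq_fract)
  show "p = 0 \<or> ?v q \<le> ?v p"
  proof (cases "p = 0")
    case False
    then have "p' \<noteq> 0" using eq * by auto
    then have "?v p + ?v q' = ?v p' + ?v q" "?v q' \<le> ?v p'"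
      using mon_val_mult[OF c False *(1)] mon_val_mult[OF c _ q] eq * by auto
    then have "?v q + ?v q' \<le> ?v p + ?v q'" by (simp add: add.commute add_right_mono)
    then show ?thesis by simp
  qed simp
qed (use q in \<open>auto simp: U_ad_def\<close>)

lemma vring_U_ad:
  assumes c: "c \<noteq> 0" shows "vring (U_ad u \<alpha> (u c))"
proof -
  let ?v = "mon_val u \<alpha> (u c)" and ?W = "U_ad u \<alpha> (u c)"
  note iff = U_ad_iff[OF c, of _ _ \<alpha>]
  have v1: "?v 1 = 0" using mon_val_mult[OF c, of 1 1] by simp
  have vm1: "?v (- p) = ?v p" if "p \<noteq> 0" for p
  proof -
    have "gmul 2 (?v (- 1)) = gmul 2 0" using mon_val_mult[OF c, of "- 1" "- 1"] v1
      by (simp add: gmul_def numeral_2_eq_2)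
    then have "?v (- 1) = 0" by (subst (asm) gmul_inject) auto
    then show ?thesis using mon_val_mult[OF c, of "- 1" p] that by simp
  qed
  have mult: "x * y \<in> ?W" if xy: "x \<in> ?W" "y \<in> ?W" for x y
  proof -
    obtain p q where x: "x = Fract p q" "q \<noteq> 0" by (cases x)
    obtain p' q' where y: "y = Fract p' q'" "q' \<noteq> 0" by (cases y)
    have "p = 0 \<or> ?v q \<le> ?v p" "p' = 0 \<or> ?v q' \<le> ?v p'" using xy x y by (simp_all add: iff)
    then show ?thesis using x y
      by (cases "p = 0 \<or> p' = 0") (auto simp: iff mon_val_mult[OF c] add_mono)
  qed
  have add: "x + y \<in> ?W" if xy: "x \<in> ?W" "y \<in> ?W" for x y
  proof -
    obtain p q where x: "x = Fract p q" "q \<noteq> 0" by (cases x)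
    obtain p' q' where y: "y = Fract p' q'" "q' \<noteq> 0" by (cases y)
    have xy': "p = 0 \<or> ?v q \<le> ?v p" "p' = 0 \<or> ?v q' \<le> ?v p'" using xy x y by (simp_all add: iff)
    show ?thesis
    proof (cases "p = 0 \<or> p' = 0 \<or> p * q' + p' * q = 0")
      case True
      then have "x = 0 \<or> y = 0 \<or> x + y = 0" using x y by (auto simp: Zero_fract_def eq_fract)
      moreover have "0 \<in> ?W" unfolding Zero_fract_def by (simp add: iff)
      ultimately show ?thesis using xy by auto
    next
      case False
      have "?v (q * q') \<le> ?v (p * q')" "?v (q * q') \<le> ?v (p' * q)"
        using xy' False x(2) y(2) by (auto simp: mon_val_mult[OF c] add_mono add.commute)
      moreover have "?v (p * q') \<le> ?v (p * q' + p' * q) \<or> ?v (p' * q) \<le> ?v (p * q' + p' * q)"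
        using mon_val_add_le[OF c, of "p * q'" "p' * q" \<alpha>] mon_val_add_le[OF c, of "p' * q" "p * q'" \<alpha>]
          False x(2) y(2) linear[of "?v (p * q')" "?v (p' * q)"] by (auto simp: add.commute)
      ultimately show ?thesis using x y False by (auto simp: iff)
    qed
  qed
  have um: "- x \<in> ?W" if x: "x \<in> ?W" for x
  proof -
    obtain p q where "x = Fract p q" "q \<noteq> 0" by (cases x)
    then show ?thesis using x vm1[of p] by (cases "p = 0") (auto simp: iff)
  qed
  have "x - y \<in> ?W" if "x \<in> ?W" "y \<in> ?W" for x y using add[OF that(1) um[OF that(2)]] by simp
  moreover have "x \<in> ?W \<or> inverse x \<in> ?W" if x: "x \<noteq> 0" for x
  proof -
    obtain p q where pq: "x = Fract p q" "q \<noteq> 0" by (cases x)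
    then have "p \<noteq> 0" using x by (auto simp: fract_collapse)
    then show ?thesis using pq by (auto simp: iff)
  qed
  moreover have "0 \<in> ?W" "1 \<in> ?W" unfolding Zero_fract_def One_fract_def by (simp_all add: iff)
  ultimately show ?thesis using add mult by (auto simp: valuation_ring_of_def)
qed

lemma over_U_ad:
  assumes c: "c \<noteq> 0" shows "over U (U_ad u \<alpha> (u c))"
proof -
  have "primitive_over U 1" using valuation_ring_subring[OF vring_U] prime_ideal_ofD(3)[OF vring_prime[OF vring_U]]
    by (auto simp: primitive_over_def one_pCons polys_in_0 subring_0 subring_1)
  then have v: "mon_val u \<alpha> (u c) [:x:] = u x" if "x \<noteq> 0" for x
    using mon_val_eq[OF c that, of 1 "[:x:]" \<alpha>] by simp
  have "const_fr x \<in> U_ad u \<alpha> (u c) \<longleftrightarrow> x \<in> U" for x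
    using v[of 1] v[of x] val_1
    by (cases "x = 0") (auto simp: const_fr_def U_ad_iff[OF c] val_ring_iff one_pCons)
  then show ?thesis using vring_U_ad[OF c] by (simp add: over_def)
qed

text \<open>A primitive polynomial in Y has monomial value 0, hence is a unit: the residue of Y is
  transcendental over the residue field of \<open>U\<close>.\<close>

lemma lin_fr_U_ad:
  assumes c: "c \<noteq> 0"
  shows "lin_fr \<alpha> c \<in> U_ad u \<alpha> (u c)"
    and "primitive_over U p \<Longrightarrow> eval_fr p (lin_fr \<alpha> c) \<notin> max_ideal (U_ad u \<alpha> (u c))"
proof -
  let ?v = "mon_val u \<alpha> (u c)"
  have v: "?v (pcompose q [:- (\<alpha> / c), inverse c:]) = 0" if "primitive_over U q" for q
    using mon_val_eq[OF c _ that, of 1 "pcompose q [:- (\<alpha> / c), inverse c:]" \<alpha>] c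
    by (simp add: pcompose_linear_inverse val_1)
  have v1: "?v 1 = 0" using mon_val_mult[OF c, of 1 1] by simp
  have "primitive_over U [:0, 1:]"
    using primitive_linear_const[OF vring_U] valuation_ring_subring[OF vring_U] subring_0 by blast
  from v[OF this] show "lin_fr \<alpha> c \<in> U_ad u \<alpha> (u c)"
    unfolding lin_fr_def using c by (simp add: U_ad_iff[OF c] v1 pcompose_pCons)
  assume p: "primitive_over U p"
  then have "pcompose p [:- (\<alpha> / c), inverse c:] \<noteq> 0"
    using pcompose_linear_inverse(2)[OF c, of p \<alpha>] primitive_nonzero[OF vring_U p] by auto
  then show "eval_fr p (lin_fr \<alpha> c) \<notin> max_ideal (U_ad u \<alpha> (u c))"
    using v[OF p] v1 by (simp add: lin_fr_def eval_fr_Fract max_ideal_iff U_ad_iff[OF c] Zero_fract_def eq_fract)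
qed

text \<open>Each nonzero polynomial is a constant times a primitive polynomial in Y, and the latter
  is a unit of \<open>W\<close>. So membership of a fraction is decided by constants, which are
  governed by \<open>U\<close>.\<close>

lemma eq_U_ad:
  assumes c: "c \<noteq> 0" and W: "over U W" and Y: "lin_fr \<alpha> c \<in> W"
    and tr: "\<And>p. primitive_over U p \<Longrightarrow> eval_fr p (lin_fr \<alpha> c) \<notin> max_ideal W"
  shows "W = U_ad u \<alpha> (u c)"
proof -
  have vW: "vring W" using W by (simp add: over_def)
  note S = valuation_ring_subring[OF vW]
  have unit: "\<exists>e z. e \<noteq> 0 \<and> z \<in> W \<and> inverse z \<in> W \<and> z \<noteq> 0 \<and> Fract p 1 = const_fr e * z \<and> mon_val u \<alpha> (u c) p = u e"
    if p: "p \<noteq> 0" for p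
  proof -
    obtain e q where e: "e \<noteq> 0" "primitive_over U q" "pcompose p [:\<alpha>, c:] = smult e q"
      "mon_val u \<alpha> (u c) p = u e" using mon_val_factorization[OF c p] by blast
    define z where "z = eval_fr q (lin_fr \<alpha> c)"
    have "z \<in> W" using over_eval[OF W Y] e(2) by (simp add: z_def primitive_over_def)
    then have "z \<in> W" "inverse z \<in> W" "z \<noteq> 0" using tr[OF e(2)] by (auto simp: z_def max_ideal_iff)
    moreover have "Fract p 1 = const_fr e * z"
      using Fract_eq_eval_lin[OF c, of p \<alpha>] e(3) by (simp add: z_def eval_fr_smult)
    ultimately show ?thesis using e(1,4) by blast
  qed
  have "Fract p q \<in> W \<longleftrightarrow> mon_val u \<alpha> (u c) q \<le> mon_val u \<alpha> (u c) p" if pq: "p \<noteq> 0" "q \<noteq> 0" for p q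
  proof -
    obtain e z where e: "e \<noteq> 0" "z \<in> W" "inverse z \<in> W" "z \<noteq> 0" "Fract p 1 = const_fr e * z"
      "mon_val u \<alpha> (u c) p = u e" using unit[OF pq(1)] by blast
    obtain e' z' where e': "e' \<noteq> 0" "z' \<in> W" "inverse z' \<in> W" "z' \<noteq> 0" "Fract q 1 = const_fr e' * z'"
      "mon_val u \<alpha> (u c) q = u e'" using unit[OF pq(2)] by blast
    have "Fract p q = Fract p 1 / Fract q 1" by simp
    then have *: "Fract p q = const_fr (e / e') * (z * inverse z')" using e e' by (simp add: const_fr_divide field_simps)
    have "z * inverse z' * (inverse z * z') = 1" using e(4) e'(4) by (simp add: field_simps)
    then have "const_fr (e / e') = Fract p q * (inverse z * z')" by (simp add: * mult.assoc)
    then have "Fract p q \<in> W \<longleftrightarrow> const_fr (e / e') \<in> W"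
      using * e e' subring_mult[OF S] by metis
    then show ?thesis using W e e' val_le_iff by (simp add: over_def)
  qed
  then have "f \<in> W \<longleftrightarrow> f \<in> U_ad u \<alpha> (u c)" for f
    using subring_0[OF S] by (cases f) (metis U_ad_iff[OF c] fract_collapse(1))
  then show ?thesis by blast
qed

end

subsection \<open>Residually transcendental extensions are monomial\<close>

lemma alg_closed_root:
  fixes e :: "'k::field"
  assumes ac: "alg_closed TYPE('k)" and "n > 0"
  shows "\<exists>c. c ^ n = e"
proof -
  have "coeff (monom 1 n - [:e:]) n = 1" using assms(2) by (auto simp: coeff_pCons split: nat.splits)
  then have "degree (monom 1 n - [:e:]) > 0"
    using le_degree[of "monom 1 n - [:e:]" n] assms(2) by simp
  then obtain c where "poly (monom 1 n - [:e:]) c = 0" using ac unfolding alg_closed_def by blast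
  then show ?thesis by (auto simp: poly_monom)
qed

lemma vring_unit_root:
  assumes W: "vring W" and n: "n > 0" and z: "z ^ n \<in> W" "inverse (z ^ n) \<in> W"
  shows "z \<in> W" "inverse z \<in> W"
  using z vring_power_iff[OF W n, of z] vring_power_iff[OF W n, of "inverse z"] by (simp_all add: power_inverse)

text \<open>Multiplication by such a factor changes neither membership in \<open>W\<close> nor the
  residue of an element of \<open>W\<close>, so these factors can be collected and ignored.\<close>

definition one_unit :: "'a::field set \<Rightarrow> 'a \<Rightarrow> bool" where
  "one_unit W s \<longleftrightarrow> s - 1 \<in> max_ideal W"

lemma
  assumes W: "vring W" and s: "one_unit W s"
  shows one_unit_mem: "s \<in> W" and one_unit_nonzero: "s \<noteq> 0" and one_unit_inverse_mem: "inverse s \<in> W"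
    and one_unit_inverse: "one_unit W (inverse s)"
proof -
  note S = valuation_ring_subring[OF W] note M = vring_prime[OF W]
  have s': "s - 1 \<in> max_ideal W" using s by (simp add: one_unit_def)
  then have "s - 1 \<in> W" using prime_ideal_ofD(1)[OF M] by blast
  from subring_add[OF S this subring_1[OF S]] show mem: "s \<in> W" by simp
  have nM: "s \<notin> max_ideal W"
    using prime_ideal_diff[OF S M _ s', of s] prime_ideal_ofD(3)[OF M] by auto
  then show s0: "s \<noteq> 0" and inv: "inverse s \<in> W" using mem by (auto simp: max_ideal_iff)
  have "- (inverse s * (s - 1)) \<in> max_ideal W"
    by (intro prime_ideal_uminus[OF S M] prime_ideal_ofD(5)[OF M inv s'])
  moreover have "- (inverse s * (s - 1)) = inverse s - 1" using s0 by (simp add: field_simps)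
  ultimately show "one_unit W (inverse s)" by (simp add: one_unit_def)
qed

lemma one_unit_1: "vring W \<Longrightarrow> one_unit W 1"
  using prime_ideal_ofD(2)[OF vring_prime] by (simp add: one_unit_def)

lemma one_unit_mult:
  assumes W: "vring W" and s: "one_unit W s" and r: "one_unit W r" shows "one_unit W (s * r)"
proof -
  note M = vring_prime[OF W]
  have "s * r - 1 = s * (r - 1) + (s - 1)" by (simp add: algebra_simps)
  moreover have "s * (r - 1) + (s - 1) \<in> max_ideal W"
    using s r one_unit_mem[OF W s] by (intro prime_ideal_ofD(4,5)[OF M]) (auto simp: one_unit_def)
  ultimately show ?thesis by (simp only: one_unit_def)
qed

lemma lin_fr_altdef: "c \<noteq> 0 \<Longrightarrow> lin_fr \<alpha> c = Fract [:- \<alpha>, 1:] 1 / const_fr c"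
  by (simp add: lin_fr_def const_fr_def eq_fract field_simps)

text \<open>Suppose that every unit of the form \<open>(X - \<alpha>) / c\<close> is congruent to a constant.  Then every linear
  polynomial is, up to a factor congruent to \<open>1\<close>, a constant multiple of \<open>1\<close> or of a fixed \<open>Z = X - \<beta>\<close>
  whose value does not lie in the value group of \<open>U\<close>; hence every rational function is a constant
  multiple of a power of \<open>Z\<close>, and the units among them are congruent to constants.\<close>

lemma exists_linear_residue_nonconst:
  fixes U :: "'k::field set"
  assumes ac: "alg_closed TYPE('k)" and W: "over U W"
    and t: "t \<in> W" "\<And>d. d \<in> U \<Longrightarrow> t - const_fr d \<notin> max_ideal W"
  shows "\<exists>\<alpha> c. c \<noteq> 0 \<and> lin_fr \<alpha> c \<in> W \<and> (\<forall>d\<in>U. lin_fr \<alpha> c - const_fr d \<notin> max_ideal W)"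
proof (rule ccontr)
  assume "\<not> ?thesis"
  then have H: "\<exists>d\<in>U. lin_fr \<alpha> c - const_fr d \<in> max_ideal W" if "c \<noteq> 0" "lin_fr \<alpha> c \<in> W" for \<alpha> c
    using that by blast
  have vW: "vring W" and cW: "\<And>x. const_fr x \<in> W \<longleftrightarrow> x \<in> U" using W by (auto simp: over_def)
  note S = valuation_ring_subring[OF vW] note M = vring_prime[OF vW]
  define L where "L a = Fract [:- a, 1:] (1 :: 'k poly)" for a :: 'k
  have L0: "L a \<noteq> 0" for a by (simp add: L_def Zero_fract_def eq_fract)
  have Ldiff: "L a = L b + const_fr (b - a)" for a b by (simp add: L_def const_fr_def)
  define unit where "unit x \<longleftrightarrow> x \<in> W \<and> inverse x \<in> W" for x
  have "\<exists>Z. Z \<noteq> 0 \<and> (Z = 1 \<or> (\<forall>c. c \<noteq> 0 \<longrightarrow> \<not> unit (Z / const_fr c))) \<and>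
      (\<forall>a. \<exists>e k s. e \<noteq> 0 \<and> one_unit W s \<and> L a = const_fr e * Z ^ k * s)"
  proof (cases "\<exists>b. \<forall>c. c \<noteq> 0 \<longrightarrow> \<not> unit (L b / const_fr c)")
    case True
    then obtain b where b: "\<And>c. c \<noteq> 0 \<Longrightarrow> \<not> unit (L b / const_fr c)" by blast
    have "\<exists>e k s. e \<noteq> 0 \<and> one_unit W s \<and> L a = const_fr e * L b ^ k * s" for a
    proof (cases "a = b")
      case True
      then show ?thesis using one_unit_1[OF vW]
        by (intro exI[of _ 1] exI[of _ "1::nat"]) (simp add: const_fr_hom)
    next
      case False
      define e where "e = const_fr (b - a)"
      have e0: "e \<noteq> 0" using False by (simp add: e_def const_fr_eq_0)
      have La: "L a = L b + e" by (simp add: e_def Ldiff[of a b])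
      have "\<not> unit (L b / e)" using b[of "b - a"] False by (simp add: e_def)
      \<comment> \<open>The values of \<open>L b\<close> and of the constant \<open>e\<close>
        differ, so their sum is dominated by one of the two and equals it up to a one-unit.\<close>
      then consider "L b / e \<notin> W" | "e / L b \<notin> W" by (auto simp: unit_def)
      then show ?thesis
      proof cases
        case 1
        then have "one_unit W (1 + e / L b)" using vring_not_in[OF vW 1] by (simp add: one_unit_def)
        moreover have "L a = const_fr 1 * L b ^ 1 * (1 + e / L b)"
          using La L0[of b] by (simp add: const_fr_hom field_simps)
        ultimately show ?thesis by (metis zero_neq_one)
      next
        case 2
        then have "one_unit W (1 + L b / e)" using vring_not_in[OF vW 2] by (simp add: one_unit_def)
        moreover have "L a = const_fr (b - a) * L b ^ 0 * (1 + L b / e)"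
          using La e0 by (simp add: e_def field_simps)
        ultimately show ?thesis using False by (metis right_minus_eq)
      qed
    qed
    then show ?thesis using b L0[of b] by blast
  next
    case False
    have "\<exists>e k s. e \<noteq> 0 \<and> one_unit W s \<and> L a = const_fr e * 1 ^ k * s" for a
    proof -
      obtain c where c: "c \<noteq> 0" "unit (L a / const_fr c)" using False by blast
      have lc: "lin_fr a c = L a / const_fr c" using c(1) by (simp add: lin_fr_altdef L_def)
      then obtain d where d: "d \<in> U" "L a / const_fr c - const_fr d \<in> max_ideal W"
        using H[OF c(1), of a] c(2) by (auto simp: unit_def)
      \<comment> \<open>\<open>L a / const_fr c\<close> is a unit, so its residue \<open>d\<close>
        is nonzero and can be absorbed into the constant.\<close>
      have "const_fr d \<notin> max_ideal W"
      proof
        assume "const_fr d \<in> max_ideal W"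
        then have "L a / const_fr c \<in> max_ideal W" using prime_ideal_ofD(4)[OF M d(2)] by force
        then show False using c L0[of a] by (simp add: max_ideal_iff unit_def const_fr_eq_0)
      qed
      then have d': "d \<noteq> 0" "inverse (const_fr d) \<in> W"
        using d(1) cW by (auto simp: max_ideal_iff const_fr_eq_0)
      have "inverse (const_fr d) * (L a / const_fr c - const_fr d) \<in> max_ideal W"
        by (rule prime_ideal_ofD(5)[OF M d'(2) d(2)])
      moreover have "inverse (const_fr d) * (L a / const_fr c - const_fr d) = L a / const_fr (c * d) - 1"
        using c(1) d'(1) by (simp add: const_fr_hom field_simps const_fr_eq_0)
      ultimately have "one_unit W (L a / const_fr (c * d))" by (simp add: one_unit_def)
      moreover have "L a = const_fr (c * d) * 1 ^ 0 * (L a / const_fr (c * d))"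
        using c(1) d'(1) by (simp add: const_fr_eq_0)
      moreover have "c * d \<noteq> 0" using c(1) d'(1) by simp
      ultimately show ?thesis by blast
    qed
    then show ?thesis by (intro exI[of _ 1]) simp
  qed
  then obtain Z where Z: "Z \<noteq> 0" "Z = 1 \<or> (\<forall>c. c \<noteq> 0 \<longrightarrow> \<not> unit (Z / const_fr c))"
    and ZL: "\<And>a. \<exists>e k s. e \<noteq> 0 \<and> one_unit W s \<and> L a = const_fr e * Z ^ k * s" by blast
  have ZP: "\<exists>e k s. e \<noteq> 0 \<and> one_unit W s \<and> Fract p 1 = const_fr e * Z ^ k * s" if "p \<noteq> 0" for p
  proof -
    obtain as where as: "p = smult (lead_coeff p) (\<Prod>a\<leftarrow>as. [:- a, 1:])"
      using alg_closed_factor[OF ac \<open>p \<noteq> 0\<close>] by blast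
    have "\<exists>e k s. e \<noteq> 0 \<and> one_unit W s \<and> Fract (\<Prod>a\<leftarrow>as. [:- a, 1:]) 1 = const_fr e * Z ^ k * s" for as
    proof (induction as)
      case Nil
      show ?case using one_unit_1[OF vW]
        by (intro exI[of _ 1] exI[of _ "0::nat"]) (simp add: const_fr_hom One_fract_def)
    next
      case (Cons a as)
      then obtain e k s where 1: "e \<noteq> 0" "one_unit W s" "Fract (\<Prod>a\<leftarrow>as. [:- a, 1:]) 1 = const_fr e * Z ^ k * s"
        by blast
      obtain e' k' s' where 2: "e' \<noteq> 0" "one_unit W s'" "L a = const_fr e' * Z ^ k' * s'" using ZL by blast
      have "Fract (\<Prod>a\<leftarrow>a # as. [:- a, 1:]) 1 = L a * Fract (\<Prod>a\<leftarrow>as. [:- a, 1:]) 1"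
        by (simp only: L_def mult_fract list.map prod_list.Cons mult_1_right)
      also have "\<dots> = const_fr (e' * e) * Z ^ (k' + k) * (s' * s)"
        by (simp add: 1 2 const_fr_hom power_add mult_ac)
      finally show ?case using one_unit_mult[OF vW 2(2) 1(2)] 1(1) 2(1) by (metis mult_eq_0_iff)
    qed
    then obtain e k s where 1: "e \<noteq> 0" "one_unit W s" "Fract (\<Prod>a\<leftarrow>as. [:- a, 1:]) 1 = const_fr e * Z ^ k * s"
      by blast
    have "Fract p 1 = const_fr (lead_coeff p) * Fract (\<Prod>a\<leftarrow>as. [:- a, 1:]) 1"
      by (subst as) (simp add: const_fr_def)
    then have "Fract p 1 = const_fr (lead_coeff p * e) * Z ^ k * s" by (simp add: 1 const_fr_hom mult_ac)
    then show ?thesis using 1 that by (metis leading_coeff_0_iff mult_eq_0_iff)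
  qed
  have U0: "0 \<in> U" using cW[of 0] subring_0[OF S] by (simp add: const_fr_hom)
  have t_unit: "t \<noteq> 0" "inverse t \<in> W"
    using t(2)[OF U0] t(1) by (auto simp: const_fr_hom max_ideal_iff)
  obtain p q where pq: "t = Fract p q" "q \<noteq> 0" by (cases t)
  have "p \<noteq> 0" using t_unit(1) pq by (auto simp: fract_collapse)
  then obtain e k s where 1: "e \<noteq> 0" "one_unit W s" "Fract p 1 = const_fr e * Z ^ k * s" using ZP by blast
  obtain e' k' s' where 2: "e' \<noteq> 0" "one_unit W s'" "Fract q 1 = const_fr e' * Z ^ k' * s'" using ZP[OF pq(2)] by blast
  define a r where "a = e / e'" and "r = s * inverse s'"
  have a0: "a \<noteq> 0" using 1 2 by (simp add: a_def)
  have r: "one_unit W r" unfolding r_def by (intro one_unit_mult[OF vW] one_unit_inverse[OF vW] 1 2)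
  have "t = Fract p 1 / Fract q 1" by (simp add: pq)
  then have tZ: "t * Z ^ k' = const_fr a * Z ^ k * r"
    using 1 2 one_unit_nonzero[OF vW 2(2)] Z(1)
    by (simp add: a_def r_def const_fr_divide const_fr_eq_0 field_simps)
  have absurd: False if "t = const_fr a * r"
  proof -
    have "const_fr a = t * inverse r" using that one_unit_nonzero[OF vW r] by simp
    then have aW: "const_fr a \<in> W" using subring_mult[OF S t(1) one_unit_inverse_mem[OF vW r]] by simp
    have "t - const_fr a = const_fr a * (r - 1)" using that by (simp add: algebra_simps)
    then have "t - const_fr a \<in> max_ideal W" using prime_ideal_ofD(5)[OF M aW] r by (simp add: one_unit_def)
    then show False using t(2) aW cW by blast
  qed
  show False
  proof (cases "Z = 1 \<or> k = k'")
    case True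
    then show ?thesis using absurd tZ Z(1) by auto
  next
    case False
    have tr: "t * inverse r \<in> W" "inverse t * r \<in> W"
      using subring_mult[OF S] t(1) t_unit(2) one_unit_inverse_mem[OF vW r] one_unit_mem[OF vW r] by blast+
    have nz: "r \<noteq> 0" "const_fr a \<noteq> 0" using one_unit_nonzero[OF vW r] a0 by (simp_all add: const_fr_eq_0)
    obtain n b where n: "n > 0" "b \<noteq> 0" "unit (Z ^ n / const_fr b)"
    proof (cases "k' < k")
      case True
      then have "Z ^ k = Z ^ (k - k') * Z ^ k'" by (simp flip: power_add)
      then have "t = const_fr a * Z ^ (k - k') * r" using tZ Z(1) by (simp add: mult_ac)
      then have "Z ^ (k - k') / const_fr (inverse a) = t * inverse r"
        using nz by (simp add: const_fr_inverse divide_inverse)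
      moreover have "inverse (t * inverse r) = inverse t * r" by simp
      ultimately show ?thesis using tr True a0 by (intro that[of "k - k'" "inverse a"]) (auto simp: unit_def)
    next
      case gt: False
      then have "Z ^ k' = Z ^ (k' - k) * Z ^ k" by (simp flip: power_add)
      then have "t * Z ^ (k' - k) = const_fr a * r" using tZ Z(1) by (simp add: mult_ac)
      then have "Z ^ (k' - k) / const_fr a = inverse t * r"
        using nz t_unit(1) by (simp add: field_simps)
      moreover have "inverse (inverse t * r) = t * inverse r" by simp
      ultimately show ?thesis using tr gt False a0 by (intro that[of "k' - k" a]) (auto simp: unit_def)
    qed
    \<comment> \<open>A positive power of \<open>Z\<close> has the value of the constant
      \<open>b\<close>. The value group of \<open>U\<close> is divisible, since roots of
      \<open>b\<close> exist, so \<open>Z\<close> itself would have the value of a constant.\<close>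
    obtain c where c: "c ^ n = b" using alg_closed_root[OF ac n(1)] by blast
    have "c \<noteq> 0" using c n(1,2) by auto
    moreover have "(Z / const_fr c) ^ n = Z ^ n / const_fr b" by (simp add: power_divide c flip: const_fr_power)
    then have "unit (Z / const_fr c)"
      using vring_unit_root[OF vW n(1), of "Z / const_fr c"] n(3) by (simp add: unit_def)
    ultimately show False using Z(2) False by blast
  qed
qed

subsection \<open>Orbits of balls\<close>

locale valued_alg_closure =
  fixes K V U :: "'k::field set" and u :: "'k \<Rightarrow> 'g::linordered_ab_group_add"
  assumes ac: "alg_closed TYPE('k)" and K: "subfield_of K" and alg: "algebraic_over K"
    and V: "valuation_ring_of K V" and val: "is_valuation_of u U" and UK: "U \<inter> K = V"
begin

lemmas vU = vring_U[OF val]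
lemmas SU = valuation_ring_subring[OF vU]
lemmas MU = vring_prime[OF vU]

lemma max_ideal_V: "max_ideal V = max_ideal U \<inter> K"
  using max_ideal_Int_subfield[OF K, of U] UK by simp

lemma commensurable:
  assumes "x \<noteq> 0"
  obtains n b where "n > 0" "b \<in> K" "b \<noteq> 0" "x ^ n / b \<in> U" "b / x ^ n \<in> U"
  using algebraic_overD[OF alg, of x] power_commensurable[OF vU K _ _ _ assms] by metis

text \<open>If n \<delta> = u b with \<open>b\<close> in \<open>K\<close>, then \<delta> is the
  value of an n-th root of \<open>b\<close>, as ordered groups are torsion-free; the converse is
  \<open>commensurable\<close>. Balls and monomial rings may thus be indexed by nonzero elements
  \<open>c\<close>.\<close>

lemma Gamma_bar_iff: "\<delta> \<in> Gamma_bar u K \<longleftrightarrow> (\<exists>c. c \<noteq> 0 \<and> u c = \<delta>)"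
proof
  assume "\<delta> \<in> Gamma_bar u K"
  then obtain n b where n: "n > 0" "b \<in> K" "b \<noteq> 0" "gmul n \<delta> = u b" by (auto simp: Gamma_bar_def)
  obtain c where c: "c ^ n = b" using alg_closed_root[OF ac n(1)] by blast
  then have "c \<noteq> 0" using n by auto
  moreover from this have "gmul n (u c) = gmul n \<delta>" using val_power[OF val, of c n] c n by simp
  ultimately show "\<exists>c. c \<noteq> 0 \<and> u c = \<delta>" using n(1) by (auto simp: gmul_inject)
next
  assume "\<exists>c. c \<noteq> 0 \<and> u c = \<delta>"
  then obtain c where c: "c \<noteq> 0" "u c = \<delta>" by blast
  obtain n b where n: "n > 0" "b \<in> K" "b \<noteq> 0" "c ^ n / b \<in> U" "b / c ^ n \<in> U" using commensurable[OF c(1)] by blast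
  then have "u (c ^ n) = u b" using c(1) val_le_iff[OF val] by (intro antisym) auto
  then have "gmul n \<delta> = u b" using c val_power[OF val] by simp
  then show "\<delta> \<in> Gamma_bar u K" using n by (auto simp: Gamma_bar_def)
qed

section \<open>The decomposition group and its action on monomial valuations\<close>

lemma decompD:
  assumes "\<sigma> \<in> decomp_group K U"
  shows "\<sigma> \<in> Gal K" "\<sigma> x \<in> U \<longleftrightarrow> x \<in> U"
proof -
  show g: "\<sigma> \<in> Gal K" using assms by (simp add: decomp_group_def)
  have "inj \<sigma>" using g by (auto simp: Gal_def bij_def)
  moreover have "\<sigma> ` U = U" using assms by (simp add: decomp_group_def)
  ultimately show "\<sigma> x \<in> U \<longleftrightarrow> x \<in> U" by (metis inj_image_mem_iff)
qed

lemma decomp_id: "(\<lambda>x. x) \<in> decomp_group K U"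
  using Gal_id by (simp add: decomp_group_def)

lemma decomp_comp: "\<sigma> \<in> decomp_group K U \<Longrightarrow> \<tau> \<in> decomp_group K U \<Longrightarrow> \<sigma> \<circ> \<tau> \<in> decomp_group K U"
  using Gal_comp[of \<sigma> K \<tau>] image_comp[of \<sigma> \<tau> U] by (metis (mono_tags, lifting) decomp_group_def mem_Collect_eq)

lemma decomp_inverse:
  assumes "\<sigma> \<in> decomp_group K U"
  obtains \<tau> where "\<tau> \<in> decomp_group K U" "\<And>x. \<tau> (\<sigma> x) = x" "\<And>x. \<sigma> (\<tau> x) = x"
proof -
  obtain \<tau> where \<tau>: "\<tau> \<in> Gal K" "\<And>x. \<tau> (\<sigma> x) = x" "\<And>x. \<sigma> (\<tau> x) = x"
    using Gal_inverse[OF decompD(1)[OF assms]] by blast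
  have "\<tau> ` U = \<tau> ` \<sigma> ` U" using assms by (simp add: decomp_group_def)
  also have "\<dots> = U" using \<tau>(2) by (simp add: image_comp)
  finally show thesis using that \<tau> by (auto simp: decomp_group_def)
qed

text \<open>Preserving the ring \<open>U\<close> would a priori allow a nontrivial order
  automorphism of the value group. Comparing a power of x with an element of \<open>K\<close>, which
  \<sigma> fixes, excludes it.\<close>

lemma val_decomp:
  assumes s: "\<sigma> \<in> decomp_group K U" and x: "x \<noteq> 0" shows "u (\<sigma> x) = u x"
proof -
  note hom = Gal_hom[OF decompD(1)[OF s]]
  obtain n b where n: "n > 0" "b \<in> K" "b \<noteq> 0" "x ^ n / b \<in> U" "b / x ^ n \<in> U" using commensurable[OF x] by blast
  have sx: "\<sigma> x \<noteq> 0" using field_hom_eq_0[OF hom] x by simp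
  have "\<sigma> (x ^ n / b) = \<sigma> x ^ n / b" "\<sigma> (b / x ^ n) = b / \<sigma> x ^ n"
    using Gal_const[OF decompD(1)[OF s] n(2)]
    by (simp_all add: divide_inverse field_hom_mult[OF hom] field_hom_inverse[OF hom] field_hom_power[OF hom])
  then have "\<sigma> x ^ n / b \<in> U" "b / \<sigma> x ^ n \<in> U" using n decompD(2)[OF s] by metis+
  then have "u (\<sigma> x ^ n) = u b" "u (x ^ n) = u b" using n x sx val_le_iff[OF val] by (auto intro: antisym)
  then have "gmul n (u (\<sigma> x)) = gmul n (u x)" using val_power[OF val] x sx by simp
  then show ?thesis using n(1) by (simp add: gmul_inject)
qed

lemma mon_val_decomp:
  assumes s: "\<sigma> \<in> decomp_group K U"
  shows "mon_val u (\<sigma> \<alpha>) \<delta> (map_poly \<sigma> p) = mon_val u \<alpha> \<delta> p"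
proof -
  note hom = Gal_hom[OF decompD(1)[OF s]]
  have "pcompose (map_poly \<sigma> p) (map_poly \<sigma> q) = map_poly \<sigma> (pcompose p q)" for q
    by (induction p) (simp_all add: pcompose_pCons map_poly_hom_pCons[OF hom] map_poly_hom_add[OF hom]
        map_poly_hom_mult[OF hom])
  from this[of "[:\<alpha>, 1:]"]
  have "coeff (pcompose (map_poly \<sigma> p) [:\<sigma> \<alpha>, 1:]) i = \<sigma> (coeff (pcompose p [:\<alpha>, 1:]) i)" for i
    by (simp add: map_poly_hom_pCons[OF hom] field_hom_1[OF hom] coeff_map_hom[OF hom])
  moreover from this have "coeff (pcompose (map_poly \<sigma> p) [:\<sigma> \<alpha>, 1:]) i \<noteq> 0 \<longleftrightarrow>
      coeff (pcompose p [:\<alpha>, 1:]) i \<noteq> 0" for i by (simp add: field_hom_eq_0[OF hom])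
  ultimately have "{u (coeff (pcompose (map_poly \<sigma> p) [:\<sigma> \<alpha>, 1:]) i) + gmul i \<delta> | i.
        coeff (pcompose (map_poly \<sigma> p) [:\<sigma> \<alpha>, 1:]) i \<noteq> 0} =
      {u (coeff (pcompose p [:\<alpha>, 1:]) i) + gmul i \<delta> | i. coeff (pcompose p [:\<alpha>, 1:]) i \<noteq> 0}"
    using val_decomp[OF s] by (intro Collect_cong ex_cong1) auto
  then show ?thesis by (simp add: mon_val_def)
qed

lemma map_fract_U_ad:
  assumes s: "\<sigma> \<in> decomp_group K U"
  shows "map_fract \<sigma> ` U_ad u \<alpha> \<delta> = U_ad u (\<sigma> \<alpha>) \<delta>"
proof -
  have sub: "map_fract \<sigma> ` U_ad u \<alpha> \<delta> \<subseteq> U_ad u (\<sigma> \<alpha>) \<delta>" if s: "\<sigma> \<in> decomp_group K U" for \<sigma> \<alpha>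
  proof safe
    fix f assume "f \<in> U_ad u \<alpha> \<delta>"
    then obtain p q where pq: "q \<noteq> 0" "f = Fract p q" "p = 0 \<or> mon_val u \<alpha> \<delta> q \<le> mon_val u \<alpha> \<delta> p"
      by (auto simp: U_ad_def)
    note hom = Gal_hom[OF decompD(1)[OF s]]
    have "map_poly \<sigma> q \<noteq> 0" "map_fract \<sigma> f = Fract (map_poly \<sigma> p) (map_poly \<sigma> q)"
      using pq by (auto simp: map_fract_Fract[OF hom] map_poly_hom_eq_0[OF hom])
    moreover have "map_poly \<sigma> p = 0 \<or> mon_val u (\<sigma> \<alpha>) \<delta> (map_poly \<sigma> q) \<le> mon_val u (\<sigma> \<alpha>) \<delta> (map_poly \<sigma> p)"
      using pq(3) by (auto simp: mon_val_decomp[OF s])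
    ultimately show "map_fract \<sigma> f \<in> U_ad u (\<sigma> \<alpha>) \<delta>" unfolding U_ad_def by blast
  qed
  obtain \<tau> where \<tau>: "\<tau> \<in> decomp_group K U" "\<And>x. \<tau> (\<sigma> x) = x" "\<And>x. \<sigma> (\<tau> x) = x"
    using decomp_inverse[OF s] by blast
  have "\<sigma> \<circ> \<tau> = (\<lambda>x. x)" using \<tau>(3) by auto
  then have "map_fract \<sigma> (map_fract \<tau> f) = f" for f
    using map_fract_comp[OF Gal_hom[OF decompD(1)[OF s]] Gal_hom[OF decompD(1)[OF \<tau>(1)]], of f]
    by (simp add: map_fract_id)
  moreover have "map_fract \<tau> f \<in> U_ad u \<alpha> \<delta>" if "f \<in> U_ad u (\<sigma> \<alpha>) \<delta>" for f
    using sub[OF \<tau>(1), of "\<sigma> \<alpha>"] \<tau>(2) that by auto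
  ultimately have "U_ad u (\<sigma> \<alpha>) \<delta> \<subseteq> map_fract \<sigma> ` U_ad u \<alpha> \<delta>" by (metis imageI subsetI)
  then show ?thesis using sub[OF s] by blast
qed

lemma map_fract_Int_KX:
  assumes s: "\<sigma> \<in> Gal K" shows "map_fract \<sigma> ` W \<inter> KX K = W \<inter> KX K"
proof -
  have inj: "inj (map_fract \<sigma>)" by (rule field_hom_inj[OF field_hom_map_fract[OF Gal_hom[OF s]]])
  have "f \<in> map_fract \<sigma> ` W \<longleftrightarrow> f \<in> W" if "f \<in> KX K" for f
    using map_fract_KX[OF s that] inj by (metis inj_image_mem_iff)
  then show ?thesis by blast
qed

section \<open>Equality of balls and equality of monomial rings\<close>

lemma ball_iff: "c \<noteq> 0 \<Longrightarrow> x \<in> ball_u u \<alpha> (u c) \<longleftrightarrow> (x - \<alpha>) / c \<in> U"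
proof (cases "x = \<alpha>")
  case False
  then show "c \<noteq> 0 \<Longrightarrow> ?thesis" using val_le_iff[OF val, of "x - \<alpha>" c] by (simp add: ball_u_def)
qed (use subring_0[OF SU] in \<open>simp add: ball_u_def\<close>)

lemma image_ball:
  assumes s: "\<sigma> \<in> decomp_group K U" shows "\<sigma> ` ball_u u \<alpha> \<delta> = ball_u u (\<sigma> \<alpha>) \<delta>"
proof -
  note hom = Gal_hom[OF decompD(1)[OF s]]
  have mem: "\<sigma> x \<in> ball_u u (\<sigma> \<alpha>) \<delta> \<longleftrightarrow> x \<in> ball_u u \<alpha> \<delta>" for x
    using val_decomp[OF s, of "x - \<alpha>"] field_hom_inj[OF hom]
    by (cases "x = \<alpha>") (auto simp: ball_u_def field_hom_diff[OF hom, symmetric] inj_eq)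
  have "surj \<sigma>" using decompD(1)[OF s] by (auto simp: Gal_def bij_def)
  moreover have "\<sigma> -` ball_u u (\<sigma> \<alpha>) \<delta> = ball_u u \<alpha> \<delta>" using mem by auto
  ultimately show ?thesis using surj_image_vimage_eq by metis
qed

text \<open>A converse of \<open>over_eval\<close>: with the content \<open>e\<close> pulled out,
  the primitive part is a unit at Y, so \<open>e\<close> lies in \<open>U\<close>. Integrality of a
  polynomial in Y is thus tested on its coefficients.\<close>

lemma eval_lin_fr_mem:
  assumes c: "c \<noteq> 0" and p: "eval_fr p (lin_fr \<alpha> c) \<in> U_ad u \<alpha> (u c)"
  shows "p \<in> polys_in U"
proof (cases "p = 0")
  case False
  let ?W = "U_ad u \<alpha> (u c)" and ?Y = "lin_fr \<alpha> c"
  note oW = over_U_ad[OF val c, of \<alpha>] note vW = vring_U_ad[OF val c, of \<alpha>]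
  obtain e q where e: "e \<noteq> 0" "primitive_over U q" "p = smult e q" using primitive_factorization[OF vU False] by blast
  have "eval_fr q ?Y \<in> ?W" using over_eval[OF oW lin_fr_U_ad(1)[OF val c]] e(2) by (simp add: primitive_over_def)
  then have z: "eval_fr q ?Y \<noteq> 0" "inverse (eval_fr q ?Y) \<in> ?W"
    using lin_fr_U_ad(2)[OF val c e(2), of \<alpha>] by (auto simp: max_ideal_iff)
  have "const_fr e * eval_fr q ?Y * inverse (eval_fr q ?Y) \<in> ?W"
    using subring_mult[OF valuation_ring_subring[OF vW] p z(2)] by (simp add: e(3) eval_fr_smult)
  then have "e \<in> U" using z oW by (simp add: over_def mult.assoc)
  then show ?thesis using e polys_in_smult[OF SU] by (simp add: primitive_over_def)
qed (simp add: polys_in_0 subring_0[OF SU])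

lemma lin_fr_change:
  assumes "c \<noteq> 0" "c' \<noteq> 0"
  shows "lin_fr \<alpha> c = eval_fr [:(\<beta> - \<alpha>) / c, c' / c:] (lin_fr \<beta> c')"
  using assms unfolding lin_fr_def[of \<beta>] eval_fr_Fract
  by (simp add: lin_fr_def pcompose_pCons field_simps)

lemma U_ad_eq_imp:
  assumes c: "c \<noteq> 0" "c' \<noteq> 0" and eq: "U_ad u \<alpha> (u c) = U_ad u \<beta> (u c')"
  shows "c' / c \<in> U" "(\<beta> - \<alpha>) / c \<in> U"
proof -
  have "lin_fr \<alpha> c \<in> U_ad u \<beta> (u c')" using lin_fr_U_ad(1)[OF val c(1), of \<alpha>] eq by simp
  from eval_lin_fr_mem[OF c(2) this[unfolded lin_fr_change[OF c, of \<alpha> \<beta>]]]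
  show "c' / c \<in> U" "(\<beta> - \<alpha>) / c \<in> U" by simp_all
qed

text \<open>If the residue of (X - \<alpha>) / c were algebraic, it would be a constant
  \<open>d\<close>. Then the coordinate change minus \<open>d\<close>, a linear polynomial with unit
  leading coefficient and so primitive, would have a value in the maximal ideal at (X - \<beta>) /
  c', which is impossible.\<close>

lemma U_ad_eqI:
  assumes c: "c \<noteq> 0" "c' \<noteq> 0" and *: "c' / c \<in> U" "c / c' \<in> U" "(\<beta> - \<alpha>) / c \<in> U"
  shows "U_ad u \<alpha> (u c) = U_ad u \<beta> (u c')"
proof (rule eq_U_ad[OF val c(1), symmetric])
  let ?W = "U_ad u \<beta> (u c')"
  show oW: "over U ?W" by (rule over_U_ad[OF val c(2)])
  show mem: "lin_fr \<alpha> c \<in> ?W"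
    unfolding lin_fr_change[OF c, of \<alpha> \<beta>]
    by (rule over_eval[OF oW lin_fr_U_ad(1)[OF val c(2)]]) (simp add: * polys_in_0 subring_0[OF SU])
  fix p assume p: "primitive_over U p"
  show "eval_fr p (lin_fr \<alpha> c) \<notin> max_ideal ?W"
  proof
    assume "eval_fr p (lin_fr \<alpha> c) \<in> max_ideal ?W"
    then obtain d where d: "d \<in> U" "lin_fr \<alpha> c - const_fr d \<in> max_ideal ?W"
      using residue_algebraic_imp_const[OF ac vU oW mem p] by blast
    have "lin_fr \<alpha> c - const_fr d = eval_fr [:(\<beta> - \<alpha>) / c - d, c' / c:] (lin_fr \<beta> c')"
      unfolding lin_fr_change[OF c, of \<alpha> \<beta>] by (simp add: const_fr_hom)
    moreover have "primitive_over U [:(\<beta> - \<alpha>) / c - d, c' / c:]"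
      using * d(1) c by (auto simp: primitive_over_def polys_in_0 subring_0[OF SU] max_ideal_iff intro: subring_diff[OF SU])
    ultimately show False using lin_fr_U_ad(2)[OF val c(2)] d(2) by metis
  qed
qed

text \<open>Both equalities amount to c / c' being a unit of \<open>U\<close> and (\<beta> -
  \<alpha>) / c lying in \<open>U\<close>: for rings by the affine change of coordinates, for balls
  by inspecting two points.\<close>

lemma ball_eq_iff_U_ad_eq:
  assumes c: "c \<noteq> 0" "c' \<noteq> 0"
  shows "ball_u u \<alpha> (u c) = ball_u u \<beta> (u c') \<longleftrightarrow> U_ad u \<alpha> (u c) = U_ad u \<beta> (u c')"
proof
  have half: "c / c' \<in> U \<and> (\<alpha> - \<beta>) / c' \<in> U"
    if c: "c \<noteq> 0" "c' \<noteq> 0" and eq: "ball_u u \<alpha> (u c) = ball_u u \<beta> (u c')" for c c' \<alpha> \<beta>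
  proof -
    \<comment> \<open>The center and one point at distance exactly \<open>u c\<close> recover both
      conditions.\<close>
    have "\<alpha> \<in> ball_u u \<alpha> (u c)" "\<alpha> + c \<in> ball_u u \<alpha> (u c)"
      using c subring_0[OF SU] subring_1[OF SU] by (simp_all add: ball_iff)
    then have 1: "(\<alpha> - \<beta>) / c' \<in> U" "(\<alpha> + c - \<beta>) / c' \<in> U" using eq c(2) by (simp_all add: ball_iff)
    have "c / c' = (\<alpha> + c - \<beta>) / c' - (\<alpha> - \<beta>) / c'" using c(2) by (simp add: field_simps)
    then show ?thesis using subring_diff[OF SU 1(2,1)] 1 by simp
  qed
  assume eq: "ball_u u \<alpha> (u c) = ball_u u \<beta> (u c')"
  show "U_ad u \<alpha> (u c) = U_ad u \<beta> (u c')"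
    using half[OF c eq] half[OF c(2,1) eq[symmetric]] by (intro U_ad_eqI[OF c]) auto
next
  assume eq: "U_ad u \<alpha> (u c) = U_ad u \<beta> (u c')"
  note 1 = U_ad_eq_imp[OF c eq] note 2 = U_ad_eq_imp[OF c(2,1) eq[symmetric]]
  have "(x - \<beta>) / c' \<in> U" if "(x - \<alpha>) / c \<in> U" for x
  proof -
    have "(x - \<beta>) / c' = (x - \<alpha>) / c * (c / c') + (\<alpha> - \<beta>) / c'" using c by (simp add: field_simps)
    then show ?thesis using subring_add[OF SU subring_mult[OF SU that 2(1)] 2(2)] by simp
  qed
  moreover have "(x - \<alpha>) / c \<in> U" if "(x - \<beta>) / c' \<in> U" for x
  proof -
    have "(x - \<alpha>) / c = (x - \<beta>) / c' * (c' / c) + (\<beta> - \<alpha>) / c" using c by (simp add: field_simps)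
    then show ?thesis using subring_add[OF SU subring_mult[OF SU that 1(1)] 1(2)] by simp
  qed
  ultimately show "ball_u u \<alpha> (u c) = ball_u u \<beta> (u c')" using c by (auto simp: ball_iff)
qed

section \<open>The restrictions of monomial rings to K(X) are exactly the residually transcendental
  extensions\<close>

lemma primitive_over_V:
  "p \<in> polys_in V \<Longrightarrow> p \<notin> polys_in (max_ideal V) \<Longrightarrow> primitive_over U p"
  unfolding max_ideal_V primitive_over_def polys_in_def using UK by auto

text \<open>Y itself need not lie in K(X). If \<open>f\<close> over \<open>K\<close> vanishes at
  \<alpha>, it is a polynomial in Y without constant term, and a power of \<open>f\<close> divided
  by a suitable \<open>b\<close> in \<open>K\<close> is a primitive such polynomial
  \<open>h\<close>. Were the residue of this element of K(X) a constant \<open>d\<close>, then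
  \<open>h - [:d:]\<close> would reduce to 0 and so would \<open>h\<close>, whose constant term is
  0.\<close>

lemma U_ad_res_transc:
  assumes c: "c \<noteq> 0" shows "U_ad u \<alpha> (u c) \<inter> KX K \<in> W_rt K V"
proof -
  let ?W = "U_ad u \<alpha> (u c)" and ?Y = "lin_fr \<alpha> c"
  note oW = over_U_ad[OF val c, of \<alpha>] note vW = vring_U_ad[OF val c, of \<alpha>]
  note KXf = subfield_KX[OF K]
  have "?W \<inter> KX K \<in> extensions K V"
    unfolding extensions_def using vring_Int_subfield[OF vW KXf] oW const_fr_KX[OF K] UK
    by (auto simp: over_def)
  moreover have "res_transc K V (?W \<inter> KX K)"
  proof -
    obtain f where f: "f \<noteq> 0" "f \<in> polys_in K" "poly f \<alpha> = 0" using algebraic_overD[OF alg] by blast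
    have "pcompose f [:\<alpha>, c:] \<noteq> 0" using pcompose_linear_eq_0[OF c] f(1) by simp
    then obtain e g where e: "e \<noteq> 0" "primitive_over U g" "pcompose f [:\<alpha>, c:] = smult e g"
      using primitive_factorization[OF vU] by blast
    have "coeff (smult e g) 0 = poly f \<alpha>"
      unfolding e(3)[symmetric] by (simp add: poly_0_coeff_0[symmetric] poly_pcompose)
    then have g0: "coeff g 0 = 0" using f(3) e(1) by simp
    \<comment> \<open>The exponent trades the content \<open>e\<close>, which may lie only in the
      algebraic closure, for an element \<open>b\<close> of \<open>K\<close> with the value of
      \<open>e ^ n\<close>.\<close>
    obtain n b where n: "n > 0" "b \<in> K" "b \<noteq> 0" "e ^ n / b \<in> U" "b / e ^ n \<in> U" using commensurable[OF e(1)] by blast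
    define h where "h = smult (e ^ n / b) (g ^ n)"
    have "primitive_over U (g ^ n)"
    proof -
      have "primitive_over U 1"
        using SU prime_ideal_ofD(3)[OF MU]
        by (auto simp: primitive_over_def one_pCons polys_in_0 subring_0 subring_1)
      then show ?thesis by (induction n) (auto intro: primitive_mult[OF vU e(2)])
    qed
    moreover have "e ^ n / b \<notin> max_ideal U" using n e(1) by (auto simp: max_ideal_iff)
    moreover from calculation have "g ^ n \<in> polys_in (max_ideal U)" if "h \<in> polys_in (max_ideal U)"
      unfolding polys_in_def
    proof (intro CollectI allI)
      fix i show "coeff (g ^ n) i \<in> max_ideal U"
        using prime_ideal_ofD(7)[OF MU n(4), of "coeff (g ^ n) i"] polys_inD[OF that, of i] calculation
        by (simp add: h_def primitive_over_def polys_in_def)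
    qed
    ultimately have h: "h \<in> polys_in U" "h \<notin> polys_in (max_ideal U)"
      using polys_in_smult[OF SU n(4), of "g ^ n"] unfolding h_def primitive_over_def by blast+
    have h0: "coeff h 0 = 0" using g0 n(1) by (simp add: h_def coeff_0_power)
    define t where "t = Fract (f ^ n) [:b:]"
    have "t = Fract f 1 ^ n / const_fr b" by (simp add: t_def const_fr_def Fract_power)
    also have "Fract f 1 = const_fr e * eval_fr g ?Y"
      using Fract_eq_eval_lin[OF c, of f \<alpha>] e(3) by (simp add: eval_fr_smult)
    also have "(const_fr e * eval_fr g ?Y) ^ n / const_fr b = eval_fr h ?Y"
    proof -
      have "eval_fr (g ^ n) ?Y = eval_fr g ?Y ^ n"
        by (induction n) (simp_all add: eval_fr_mult one_pCons const_fr_hom)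
      then show ?thesis by (simp add: h_def eval_fr_smult const_fr_divide const_fr_power power_mult_distrib)
    qed
    finally have th: "t = eval_fr h ?Y" .
    have tW: "t \<in> ?W" unfolding th by (rule over_eval[OF oW lin_fr_U_ad(1)[OF val c] h(1)])
    have tK: "t \<in> KX K"
      unfolding KX_iff t_def using n f subring_power[OF subring_polys_in[OF subfield_subring[OF K]] f(2)]
      by (intro exI[of _ "f ^ n"] exI[of _ "[:b:]"]) (auto simp: polys_in_0 subring_0[OF subfield_subring[OF K]])
    show ?thesis
      unfolding res_transc_def
    proof (intro bexI[of _ t] allI impI)
      fix p :: "'k poly" assume "\<forall>i. coeff p i \<in> V" "\<exists>i. coeff p i \<notin> max_ideal V"
      then have p: "primitive_over U p" by (intro primitive_over_V) (auto simp: polys_in_def)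
      show "(\<Sum>i\<le>degree p. const_fr (coeff p i) * t ^ i) \<notin> max_ideal (?W \<inter> KX K)"
      proof
        assume "(\<Sum>i\<le>degree p. const_fr (coeff p i) * t ^ i) \<in> max_ideal (?W \<inter> KX K)"
        then have "eval_fr p t \<in> max_ideal ?W"
          unfolding max_ideal_Int_subfield[OF KXf] by (simp add: eval_fr_altdef)
        then obtain d where d: "d \<in> U" "t - const_fr d \<in> max_ideal ?W"
          using residue_algebraic_imp_const[OF ac vU oW tW p] by blast
        have hd: "eval_fr (h - [:d:]) ?Y = t - const_fr d"
          using eval_fr_add[of "h - [:d:]" "[:d:]" ?Y] by (simp add: th const_fr_hom)
        have "h - [:d:] \<in> polys_in U"
          using h(1) d(1) by (intro subring_diff[OF subring_polys_in[OF SU]]) (auto simp: polys_in_0 subring_0[OF SU])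
        then have hM: "h - [:d:] \<in> polys_in (max_ideal U)"
          using lin_fr_U_ad(2)[OF val c, of "h - [:d:]" \<alpha>] d(2) hd by (auto simp: primitive_over_def)
        have "coeff h i \<in> max_ideal U" for i
          using polys_inD[OF hM, of i] h0 prime_ideal_ofD(2)[OF MU]
          by (cases i) auto
        then show False using h(2) by (simp add: polys_in_def)
      qed
    qed (use tW tK in blast)
  qed
  ultimately show ?thesis by (simp add: W_rt_def)
qed

lemma res_transc_imp_U_ad:
  assumes W: "W \<in> W_rt K V"
  obtains \<alpha> c where "c \<noteq> 0" "W = U_ad u \<alpha> (u c) \<inter> KX K"
proof -
  note KXf = subfield_KX[OF K]
  have vW: "valuation_ring_of (KX K) W" and cW: "\<And>c. c \<in> K \<Longrightarrow> const_fr c \<in> W \<longleftrightarrow> c \<in> V"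
    and rt: "res_transc K V W" using W by (auto simp: W_rt_def extensions_def)
  obtain W1 where W1: "vring W1" "W1 \<inter> KX K = W" using valuation_ring_extends[OF KXf vW] by blast
  \<comment> \<open>\<open>W1\<close> need not lie over \<open>U\<close>: its trace on the constants
    is only conjugate to \<open>U\<close>. So \<open>W1\<close> is moved by \<sigma>, which fixes
    K(X) pointwise.\<close>
  define U1 where "U1 = {x. const_fr x \<in> W1}"
  have "vring U1"
    using W1(1) unfolding valuation_ring_of_def U1_def
    by (auto simp: const_fr_hom const_fr_eq_0 const_fr_inverse)
  moreover have "U1 \<inter> K = U \<inter> K"
    using cW const_fr_KX[OF K] W1(2) UK by (auto simp: U1_def)
  ultimately obtain \<sigma> where \<sigma>: "\<sigma> \<in> Gal K" "\<sigma> ` U1 = U"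
    using Gal_conjugates_extensions[OF ac K alg _ vU] by blast
  note hom = Gal_hom[OF \<sigma>(1)]
  note fhom = field_hom_map_fract[OF hom]
  obtain \<tau> where \<tau>: "\<And>x. map_fract \<sigma> (map_fract \<tau> x) = x" "\<And>x. \<sigma> (\<tau> x) = x"
    using map_fract_inverse[OF \<sigma>(1)] by metis
  define W' where "W' = map_fract \<sigma> ` W1"
  have W'_iff: "map_fract \<sigma> x \<in> W' \<longleftrightarrow> x \<in> W1" for x
    unfolding W'_def using field_hom_inj[OF fhom] by (rule inj_image_mem_iff)
  have "vring W'"
    unfolding valuation_ring_of_def
  proof (intro conjI ballI impI)
    note S1 = valuation_ring_subring[OF W1(1)]
    show "0 \<in> W'" "1 \<in> W'"
      using W'_iff[of 0] W'_iff[of 1] subring_0[OF S1] subring_1[OF S1] field_hom_0[OF fhom] field_hom_1[OF fhom] by simp_all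
    show "x + y \<in> W'" "x - y \<in> W'" "x * y \<in> W'" if "x \<in> W'" "y \<in> W'" for x y
      using that W'_iff[of "map_fract \<tau> x"] W'_iff[of "map_fract \<tau> y"]
        W'_iff[of "map_fract \<tau> x + map_fract \<tau> y"] W'_iff[of "map_fract \<tau> x - map_fract \<tau> y"]
        W'_iff[of "map_fract \<tau> x * map_fract \<tau> y"] subring_add[OF S1] subring_diff[OF S1] subring_mult[OF S1]
      by (simp_all add: \<tau>(1) field_hom_add[OF fhom] field_hom_diff[OF fhom] field_hom_mult[OF fhom])
    show "x \<in> W' \<or> inverse x \<in> W'" for x
      using W'_iff[of "map_fract \<tau> x"] W'_iff[of "inverse (map_fract \<tau> x)"]
        valuation_ring_cases[OF W1(1), of "map_fract \<tau> x"]
      by (simp add: \<tau>(1) field_hom_inverse[OF fhom])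
  qed simp
  moreover have "const_fr x \<in> W' \<longleftrightarrow> x \<in> U" for x
  proof -
    have "const_fr x \<in> W' \<longleftrightarrow> \<tau> x \<in> U1"
      using W'_iff[of "const_fr (\<tau> x)"] by (simp add: map_fract_const[OF hom] \<tau>(2) U1_def)
    also have "\<dots> \<longleftrightarrow> x \<in> U"
      using inj_image_mem_iff[OF field_hom_inj[OF hom], of "\<tau> x" U1] \<sigma>(2) \<tau>(2) by simp
    finally show ?thesis .
  qed
  ultimately have oW: "over U W'" by (simp add: over_def)
  have W'K: "W' \<inter> KX K = W" unfolding W'_def map_fract_Int_KX[OF \<sigma>(1)] by (rule W1(2))
  obtain t where t: "t \<in> W" "\<And>p. p \<in> polys_in V \<Longrightarrow> p \<notin> polys_in (max_ideal V) \<Longrightarrow> eval_fr p t \<notin> max_ideal W"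
    using rt unfolding res_transc_def eval_fr_altdef polys_in_def by blast
  have tW: "t \<in> W'" "t \<in> KX K" using t(1) W'K by auto
  \<comment> \<open>Constant residues are algebraic over the residue field of \<open>V\<close>, so a
    constant residue of \<open>t\<close> would contradict its choice.\<close>
  have "t - const_fr d \<notin> max_ideal W'" if d: "d \<in> U" for d
  proof
    assume "t - const_fr d \<in> max_ideal W'"
    then obtain p where p: "p \<in> polys_in V" "p \<notin> polys_in (max_ideal V)" "eval_fr p t \<in> max_ideal W'"
      using residue_const_imp_algebraic[OF vU K alg oW tW(1) d] unfolding UK by blast
    have "eval_fr p t \<in> KX K"
      using p(1) by (induction p) (auto simp: const_fr_KX[OF K] UK[symmetric]
          intro!: subring_0[OF subfield_subring[OF KXf]] subring_add[OF subfield_subring[OF KXf]]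
            subring_mult[OF subfield_subring[OF KXf]] tW(2))
    then have "eval_fr p t \<in> max_ideal W"
      using p(3) max_ideal_Int_subfield[OF KXf, of W'] W'K by simp
    then show False using t(2) p(1,2) by blast
  qed
  then obtain \<alpha> c where c: "c \<noteq> 0" "lin_fr \<alpha> c \<in> W'" "\<And>d. d \<in> U \<Longrightarrow> lin_fr \<alpha> c - const_fr d \<notin> max_ideal W'"
    using exists_linear_residue_nonconst[OF ac oW tW(1)] by blast
  \<comment> \<open>A residue that is not constant is transcendental, so (X - \<alpha>) / c meets
    the criterion \<open>eq_U_ad\<close>.\<close>
  have "W' = U_ad u \<alpha> (u c)"
    using residue_algebraic_imp_const[OF ac vU oW c(2)] c(3) by (intro eq_U_ad[OF val c(1) oW c(2)]) blast
  then show thesis using that c(1) W'K by blast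
qed

section \<open>Orbits of balls and the bijection\<close>

definition ball_orbit :: "'k set \<Rightarrow> 'k set set" where
  "ball_orbit B = {\<sigma> ` B | \<sigma>. \<sigma> \<in> decomp_group K U}"

lemma ball_orbits_eq: "ball_orbits u K U = {ball_orbit (ball_u u \<alpha> (u c)) | \<alpha> c. c \<noteq> 0}"
proof -
  have "balls_u u K = {ball_u u \<alpha> (u c) | \<alpha> c. c \<noteq> 0}"
    unfolding balls_u_def Gamma_bar_iff by blast
  moreover have "ball_orbits u K U = ball_orbit ` balls_u u K"
    by (auto simp: ball_orbits_def ball_orbit_def)
  ultimately show ?thesis by (simp add: image_def) blast
qed

lemma ball_orbit_image:
  assumes s: "\<sigma> \<in> decomp_group K U" shows "ball_orbit (\<sigma> ` B) = ball_orbit B"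
proof -
  obtain \<tau> where \<tau>: "\<tau> \<in> decomp_group K U" "\<And>x. \<tau> (\<sigma> x) = x" "\<And>x. \<sigma> (\<tau> x) = x" using decomp_inverse[OF s] by blast
  have "\<rho> ` \<sigma> ` B \<in> ball_orbit B" if "\<rho> \<in> decomp_group K U" for \<rho>
    unfolding ball_orbit_def image_comp using decomp_comp[OF that s] by blast
  moreover have "\<rho> ` B \<in> ball_orbit (\<sigma> ` B)" if "\<rho> \<in> decomp_group K U" for \<rho>
  proof -
    have "\<rho> ` B = (\<rho> \<circ> \<tau>) ` \<sigma> ` B" by (simp add: image_comp \<tau>(2))
    then show ?thesis unfolding ball_orbit_def using decomp_comp[OF that \<tau>(1)] by blast
  qed
  ultimately show ?thesis unfolding ball_orbit_def by blast
qed

text \<open>There are two sources of ambiguity: a ball can be given by different centers and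
  scalars, which is settled by \<open>ball_eq_iff_U_ad_eq\<close>, and an orbit can contain
  different balls, which is harmless because \<sigma> moves the ring but fixes K(X).\<close>

lemma Theta_set_orbit:
  assumes c: "c \<noteq> 0"
  shows "{U_ad u \<beta> \<delta> \<inter> KX K | \<beta> \<delta>. \<delta> \<in> Gamma_bar u K \<and> ball_u u \<beta> \<delta> \<in> ball_orbit (ball_u u \<alpha> (u c))}
    = {U_ad u \<alpha> (u c) \<inter> KX K}" (is "?L = _")
proof
  show "?L \<subseteq> {U_ad u \<alpha> (u c) \<inter> KX K}"
  proof (rule subsetI)
    fix W assume "W \<in> ?L"
    then obtain \<beta> \<delta> where \<delta>: "\<delta> \<in> Gamma_bar u K" and ball: "ball_u u \<beta> \<delta> \<in> ball_orbit (ball_u u \<alpha> (u c))"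
      and W: "W = U_ad u \<beta> \<delta> \<inter> KX K" by blast
    obtain c' where c': "c' \<noteq> 0" "\<delta> = u c'" using \<delta> unfolding Gamma_bar_iff by blast
    obtain \<sigma> where \<sigma>: "\<sigma> \<in> decomp_group K U" "ball_u u \<beta> \<delta> = \<sigma> ` ball_u u \<alpha> (u c)"
      using ball by (auto simp: ball_orbit_def)
    then have "U_ad u \<beta> \<delta> = U_ad u (\<sigma> \<alpha>) (u c)"
      using ball_eq_iff_U_ad_eq[OF c'(1) c] by (simp add: c' image_ball)
    then have "U_ad u \<beta> \<delta> \<inter> KX K = U_ad u \<alpha> (u c) \<inter> KX K"
      using map_fract_U_ad[OF \<sigma>(1), of \<alpha> "u c"] map_fract_Int_KX[OF decompD(1)[OF \<sigma>(1)]] by metis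
    then show "W \<in> {U_ad u \<alpha> (u c) \<inter> KX K}" using W by simp
  qed
  have "ball_u u \<alpha> (u c) \<in> ball_orbit (ball_u u \<alpha> (u c))"
    unfolding ball_orbit_def using decomp_id by (intro CollectI exI[of _ "\<lambda>x. x"]) simp
  then show "{U_ad u \<alpha> (u c) \<inter> KX K} \<subseteq> ?L" using c Gamma_bar_iff by blast
qed

lemma Theta_orbit: "c \<noteq> 0 \<Longrightarrow> Theta u K (ball_orbit (ball_u u \<alpha> (u c))) = U_ad u \<alpha> (u c) \<inter> KX K"
  by (simp add: Theta_def Theta_set_orbit)

lemma Theta_inj:
  assumes c: "c \<noteq> 0" "c' \<noteq> 0" and eq: "U_ad u \<alpha> (u c) \<inter> KX K = U_ad u \<beta> (u c') \<inter> KX K"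
  shows "ball_orbit (ball_u u \<alpha> (u c)) = ball_orbit (ball_u u \<beta> (u c'))"
proof -
  obtain \<sigma> where \<sigma>: "\<sigma> \<in> Gal K" "map_fract \<sigma> ` U_ad u \<alpha> (u c) = U_ad u \<beta> (u c')"
    using Gal_conjugates_extensions_KX[OF ac K alg vring_U_ad[OF val c(1)] vring_U_ad[OF val c(2)] eq] by blast
  note hom = Gal_hom[OF \<sigma>(1)]
  have oa: "const_fr x \<in> U_ad u \<alpha> (u c) \<longleftrightarrow> x \<in> U" and ob: "const_fr x \<in> U_ad u \<beta> (u c') \<longleftrightarrow> x \<in> U" for x
    using over_U_ad[OF val c(1)] over_U_ad[OF val c(2)] by (auto simp: over_def)
  \<comment> \<open>Both rings lie over \<open>U\<close>, so reading the conjugation on constants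
    shows that \<sigma> preserves \<open>U\<close>.\<close>
  have mem: "\<sigma> x \<in> U \<longleftrightarrow> x \<in> U" for x
  proof -
    have "\<sigma> x \<in> U \<longleftrightarrow> map_fract \<sigma> (const_fr x) \<in> map_fract \<sigma> ` U_ad u \<alpha> (u c)"
      by (simp add: map_fract_const[OF hom] \<sigma>(2) ob)
    also have "\<dots> \<longleftrightarrow> x \<in> U"
      by (simp add: inj_image_mem_iff[OF field_hom_inj[OF field_hom_map_fract[OF hom]]] oa)
    finally show ?thesis .
  qed
  have "surj \<sigma>" using \<sigma>(1) by (auto simp: Gal_def bij_def)
  have "\<sigma> -` U = U" using mem by auto
  then have "\<sigma> ` U = U" using surj_image_vimage_eq[OF \<open>surj \<sigma>\<close>, of U] by simp
  then have d: "\<sigma> \<in> decomp_group K U" using \<sigma>(1) by (simp add: decomp_group_def)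
  have "U_ad u (\<sigma> \<alpha>) (u c) = U_ad u \<beta> (u c')" using map_fract_U_ad[OF d] \<sigma>(2) by metis
  then have "\<sigma> ` ball_u u \<alpha> (u c) = ball_u u \<beta> (u c')"
    using ball_eq_iff_U_ad_eq[OF c] by (simp add: image_ball[OF d])
  then show ?thesis using ball_orbit_image[OF d] by metis
qed

lemma Theta_bij: "bij_betw (Theta u K) (ball_orbits u K U) (W_rt K V)"
  unfolding bij_betw_def
proof
  show "inj_on (Theta u K) (ball_orbits u K U)"
  proof (rule inj_onI)
    fix O1 O2 assume O12: "O1 \<in> ball_orbits u K U" "O2 \<in> ball_orbits u K U" and eq: "Theta u K O1 = Theta u K O2"
    obtain \<alpha> c where 1: "c \<noteq> 0" "O1 = ball_orbit (ball_u u \<alpha> (u c))" using O12(1) unfolding ball_orbits_eq by blast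
    obtain \<beta> c' where 2: "c' \<noteq> 0" "O2 = ball_orbit (ball_u u \<beta> (u c'))" using O12(2) unfolding ball_orbits_eq by blast
    show "O1 = O2" using Theta_inj[OF 1(1) 2(1)] eq by (simp add: 1 2 Theta_orbit)
  qed
  show "Theta u K ` ball_orbits u K U = W_rt K V"
  proof
    show "Theta u K ` ball_orbits u K U \<subseteq> W_rt K V"
      unfolding ball_orbits_eq using Theta_orbit U_ad_res_transc by auto
    show "W_rt K V \<subseteq> Theta u K ` ball_orbits u K U"
    proof
      fix W assume "W \<in> W_rt K V"
      then obtain \<alpha> c where "c \<noteq> 0" "W = U_ad u \<alpha> (u c) \<inter> KX K" by (rule res_transc_imp_U_ad)
      then show "W \<in> Theta u K ` ball_orbits u K U"
        using Theta_orbit[of c \<alpha>] unfolding ball_orbits_eq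
        by (intro image_eqI[of _ _ "ball_orbit (ball_u u \<alpha> (u c))"]) (simp, blast)
    qed
  qed
qed

end

text \<open>\<open>Theta\<close> is defined through \<open>the_elem\<close>, so bijectivity alone
  would not express well-definedness. The first conjunct does: the set from which the value is taken
  is a singleton for every orbit.\<close>

theorem mainTheorem2:
  fixes K V U :: "'k::field set" and u :: "'k \<Rightarrow> 'g::linordered_ab_group_add"
  assumes "alg_closed TYPE('k)"
    and "subfield_of K"
    and "algebraic_over K"
    and "valuation_ring_of K V"
    and "is_valuation_of u U"
    and "U \<inter> K = V"
  shows "(\<forall>Ob\<in>ball_orbits u K U.
            is_singleton {U_ad u \<alpha> \<delta> \<inter> KX K | \<alpha> \<delta>. \<delta> \<in> Gamma_bar u K \<and> ball_u u \<alpha> \<delta> \<in> Ob})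
       \<and> bij_betw (Theta u K) (ball_orbits u K U) (W_rt K V)"
proof -
  interpret valued_alg_closure K V U u by unfold_locales fact+
  show ?thesis
    using Theta_bij Theta_set_orbit unfolding ball_orbits_eq by (auto simp: is_singleton_def)
qed

end
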